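(* Let $m\le n$ be positive integers, let $\Omega\subset\mathbb{R}^n$ be open, and let $\mathcal{H}_{m\leq n}\colon Bo(\Omega)\to[0,\infty]$ be the inductive volume measure of local dimension $m$ and ambient dimension $n$. (i) If $A\in Bo(\Omega)$ is covered by a sequence $(M_k)_{k\in\mathbb{N}}$ of $m$-dimensional submanifolds, then $$\mathcal{H}_{m\leq n}(A)=\sum_{k=1}^{\infty}\mu_{M_k}(A\cap M_k).$$ (ii) If $f$ is an integrable function with respect to $\mathcal{H}_{m\leq n}$ and $\{M_k\}_{k\in\mathbb{N}}$ is a disjoint sequence of $m$-dimensional submanifolds, then $$\int_{\bigcup_{k\in\mathbb{N}}M_k} f\,d\mathcal{H}_{m\leq n}=\sum_{k=1}^{\infty}\int f\,d\mu_{M_k}.$$ (iii) Likewise, if (for such a disjoint sequence $\{M_k\}_{k\in\mathbb{N}}$) $f$ is integrable with respect to $\mu_{M_k}$ for each $k\in\mathbb{N}$ and $$\sum_{k=1}^{\infty}\int f^{+}\,d\mu_{M_k}<\infty\quad\text{and}\quad\sum_{k=1}^{\infty}\int f^{-}\,d\mu_{M_k}<\infty,$$ then $f$ is integrable with respect to $\mathcal{H}_{m\leq n}$ and the formula in (ii) is valid.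
   Context: Submanifolds are submanifolds of $\mathbb{R}^n$ contained in $\Omega$, in the usual (smooth) sense of differential geometry, carrying the subspace topology and the Riemannian metric induced from $\mathbb{R}^n$; their Riemannian volume form is assumed to exist. $Bo(\Omega)$ is the Borel $\sigma$-algebra of $\Omega$. For an $m$-dimensional submanifold $M$ with volume form $dV_M$, the volume measure $\mu_M$ is the unique positive Borel measure on $M$ with $\int f\,d\mu_M=\int_M f\,dV_M$ for all continuous compactly supported $f$ on $M$. It is regarded as a Borel measure on $\Omega$ through $A\mapsto\mu_M(A\cap M)$. As usual, $f^{+}$ and $f^{-}$ are the positive and negative parts of $f$. Definition of $\mathcal{H}_{m\leq n}$. Let $\mathcal{C}_m$ be the class of Borel sets contained in some $m$-dimensional submanifold. For $C\in\mathcal{C}_m$ with $C\subset S$, $S$ such a submanifold, put $\mu_C(A)=\mu_S(A\cap C)$ for $A\in Bo(\Omega)$ (this does not depend on $S$). Let $I_m$ be the class of finite disjoint unions $\tilde M=\biguplus_{i=1}^{k}C_i$ of elements of $\mathcal{C}_m$, directed by inclusion, and put $\mu_{\tilde M}=\sum_{i=1}^{k}\mu_{C_i}$ (this does not depend on the decomposition). The inductive volume measure is the limit of the increasing net of measures $(\mu_{\tilde M})_{\tilde M\in I_m}$: $$\mathcal{H}_{m\leq n}(A)=\lim_{\tilde M\in I_m}\mu_{\tilde M}(A),\qquad A\in Bo(\Omega),$$ which is a measure on $Bo(\Omega)$.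
   Formalization: In (i) the overlaps A∩M_j∩M_k (j≠k) are assumed to be null for the volume measure, since the formula fails if M_1=M_2; in (iii) f is concluded to be integrable over the union of the M_k only, since nothing is assumed about f off that union. *)

theory Defs
  imports "HOL-Analysis.Analysis"
begin

section \<open>Smooth maps and submanifolds of Euclidean space\<close>

text \<open>
  The local dimension \<open>m\<close> and the ambient dimension \<open>n\<close> are the cardinalities of the index types
  \<open>'m\<close> and \<open>'n\<close>.
\<close>

primrec Ck_on :: "nat \<Rightarrow> 'a::euclidean_space set \<Rightarrow> ('a \<Rightarrow> 'b::real_normed_vector) \<Rightarrow> bool" where
  "Ck_on 0 S f \<longleftrightarrow> continuous_on S f"
| "Ck_on (Suc k) S f \<longleftrightarrow>
     (\<forall>x\<in>S. f differentiable (at x)) \<and> (\<forall>v. Ck_on k S (\<lambda>x. frechet_derivative f (at x) v))"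

text \<open>Meant for open \<open>S\<close>.\<close>

definition smooth_on :: "'a::euclidean_space set \<Rightarrow> ('a \<Rightarrow> 'b::real_normed_vector) \<Rightarrow> bool" where
  "smooth_on S f \<longleftrightarrow> (\<forall>k. Ck_on k S f)"

definition local_parametrization ::
    "(real^'n::finite) set \<Rightarrow> (real^'m::finite) set \<Rightarrow> (real^'m \<Rightarrow> real^'n) \<Rightarrow> bool" where
  "local_parametrization M W \<phi> \<longleftrightarrow>
     open W \<and> smooth_on W \<phi> \<and> (\<forall>x\<in>W. inj (frechet_derivative \<phi> (at x))) \<and>
     openin (top_of_set M) (\<phi> ` W) \<and> (\<exists>\<psi>. homeomorphism W (\<phi> ` W) \<phi> \<psi>)"

definition submanifold :: "'m::finite itself \<Rightarrow> (real^'n::finite) set \<Rightarrow> bool" where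
  "submanifold _ M \<longleftrightarrow>
     (\<forall>p\<in>M. \<exists>(W :: (real^'m) set) \<phi>. local_parametrization M W \<phi> \<and> p \<in> \<phi> ` W)"

definition tangent_space ::
    "'m::finite itself \<Rightarrow> (real^'n::finite) set \<Rightarrow> real^'n \<Rightarrow> (real^'n) set" where
  "tangent_space _ M p =
     {v. \<exists>(W :: (real^'m) set) \<phi> x. local_parametrization M W \<phi> \<and> x \<in> W \<and> \<phi> x = p \<and>
           v \<in> range (frechet_derivative \<phi> (at x))}"

definition coord_frame :: "(real^'m::finite \<Rightarrow> real^'n::finite) \<Rightarrow> real^'m \<Rightarrow> 'm \<Rightarrow> real^'n" where
  "coord_frame \<phi> x = (\<lambda>i. frechet_derivative \<phi> (at x) (axis i 1))"


section \<open>The Riemannian volume form and integration\<close>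

text \<open>
  An \<open>m\<close>-form assigns to a point a function of \<open>m\<close> vectors. Only its values at points of \<open>M\<close> on
  tangent vectors are meaningful.
\<close>

type_synonym ('m, 'n) form = "real^'n \<Rightarrow> ('m \<Rightarrow> real^'n) \<Rightarrow> real"

definition alternating_on :: "(real^'n::finite) set \<Rightarrow> (('m::finite \<Rightarrow> real^'n) \<Rightarrow> real) \<Rightarrow> bool" where
  "alternating_on T \<alpha> \<longleftrightarrow>
     (\<forall>v i. \<forall>x\<in>T. \<forall>y\<in>T. \<forall>a b. range v \<subseteq> T \<longrightarrow>
        \<alpha> (v(i := a *\<^sub>R x + b *\<^sub>R y)) = a * \<alpha> (v(i := x)) + b * \<alpha> (v(i := y))) \<and>
     (\<forall>v i j. range v \<subseteq> T \<and> i \<noteq> j \<and> v i = v j \<longrightarrow> \<alpha> v = 0)"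

definition smooth_form :: "(real^'n::finite) set \<Rightarrow> ('m::finite, 'n) form \<Rightarrow> bool" where
  "smooth_form M \<omega> \<longleftrightarrow>
     (\<forall>p\<in>M. alternating_on (tangent_space TYPE('m) M p) (\<omega> p)) \<and>
     (\<forall>W \<phi>. local_parametrization M W \<phi> \<longrightarrow> smooth_on W (\<lambda>x. \<omega> (\<phi> x) (coord_frame \<phi> x)))"

text \<open>
  A smooth form that is nowhere zero determines an orientation of \<open>M\<close>: a basis \<open>e\<close> of the tangent
  space at \<open>p\<close> is positive if \<open>\<omega> p e > 0\<close>. Such a form is the Riemannian volume form of \<open>M\<close> with
  this orientation if its value on positive orthonormal bases is 1, hence -1 on negative ones. In
  particular a Riemannian volume form exists iff \<open>M\<close> is orientable.
\<close>

definition riemannian_volume_form :: "(real^'n::finite) set \<Rightarrow> ('m::finite, 'n) form \<Rightarrow> bool" where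
  "riemannian_volume_form M \<omega> \<longleftrightarrow>
     smooth_form M \<omega> \<and>
     (\<forall>p\<in>M. \<forall>e. (\<forall>i. e i \<in> tangent_space TYPE('m) M p) \<and>
          (\<forall>i j. e i \<bullet> e j = (if i = j then 1 else 0)) \<longrightarrow> \<bar>\<omega> p e\<bar> = 1)"

definition positive_parametrization ::
    "(real^'n::finite) set \<Rightarrow> ('m::finite, 'n) form \<Rightarrow> (real^'m) set \<Rightarrow> (real^'m \<Rightarrow> real^'n) \<Rightarrow> bool" where
  "positive_parametrization M \<omega> W \<phi> \<longleftrightarrow>
     local_parametrization M W \<phi> \<and> (\<forall>x\<in>W. \<omega> (\<phi> x) (coord_frame \<phi> x) > 0)"

definition compactly_supported :: "(real^'n::finite) set \<Rightarrow> (real^'n \<Rightarrow> real) \<Rightarrow> bool" where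
  "compactly_supported M f \<longleftrightarrow> (\<exists>K. compact K \<and> K \<subseteq> M \<and> (\<forall>p\<in>M - K. f p = 0))"

text \<open>
  \<open>I\<close> is the integral of the form \<open>\<alpha>\<close> over \<open>M\<close> with the orientation given by \<open>\<omega>\<close>, computed from
  positive charts and a finite partition of unity \<open>\<rho>\<close> that is subordinate to them and sums to 1
  where \<open>\<alpha>\<close> is nonzero. The functions \<open>\<rho> i\<close> need only be continuous.
\<close>

definition has_form_integral ::
    "(real^'n::finite) set \<Rightarrow> ('m::finite, 'n) form \<Rightarrow> ('m, 'n) form \<Rightarrow> real \<Rightarrow> bool" where
  "has_form_integral M \<omega> \<alpha> I \<longleftrightarrow>
     (\<exists>(N::nat) W \<phi> \<rho>.
        (\<forall>i<N. positive_parametrization M \<omega> (W i) (\<phi> i) \<and>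
           continuous_on M (\<rho> i) \<and> (\<forall>p\<in>M. 0 \<le> \<rho> i p \<and> \<rho> i p \<le> 1) \<and>
           (\<exists>K. compact K \<and> K \<subseteq> \<phi> i ` W i \<and> (\<forall>p\<in>M - K. \<rho> i p = 0))) \<and>
        (\<forall>p\<in>M. \<alpha> p \<noteq> (\<lambda>_. 0) \<longrightarrow> (\<Sum>i<N. \<rho> i p) = 1) \<and>
        I = (\<Sum>i<N. LINT x:W i|lborel. \<rho> i (\<phi> i x) * \<alpha> (\<phi> i x) (coord_frame (\<phi> i) x)))"

definition form_integral ::
    "(real^'n::finite) set \<Rightarrow> ('m::finite, 'n) form \<Rightarrow> ('m, 'n) form \<Rightarrow> real" where
  "form_integral M \<omega> \<alpha> = (THE I. has_form_integral M \<omega> \<alpha> I)"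


section \<open>The volume measure of a submanifold\<close>

text \<open>
  The quantification over \<open>\<omega>\<close> makes the choice of an orientation unnecessary. The measure lives
  on the Borel sets of \<open>M\<close>, and the requirement is only meaningful if \<open>M\<close> has a volume form.
\<close>

definition volume_measure :: "'m::finite itself \<Rightarrow> (real^'n::finite) set \<Rightarrow> (real^'n) measure" where
  "volume_measure _ M =
     (THE \<mu>. sets \<mu> = sets (restrict_space borel M) \<and>
        (\<forall>(\<omega> :: ('m, 'n) form) f. riemannian_volume_form M \<omega> \<and>
            continuous_on M f \<and> compactly_supported M f \<longrightarrow>
            integrable \<mu> f \<and> (LINT p|\<mu>. f p) = form_integral M \<omega> (\<lambda>p v. f p * \<omega> p v)))"

abbreviation Bo :: "(real^'n::finite) set \<Rightarrow> (real^'n) set set" where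
  "Bo \<Omega> \<equiv> sets (restrict_space borel \<Omega>)"

text \<open>The same measure regarded as a Borel measure on \<open>\<Omega>\<close>, that is, \<open>A \<mapsto> \<mu>\<^sub>M(A \<inter> M)\<close>.\<close>

definition volume_measure_in ::
    "'m::finite itself \<Rightarrow> (real^'n::finite) set \<Rightarrow> (real^'n) set \<Rightarrow> (real^'n) measure" where
  "volume_measure_in m \<Omega> M = distr (volume_measure m M) (restrict_space borel \<Omega>) (\<lambda>x. x)"


section \<open>The inductive volume measure\<close>

text \<open>The \<open>m\<close>-dimensional submanifolds contained in \<open>\<Omega>\<close> whose Riemannian volume form exists.\<close>

definition submanifolds_in :: "'m::finite itself \<Rightarrow> (real^'n::finite) set \<Rightarrow> (real^'n) set set" where
  "submanifolds_in m \<Omega> =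
     {M. submanifold m M \<and> M \<subseteq> \<Omega> \<and> (\<exists>\<omega> :: ('m, 'n) form. riemannian_volume_form M \<omega>)}"

definition pieces :: "'m::finite itself \<Rightarrow> (real^'n::finite) set \<Rightarrow> (real^'n) set set" where
  "pieces m \<Omega> = {C \<in> Bo \<Omega>. \<exists>S \<in> submanifolds_in m \<Omega>. C \<subseteq> S}"

text \<open>The two descriptions below express that the value is independent of \<open>S\<close> and \<open>\<D>\<close>.\<close>

definition piece_measure ::
    "'m::finite itself \<Rightarrow> (real^'n::finite) set \<Rightarrow> (real^'n) set \<Rightarrow> (real^'n) set \<Rightarrow> ennreal" where
  "piece_measure m \<Omega> C A =
     (THE r. \<forall>S \<in> submanifolds_in m \<Omega>. C \<subseteq> S \<longrightarrow> r = emeasure (volume_measure m S) (A \<inter> C))"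

definition decompositions ::
    "'m::finite itself \<Rightarrow> (real^'n::finite) set \<Rightarrow> (real^'n) set \<Rightarrow> (real^'n) set set set" where
  "decompositions m \<Omega> N = {\<D>. finite \<D> \<and> \<D> \<subseteq> pieces m \<Omega> \<and> disjoint \<D> \<and> \<Union>\<D> = N}"

definition piece_unions :: "'m::finite itself \<Rightarrow> (real^'n::finite) set \<Rightarrow> (real^'n) set set" where
  "piece_unions m \<Omega> = {N. decompositions m \<Omega> N \<noteq> {}}"

definition union_measure ::
    "'m::finite itself \<Rightarrow> (real^'n::finite) set \<Rightarrow> (real^'n) set \<Rightarrow> (real^'n) set \<Rightarrow> ennreal" where
  "union_measure m \<Omega> N A =
     (THE r. \<forall>\<D> \<in> decompositions m \<Omega> N. r = (\<Sum>C\<in>\<D>. piece_measure m \<Omega> C A))"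

text \<open>The filter of tails of the index class \<open>I\<close>, directed by inclusion.\<close>

definition inclusion_net :: "'a set set \<Rightarrow> 'a set filter" where
  "inclusion_net I = (INF N\<in>I. principal {N' \<in> I. N \<subseteq> N'})"

definition inductive_volume_measure ::
    "'m::finite itself \<Rightarrow> (real^'n::finite) set \<Rightarrow> (real^'n) measure" where
  "inductive_volume_measure m \<Omega> =
     measure_of \<Omega> (Bo \<Omega>)
       (\<lambda>A. Lim (inclusion_net (piece_unions m \<Omega>)) (\<lambda>N. union_measure m \<Omega> N A))"

end

theory Submission
  imports Defs
begin

text \<open>
  The volume of a subset of a chart is the integral of the square root of the Gram determinant of
  the coordinate frame. For two charts \<open>\<phi>\<close>, \<open>\<theta>\<close> of different submanifolds the two values agree on a
  Borel set \<open>C\<close> in the intersection of the charts: the transition map \<open>\<theta>\<^sup>-\<^sup>1 \<circ> \<phi>\<close> is differentiable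
  within \<open>\<phi>\<^sup>-\<^sup>1 C\<close> although this set need not be open, and the change of variables formula applies.
  Hence all chart measures are restrictions of a single Borel measure on \<open>\<real>\<^sup>n\<close>, whose restriction to
  a submanifold \<open>M\<close> is \<open>\<mu>\<^sub>M\<close>. The inductive volume measure is then the supremum over \<open>N\<close> of
  the restrictions of this measure to finite unions \<open>N\<close> of pieces, so it agrees with it on every
  set that is covered by countably many submanifolds.
\<close>

text \<open>On an orthonormal basis a volume form takes a value of absolute value 1, so on a
  coordinate frame its absolute value is that of the determinant of the coefficients in such a
  basis. The square of this determinant is the Gram determinant, which knows neither orientation nor
  submanifold; this is why chart measures from different submanifolds can be compared at all. Two
  submanifolds may meet in a set without interior in either and with different tangent spaces at
  some of its points. There the comparison of the charts brings in the orthogonal projection from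
  one tangent space to the other, whose determinant in orthonormal bases is at most 1 in absolute
  value. That bound is what the change of variables inequality needs. The charts form an uncountable
  family and no countable subfamily serves all sets, so the common measure is built by choosing a
  countable cover for each set separately. Once it exists, the definite descriptions in the
  definitions have unique values for a trivial reason: the value found mentions neither the
  enclosing submanifold nor the decomposition nor the partition of unity.\<close>

section \<open>Alternating forms and Gram determinants\<close>

text \<open>Both sides are compatible with matrix products, so induction over elementary matrices
  suffices. The subspace \<open>R\<close> is separate from \<open>T\<close> because
  \<open>tangent_space\<close> is a union over charts that is never shown to be a subspace; the
  range of a single chart derivative is one.\<close>

lemma alternating_on_linear_combination:
  fixes \<alpha> :: "('m::finite \<Rightarrow> real^'n::finite) \<Rightarrow> real" and A :: "real^'m^'m"
  assumes alt: "alternating_on T \<alpha>" and R: "subspace R" "R \<subseteq> T" and e: "range e \<subseteq> R"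
  shows "\<alpha> (\<lambda>i. \<Sum>j\<in>UNIV. A$i$j *\<^sub>R e j) = det A * \<alpha> e"
proof -
  have lin: "\<alpha> (v(i := a *\<^sub>R x + b *\<^sub>R y)) = a * \<alpha> (v(i := x)) + b * \<alpha> (v(i := y))"
    if "range v \<subseteq> R" "x \<in> R" "y \<in> R" for v i x y a b
    using alt[unfolded alternating_on_def, THEN conjunct1, THEN spec[of _ v], THEN spec[of _ i],
        THEN bspec[of _ _ x], THEN bspec[of _ _ y], THEN spec[of _ a], THEN spec[of _ b]]
      that R(2) by (simp add: subset_iff)
  have alt0: "\<alpha> v = 0" if "range v \<subseteq> R" "i \<noteq> j" "v i = v j" for v i j
    using alt[unfolded alternating_on_def, THEN conjunct2, THEN spec[of _ v], THEN spec[of _ i],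
        THEN spec[of _ j]] that R(2) by (simp add: subset_iff)
  have scale: "\<alpha> (v(i := a *\<^sub>R x)) = a * \<alpha> (v(i := x))" if "range v \<subseteq> R" "x \<in> R" for v i x a
    using lin[OF that(1) that(2) that(2), of i a 0] by simp
  have add: "\<alpha> (v(i := x + y)) = \<alpha> (v(i := x)) + \<alpha> (v(i := y))"
    if "range v \<subseteq> R" "x \<in> R" "y \<in> R" for v i x y
    using lin[OF that, of i 1 1] by simp
  have "\<forall>e. range e \<subseteq> R \<longrightarrow> \<alpha> (\<lambda>i. \<Sum>j\<in>UNIV. A$i$j *\<^sub>R e j) = det A * \<alpha> e"
  proof (induction A rule: induct_matrix_elementary)
    case (1 A B)
    show ?case
    proof (intro allI impI)
      fix e :: "'m \<Rightarrow> real^'n" assume e: "range e \<subseteq> R"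
      let ?f = "\<lambda>i. \<Sum>j\<in>UNIV. B$i$j *\<^sub>R e j"
      have f: "range ?f \<subseteq> R"
        using e R by (auto intro!: subspace_sum subspace_scale)
      have "(\<Sum>j\<in>UNIV. (A ** B)$i$j *\<^sub>R e j) = (\<Sum>j\<in>UNIV. A$i$j *\<^sub>R ?f j)" for i
      proof -
        have "(\<Sum>j\<in>UNIV. (A ** B)$i$j *\<^sub>R e j) = (\<Sum>j\<in>UNIV. \<Sum>k\<in>UNIV. (A$i$k * B$k$j) *\<^sub>R e j)"
          by (simp add: matrix_matrix_mult_def scaleR_sum_left)
        also have "\<dots> = (\<Sum>k\<in>UNIV. \<Sum>j\<in>UNIV. (A$i$k * B$k$j) *\<^sub>R e j)"
          by (rule sum.swap)
        finally show ?thesis by (simp add: scaleR_sum_right)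
      qed
      then have "\<alpha> (\<lambda>i. \<Sum>j\<in>UNIV. (A ** B)$i$j *\<^sub>R e j) = det A * \<alpha> ?f"
        using 1(1)[rule_format, OF f] by (simp only:)
      also have "\<alpha> ?f = det B * \<alpha> e" using 1(2)[rule_format, OF e] .
      finally show "\<alpha> (\<lambda>i. \<Sum>j\<in>UNIV. (A ** B)$i$j *\<^sub>R e j) = det (A ** B) * \<alpha> e"
        by (simp add: det_mul)
    qed
  next
    case (2 A i)
    show ?case
    proof (intro allI impI)
      fix e :: "'m \<Rightarrow> real^'n" assume e: "range e \<subseteq> R"
      let ?v = "\<lambda>i. \<Sum>j\<in>UNIV. A$i$j *\<^sub>R e j"
      have f: "range ?v \<subseteq> R"
        using e R by (auto intro!: subspace_sum subspace_scale)
      have "A$i$j = 0" for j using 2 by (simp add: row_def vec_eq_iff)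
      then have "\<alpha> ?v = \<alpha> (?v(i := 0 *\<^sub>R 0))" by (intro arg_cong[of _ _ \<alpha>]) auto
      also have "\<dots> = 0" using scale[OF f subspace_0[OF R(1)], of i 0] by simp
      finally have "\<alpha> ?v = 0" .
      then show "\<alpha> ?v = det A * \<alpha> e" using det_zero_row[of i A] 2
        by (simp add: row_def)
    qed
  next
    case (3 A)
    show ?case
    proof (intro allI impI)
      fix e :: "'m \<Rightarrow> real^'n" assume e: "range e \<subseteq> R"
      have *: "\<alpha> (\<lambda>i. if i \<in> S then A$i$i *\<^sub>R e i else e i) = (\<Prod>i\<in>S. A$i$i) * \<alpha> e" if "finite S" for S
        using that
      proof (induction S rule: finite_induct)
        case (insert x S)
        let ?v = "\<lambda>i. if i \<in> S then A$i$i *\<^sub>R e i else e i"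
        have v: "range ?v \<subseteq> R" using e R by (auto intro!: subspace_scale)
        have "(\<lambda>i. if i \<in> insert x S then A$i$i *\<^sub>R e i else e i) = ?v(x := A$x$x *\<^sub>R e x)"
          by auto
        then have "\<alpha> (\<lambda>i. if i \<in> insert x S then A$i$i *\<^sub>R e i else e i) = A$x$x * \<alpha> (?v(x := e x))"
          using scale[OF v, of "e x" x "A$x$x"] e by (simp add: range_subsetD)
        also have "?v(x := e x) = ?v" using insert by auto
        finally have "\<alpha> (\<lambda>i. if i \<in> insert x S then A$i$i *\<^sub>R e i else e i) = A$x$x * \<alpha> ?v" .
        then show ?case using insert by simp
      qed simp
      have "(\<Sum>j\<in>UNIV. A$i$j *\<^sub>R e j) = A$i$i *\<^sub>R e i" for i
      proof -
        have "(\<Sum>j\<in>UNIV. A$i$j *\<^sub>R e j) = (\<Sum>j\<in>{i}. A$i$j *\<^sub>R e j)"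
          by (rule sum.mono_neutral_right) (auto simp: 3)
        then show ?thesis by simp
      qed
      then show "\<alpha> (\<lambda>i. \<Sum>j\<in>UNIV. A$i$j *\<^sub>R e j) = det A * \<alpha> e"
        using *[of UNIV] 3 by (simp add: det_diagonal)
    qed
  next
    case (4 m n)
    show ?case
    proof (intro allI impI)
      fix e :: "'m \<Rightarrow> real^'n" assume e: "range e \<subseteq> R"
      let ?t = "Transposition.transpose m n"
      have s: "(\<Sum>j\<in>UNIV. (mat 1 $ i $ ?t j) *\<^sub>R e j) = e (?t i)" for i
      proof -
        have "(\<Sum>j\<in>UNIV. (mat 1 $ i $ ?t j) *\<^sub>R e j) = (\<Sum>j\<in>UNIV. if j = ?t i then e j else 0)"
          by (rule sum.cong) (auto simp: mat_def)
        then show ?thesis by simp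
      qed
      have d: "det (\<chi> i j. (mat 1 :: real^'m^'m) $ i $ ?t j) = -1"
        using det_permute_columns[of ?t "mat 1 :: real^'m^'m"] 4
        by (simp add: permutes_swap_id sign_swap_id)
      \<comment> \<open>Only arguments \<open>m\<close> and \<open>n\<close> vary; expanding
        \<open>w\<close> at the repeated vector \<open>e m + e n\<close> turns vanishing on equal
        arguments into antisymmetry.\<close>
      define w where "w x y = \<alpha> (e(m := x, n := y))" for x y
      have rng: "range (e(m := x, n := y)) \<subseteq> R" if "x \<in> R" "y \<in> R" for x y
        using e that by auto
      have rng1: "range (e(m := x)) \<subseteq> R" "range (e(n := x)) \<subseteq> R" if "x \<in> R" for x
        using e that by auto
      have em: "e m \<in> R" "e n \<in> R" "e m + e n \<in> R" using e R by (auto intro: subspace_add)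
      have tw: "e(m := x, n := y) = e(n := y, m := x)" for x y using 4 by auto
      have w2: "w x (y + z) = w x y + w x z" if "x \<in> R" "y \<in> R" "z \<in> R" for x y z
        unfolding w_def using add[OF rng1(1), of x y z n] that by simp
      have w1: "w (y + z) x = w y x + w z x" if "x \<in> R" "y \<in> R" "z \<in> R" for x y z
        unfolding w_def tw using add[OF rng1(2), of x y z m] that by simp
      have w0: "w x x = 0" if "x \<in> R" for x
        unfolding w_def by (rule alt0[OF rng[OF that that] 4]) (use 4 in simp)
      have "0 = w (e m + e n) (e m + e n)" using w0 em by simp
      also have "\<dots> = w (e m) (e n) + w (e n) (e m)"
        using em by (simp add: w1 w2 w0[OF em(1)] w0[OF em(2)])
      finally have "w (e n) (e m) = - w (e m) (e n)" by simp
      moreover have "(\<lambda>i. e (?t i)) = e(m := e n, n := e m)"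
        by (auto simp: Transposition.transpose_def)
      moreover have "e(m := e m, n := e n) = e" by auto
      ultimately have "\<alpha> (\<lambda>i. e (?t i)) = - \<alpha> e" by (simp add: w_def)
      then show "\<alpha> (\<lambda>i. \<Sum>j\<in>UNIV. (\<chi> i j. (mat 1 :: real^'m^'m) $ i $ ?t j)$i$j *\<^sub>R e j)
          = det (\<chi> i j. (mat 1 :: real^'m^'m) $ i $ ?t j) * \<alpha> e"
        by (simp add: d s)
    qed
  next
    case (5 m n c)
    show ?case
    proof (intro allI impI)
      fix e :: "'m \<Rightarrow> real^'n" assume e: "range e \<subseteq> R"
      let ?A = "(\<chi> i j. if i = m \<and> j = n then c else of_bool (i = j)) :: real^'m^'m"
      have s: "(\<Sum>j\<in>UNIV. ?A$i$j *\<^sub>R e j) = (e(m := e m + c *\<^sub>R e n)) i" for i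
      proof (cases "i = m")
        case True
        have "(\<Sum>j\<in>UNIV. ?A$m$j *\<^sub>R e j) = (\<Sum>j\<in>{m,n}. ?A$m$j *\<^sub>R e j)"
          by (rule sum.mono_neutral_right) auto
        then show ?thesis using True 5 by simp
      next
        case False
        have "(\<Sum>j\<in>UNIV. ?A$i$j *\<^sub>R e j) = (\<Sum>j\<in>{i}. ?A$i$j *\<^sub>R e j)"
          by (rule sum.mono_neutral_right) (use False in auto)
        then show ?thesis using False by simp
      qed
      have d: "det ?A = 1"
      proof -
        have "?A = (\<chi> k. if k = m then row m (mat 1) + c *s row n (mat 1) else row k (mat 1))"
          using 5 by (auto simp: vec_eq_iff row_def mat_def)
        then show ?thesis using det_row_operation[OF 5, of "mat 1" c] by (simp del: vec_lambda_unique)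
      qed
      have r: "range (e(m := e n)) \<subseteq> R" using e by auto
      have "\<alpha> (e(m := e m + c *\<^sub>R e n)) = \<alpha> e + c * \<alpha> (e(m := e n))"
        using lin[OF e, of "e m" "e n" m 1 c] e by (auto simp: range_subsetD)
      also have "\<alpha> (e(m := e n)) = 0" by (rule alt0[OF r 5]) (use 5 in simp)
      finally show "\<alpha> (\<lambda>i. \<Sum>j\<in>UNIV. ?A$i$j *\<^sub>R e j) = det ?A * \<alpha> e"
        unfolding s d by simp
    qed
  qed
  then show ?thesis using e by blast
qed

text \<open>The squared m-dimensional volume of the parallelepiped spanned by
  \<open>v\<close>.\<close>

definition gram_det :: "('m::finite \<Rightarrow> real^'n::finite) \<Rightarrow> real" where
  "gram_det v = det (\<chi> i j. v i \<bullet> v j)"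

text \<open>The matrix of inner products factors as A, the inner products of the frames, and the
  transpose of B. With \<open>e = f\<close> this evaluates Gram determinants; with two orthonormal
  frames it isolates the projection between two tangent spaces.\<close>

lemma det_cross_gram_linear_combination:
  fixes A B :: "real^'m::finite^'m" and e f :: "'m \<Rightarrow> real^'n::finite"
  shows "det (\<chi> i j. (\<Sum>k\<in>UNIV. A$i$k *\<^sub>R e k) \<bullet> (\<Sum>l\<in>UNIV. B$j$l *\<^sub>R f l)) =
    det A * det (\<chi> i j. e i \<bullet> f j) * det B"
proof -
  have "(\<Sum>k\<in>UNIV. A$i$k *\<^sub>R e k) \<bullet> (\<Sum>l\<in>UNIV. B$j$l *\<^sub>R f l) =
      (\<Sum>l\<in>UNIV. (\<Sum>k\<in>UNIV. A$i$k * (e k \<bullet> f l)) * B$j$l)" for i j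
    by (simp add: inner_sum_left inner_sum_right sum_distrib_left mult_ac)
  then have "(\<chi> i j. (\<Sum>k\<in>UNIV. A$i$k *\<^sub>R e k) \<bullet> (\<Sum>l\<in>UNIV. B$j$l *\<^sub>R f l)) =
      A ** (\<chi> i j. e i \<bullet> f j) ** transpose B"
    by (simp add: vec_eq_iff matrix_matrix_mult_def transpose_def)
  then show ?thesis by (simp add: det_mul det_transpose)
qed

lemma gram_det_orthonormal:
  assumes "\<And>i j. e i \<bullet> e j = (if i = j then 1 else 0)"
  shows "gram_det (e :: 'm::finite \<Rightarrow> real^'n::finite) = 1"
proof -
  have "(\<chi> i j. e i \<bullet> e j) = (mat 1 :: real^'m^'m)" by (simp add: vec_eq_iff mat_def assms)
  then show ?thesis by (simp add: gram_det_def)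
qed

text \<open>Injectivity gives the range dimension \<open>CARD('m)\<close>, so an orthonormal basis
  of it can be indexed by \<open>'m\<close> and the coefficients form a square matrix with a
  determinant.\<close>

lemma orthonormal_frame_expansion:
  fixes L :: "real^'m::finite \<Rightarrow> real^'n::finite"
  assumes "linear L" "inj L"
  shows "\<exists>(e :: 'm \<Rightarrow> real^'n) (A :: real^'m^'m).
    range e \<subseteq> range L \<and> (\<forall>i j. e i \<bullet> e j = (if i = j then 1 else 0)) \<and>
    (\<forall>i. L (axis i 1) = (\<Sum>k\<in>UNIV. A$i$k *\<^sub>R e k))"
proof -
  have sub: "subspace (range L)" using assms by (simp add: linear_subspace_image)
  obtain B where B: "B \<subseteq> range L" "pairwise orthogonal B" "\<And>x. x \<in> B \<Longrightarrow> norm x = 1"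
      "independent B" "card B = dim (range L)" "span B = range L"
    using orthonormal_basis_subspace[OF sub] by metis
  have "card B = CARD('m)" using B(5) assms by (simp add: dim_image_eq)
  moreover have "finite B" using B(4) by (rule independent_imp_finite)
  ultimately obtain e :: "'m \<Rightarrow> real^'n" where e: "bij_betw e UNIV B"
    using finite_same_card_bij[of "UNIV :: 'm set" B] by auto
  then have inj: "inj e" and im: "range e = B" by (auto simp: bij_betw_def)
  have on: "e i \<bullet> e j = (if i = j then 1 else 0)" for i j
  proof (cases "i = j")
    case True
    then show ?thesis using B(3)[of "e i"] im by (auto simp: dot_square_norm)
  next
    case False
    then have "e i \<noteq> e j" using inj by (auto dest: injD)
    then show ?thesis using False B(2) im by (auto simp: pairwise_def orthogonal_def)
  qed
  define A :: "real^'m^'m" where "A = (\<chi> i k. L (axis i 1) \<bullet> e k)"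
  have "L (axis i 1) = (\<Sum>k\<in>UNIV. A$i$k *\<^sub>R e k)" for i
  proof -
    have "L (axis i 1) = (\<Sum>x\<in>B. (L (axis i 1) \<bullet> x) *\<^sub>R x)"
      using orthonormal_basis_expand[OF B(2,3) _ \<open>finite B\<close>, of "L (axis i 1)"] B(6)
      by (metis rangeI)
    also have "\<dots> = (\<Sum>k\<in>UNIV. (L (axis i 1) \<bullet> e k) *\<^sub>R e k)"
      by (rule sum.reindex_bij_betw[OF e, symmetric])
    finally show ?thesis by (simp add: A_def)
  qed
  then show ?thesis using on B(1) im by blast
qed

lemma gram_det_axis_expansion:
  fixes L :: "real^'m::finite \<Rightarrow> real^'n::finite"
  assumes "\<And>i j. e i \<bullet> e j = (if i = j then 1 else 0)"
    "\<And>i. L (axis i 1) = (\<Sum>k\<in>UNIV. A$i$k *\<^sub>R e k)"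
  shows "gram_det (\<lambda>i. L (axis i 1)) = (det A)\<^sup>2"
proof -
  have "gram_det (\<lambda>i. L (axis i 1)) = det A * gram_det e * det A"
    unfolding gram_det_def assms(2) by (rule det_cross_gram_linear_combination)
  then show ?thesis using gram_det_orthonormal[of e, OF assms(1)] by (simp add: power2_eq_square)
qed

lemma gram_det_pos:
  fixes L :: "real^'m::finite \<Rightarrow> real^'n::finite"
  assumes "linear L" "inj L"
  shows "gram_det (\<lambda>i. L (axis i 1)) > 0"
proof -
  obtain e and A :: "real^'m^'m" where eA: "range e \<subseteq> range L"
    "\<And>i j. e i \<bullet> e j = (if i = j then 1 else 0)"
    "\<And>i. L (axis i 1) = (\<Sum>k\<in>UNIV. A$i$k *\<^sub>R e k)"
    using orthonormal_frame_expansion[OF assms] by blast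
  have "det A \<noteq> 0"
  proof
    assume "det A = 0"
    then have "det (transpose A) = 0" by (simp add: det_transpose)
    \<comment> \<open>Row \<open>i\<close> of \<open>A\<close> holds the coordinates of
      \<open>L (axis i 1)\<close>, so \<open>L\<close> acts on coefficient vectors through
      \<open>transpose A\<close>, and a kernel vector of the latter contradicts injectivity.\<close>
    then obtain x where x: "x \<noteq> 0" "transpose A *v x = 0"
      using invertible_det_nz[of "transpose A"] matrix_left_invertible_ker[of "transpose A"]
      by (metis invertible_left_inverse)
    have "L x = L (\<Sum>i\<in>UNIV. x$i *\<^sub>R axis i 1)"
      by (metis basis_expansion scalar_mult_eq_scaleR)
    also have "\<dots> = (\<Sum>i\<in>UNIV. x$i *\<^sub>R L (axis i 1))"
      using assms by (simp add: linear_sum linear_scale o_def)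
    also have "\<dots> = (\<Sum>i\<in>UNIV. \<Sum>k\<in>UNIV. (x$i * A$i$k) *\<^sub>R e k)"
      by (simp add: eA(3) scaleR_sum_right)
    also have "\<dots> = (\<Sum>k\<in>UNIV. (\<Sum>i\<in>UNIV. x$i * A$i$k) *\<^sub>R e k)"
      by (subst sum.swap) (simp add: scaleR_sum_left)
    also have "\<dots> = (\<Sum>k\<in>UNIV. (transpose A *v x)$k *\<^sub>R e k)"
      by (simp add: matrix_vector_mult_def transpose_def mult.commute)
    finally have "L x = 0" using x by simp
    then have "x = 0" using assms by (metis injD linear_0)
    with x show False by simp
  qed
  then show ?thesis using gram_det_axis_expansion[of e L A, OF eA(2,3)] by simp
qed

text \<open>Relative to an orthonormal frame \<open>e\<close> of the range, the left side is
  \<open>\<bar>det A\<bar> * \<bar>\<alpha> e\<bar>\<close> and the Gram determinant is the square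
  of \<open>det A\<close>. The absolute value removes the orientation.\<close>

lemma abs_alternating_eq_sqrt_gram_det:
  fixes \<alpha> :: "('m::finite \<Rightarrow> real^'n::finite) \<Rightarrow> real" and L :: "real^'m \<Rightarrow> real^'n"
  assumes "linear L" "inj L" "alternating_on T \<alpha>" "range L \<subseteq> T"
    and one: "\<And>e. (\<forall>i. e i \<in> T) \<Longrightarrow> (\<forall>i j. e i \<bullet> e j = (if i = j then 1 else 0)) \<Longrightarrow> \<bar>\<alpha> e\<bar> = 1"
  shows "\<bar>\<alpha> (\<lambda>i. L (axis i 1))\<bar> = sqrt (gram_det (\<lambda>i. L (axis i 1)))"
proof -
  obtain e and A :: "real^'m^'m" where eA: "range e \<subseteq> range L"
    "\<And>i j. e i \<bullet> e j = (if i = j then 1 else 0)"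
    "\<And>i. L (axis i 1) = (\<Sum>k\<in>UNIV. A$i$k *\<^sub>R e k)"
    using orthonormal_frame_expansion[OF assms(1,2)] by blast
  have sub: "subspace (range L)" using assms by (simp add: linear_subspace_image)
  have "\<alpha> (\<lambda>i. L (axis i 1)) = det A * \<alpha> e"
    unfolding eA(3) by (rule alternating_on_linear_combination[OF assms(3) sub assms(4) eA(1)])
  moreover have "\<bar>\<alpha> e\<bar> = 1" by (rule one) (use eA(1) assms(4) in blast, simp add: eA(2))
  ultimately show ?thesis using gram_det_axis_expansion[of e L A, OF eA(2,3)] by (simp add: abs_mult)
qed

section \<open>Change of variables over arbitrary finite index types\<close>

text \<open>
  The change of variables theorems of the library require the index type to be a well-order. They
  are transferred to an arbitrary finite index type along a bijection with the following type.
\<close>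

typedef 'm ordered_index = "{..<CARD('m::finite)}"
  using zero_less_card_finite by blast

instantiation ordered_index :: (finite) wellorder
begin

definition less_eq_ordered_index :: "'a ordered_index \<Rightarrow> 'a ordered_index \<Rightarrow> bool" where
  "x \<le> y \<longleftrightarrow> Rep_ordered_index x \<le> Rep_ordered_index y"

definition less_ordered_index :: "'a ordered_index \<Rightarrow> 'a ordered_index \<Rightarrow> bool" where
  "x < y \<longleftrightarrow> Rep_ordered_index x < Rep_ordered_index y"

instance
proof
  fix P :: "'a ordered_index \<Rightarrow> bool" and a :: "'a ordered_index"
  assume *: "\<And>x. (\<And>y. y < x \<Longrightarrow> P y) \<Longrightarrow> P x"
  show "P a"
    by (induction a rule: measure_induct_rule[of Rep_ordered_index])
      (rule *, simp add: less_ordered_index_def)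
qed (auto simp: less_eq_ordered_index_def less_ordered_index_def Rep_ordered_index_inject)

end

instance ordered_index :: (finite) finite
proof
  have "(UNIV :: 'a ordered_index set) = Abs_ordered_index ` {..<CARD('a)}"
    using type_definition.Abs_image[OF type_definition_ordered_index] by auto
  then show "finite (UNIV :: 'a ordered_index set)" by (metis finite_imageI finite_lessThan)
qed

lemma card_ordered_index: "CARD('m::finite ordered_index) = CARD('m)"
  using type_definition.card[OF type_definition_ordered_index] by simp

context
  fixes \<rho> :: "'k::finite \<Rightarrow> 'm::finite" and \<sigma>
  assumes \<rho>\<sigma>: "\<And>i. \<sigma> (\<rho> i) = i" "\<And>j. \<rho> (\<sigma> j) = j"
begin

text \<open>Lebesgue measure is determined by its values on boxes, and relabelling coordinates only
  permutes the side lengths.\<close>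

lemma lborel_reindex: "distr lborel borel (\<lambda>x :: real^'m. \<chi> i. x$(\<rho> i)) = (lborel :: (real^'k) measure)"
proof (rule lborel_eqI[symmetric])
  have "continuous_on UNIV (\<lambda>x :: real^'m. (\<chi> i. x$(\<rho> i)) :: real^'k)"
    by (intro continuous_intros)
  then have meas: "(\<lambda>x :: real^'m. \<chi> i. x$(\<rho> i)) \<in> borel \<rightarrow>\<^sub>M (borel :: (real^'k) measure)"
    by (rule borel_measurable_continuous_onI)
  fix l u :: "real^'k"
  assume lu: "\<And>b. b \<in> Basis \<Longrightarrow> l \<bullet> b \<le> u \<bullet> b"
  let ?l = "(\<chi> j. l$(\<sigma> j)) :: real^'m" and ?u = "(\<chi> j. u$(\<sigma> j)) :: real^'m"
  have lu': "l$i \<le> u$i" for i using lu[of "axis i 1"] by (auto simp: Basis_vec_def inner_axis)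
  have vim: "(\<lambda>x :: real^'m. \<chi> i. x$(\<rho> i)) -` box l u = box ?l ?u"
    by (auto simp: mem_box_cart) (metis \<rho>\<sigma>)+
  have "emeasure (distr lborel borel (\<lambda>x :: real^'m. \<chi> i. x$(\<rho> i))) (box l u) =
      emeasure lborel (box ?l ?u)"
    by (subst emeasure_distr) (use meas vim in auto)
  also have "\<dots> = (\<Prod>b\<in>Basis. (?u - ?l) \<bullet> b)"
    by (rule emeasure_lborel_box) (auto simp: Basis_vec_def inner_axis lu')
  also have "(\<Prod>b\<in>Basis. (?u - ?l) \<bullet> b) = (\<Prod>j\<in>UNIV. u$(\<sigma> j) - l$(\<sigma> j))"
    by (rule prod.reindex_bij_witness[of _ "\<lambda>j. axis j 1" "\<lambda>b. THE j. b = axis j 1"])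
      (auto simp: Basis_vec_def inner_axis axis_eq_axis)
  also have "\<dots> = (\<Prod>i\<in>UNIV. u$i - l$i)"
    by (rule prod.reindex_bij_witness[of _ \<rho> \<sigma>]) (auto simp: \<rho>\<sigma>)
  also have "\<dots> = (\<Prod>b\<in>Basis. (u - l) \<bullet> b)"
    by (rule prod.reindex_bij_witness[of _ "\<lambda>b. THE j. b = axis j 1" "\<lambda>j. axis j 1"])
      (auto simp: Basis_vec_def inner_axis axis_eq_axis)
  finally show "emeasure (distr lborel borel (\<lambda>x :: real^'m. \<chi> i. x$(\<rho> i))) (box l u) =
      (\<Prod>b\<in>Basis. (u - l) \<bullet> b)" .
qed simp

text \<open>Permutations of the two index types are not matched up. Instead the determinant over
  \<open>'k\<close> is read as an alternating form in rows indexed by \<open>'m\<close>, and such a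
  form is \<open>det A\<close> times its value on the unit vectors, which is 1.\<close>

lemma det_reindex: "det (\<chi> i j. A$(\<rho> i)$(\<rho> j)) = det (A :: real^'m^'m)"
proof -
  let ?\<alpha> = "\<lambda>v :: 'm \<Rightarrow> real^'k. det (\<chi> i. v (\<rho> i))"
  have lin: "?\<alpha> (v(i := a *\<^sub>R x + b *\<^sub>R y)) = a * ?\<alpha> (v(i := x)) + b * ?\<alpha> (v(i := y))"
    for v i x y a b
  proof -
    have *: "(\<chi> k. (v(i := z)) (\<rho> k)) = (\<chi> k. if k = \<sigma> i then z else v (\<rho> k))" for z
      using \<rho>\<sigma> by (auto simp: vec_eq_iff)
    show ?thesis
      unfolding * scalar_mult_eq_scaleR[symmetric] det_row_add[of "\<sigma> i" "\<lambda>_. a *s x"] det_row_mul ..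
  qed
  have alt: "alternating_on UNIV ?\<alpha>"
    unfolding alternating_on_def
  proof (intro conjI allI ballI impI)
    fix v :: "'m \<Rightarrow> real^'k" and i j assume "range v \<subseteq> UNIV \<and> i \<noteq> j \<and> v i = v j"
    moreover from this have "\<sigma> i \<noteq> \<sigma> j" using \<rho>\<sigma>(2) by metis
    ultimately show "?\<alpha> v = 0"
      using det_identical_rows[of "\<sigma> i" "\<sigma> j" "\<chi> i. v (\<rho> i)"] \<rho>\<sigma>
      by (auto simp: row_def vec_eq_iff)
  qed (rule lin)
  have "(\<Sum>j\<in>UNIV. A$i$j *\<^sub>R axis (\<sigma> j) 1) = (\<chi> k. A$i$(\<rho> k))" for i
  proof -
    have "(\<Sum>j\<in>UNIV. A$i$j *\<^sub>R axis (\<sigma> j) 1) $ k = A$i$(\<rho> k)" for k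
    proof -
      have "(\<Sum>j\<in>UNIV. A$i$j *\<^sub>R axis (\<sigma> j) 1) $ k = (\<Sum>j\<in>{\<rho> k}. (A$i$j *\<^sub>R axis (\<sigma> j) 1) $ k)"
        unfolding sum_component
        by (rule sum.mono_neutral_right) (use \<rho>\<sigma> in \<open>auto simp: axis_def\<close>)
      also have "\<dots> = A$i$(\<rho> k)" by (simp add: axis_def \<rho>\<sigma>)
      finally show ?thesis .
    qed
    then show ?thesis by (simp only: vec_eq_iff vec_lambda_beta simp_thms)
  qed
  then have "det (\<chi> i. (\<chi> k. A$(\<rho> i)$(\<rho> k)) :: real^'k^'k) = det A * ?\<alpha> (\<lambda>j. axis (\<sigma> j) 1)"
    using alternating_on_linear_combination[OF alt, of UNIV "\<lambda>j. axis (\<sigma> j) 1" A] by simp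
  also have "(\<chi> i. axis (\<sigma> (\<rho> i)) 1) = (mat 1 :: real^'k^'k)"
    by (simp add: \<rho>\<sigma> vec_eq_iff mat_def axis_def)
  finally show ?thesis by simp
qed

end

text \<open>Rephrases a gauge integral bound for nonnegative Lebesgue integrals; an infinite right
  side is trivial. As \<open>g\<close> may hit a point several times, only an inequality can
  hold.\<close>

lemma nn_integral_image_le_wellorder:
  fixes f :: "real^'m::{finite,wellorder} \<Rightarrow> real"
  assumes nonneg: "\<And>x. x \<in> S \<Longrightarrow> 0 \<le> f (g x)"
    and der: "\<And>x. x \<in> S \<Longrightarrow> (g has_derivative g' x) (at x within S)"
    and meas: "(\<lambda>x. indicator S x * (\<bar>det (matrix (g' x))\<bar> * f (g x))) \<in> borel_measurable borel"
  shows "(\<integral>\<^sup>+y. ennreal (indicator (g ` S) y * f y) \<partial>lborel) \<le>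
    (\<integral>\<^sup>+x. ennreal (indicator S x * (\<bar>det (matrix (g' x))\<bar> * f (g x))) \<partial>lborel)"
    (is "_ \<le> (\<integral>\<^sup>+x. ennreal (?D x) \<partial>lborel)")
proof (cases "(\<integral>\<^sup>+x. ennreal (?D x) \<partial>lborel) = \<infinity>")
  case False
  have D0: "0 \<le> ?D x" for x using nonneg by (auto simp: indicator_def)
  have "integrable lborel ?D"
    by (rule integrableI_nonneg) (use meas False D0 in \<open>auto simp: less_top\<close>)
  then have hi: "(?D has_integral (integral\<^sup>L lborel ?D)) UNIV"
    by (rule has_integral_integral_lborel)
  have D: "?D = (\<lambda>x. if x \<in> S then \<bar>det (matrix (g' x))\<bar> * f (g x) else 0)"
    by (auto simp: indicator_def)
  have hiS: "((\<lambda>x. \<bar>det (matrix (g' x))\<bar> * f (g x)) has_integral (integral\<^sup>L lborel ?D)) S"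
    using hi unfolding D has_integral_restrict_UNIV .
  then have *: "f integrable_on (g ` S) \<and>
      integral (g ` S) f \<le> integral S (\<lambda>x. \<bar>det (matrix (g' x))\<bar> * f (g x))"
    by (intro integral_on_image_ubound_nonneg nonneg der has_integral_integrable)
  have "(\<integral>\<^sup>+y. ennreal (indicator (g ` S) y * f y) \<partial>lborel) = ennreal (integral (g ` S) f)"
    by (rule nn_integral_has_integral_lebesgue) (use nonneg * in auto)
  also have "\<dots> \<le> ennreal (integral S (\<lambda>x. \<bar>det (matrix (g' x))\<bar> * f (g x)))"
    using * by (intro ennreal_leI) auto
  also have "\<dots> = (\<integral>\<^sup>+x. ennreal (?D x) \<partial>lborel)"
    by (rule nn_integral_has_integral_lebesgue[symmetric]) (use nonneg hiS in \<open>auto simp: has_integral_integrable_integral\<close>)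
  finally show ?thesis .
qed simp

text \<open>Conjugating \<open>g\<close> with the coordinate relabelling \<open>T\<close> changes
  neither Lebesgue measure nor the determinant of the derivative.\<close>

lemma nn_integral_image_le:
  fixes f :: "real^'m::finite \<Rightarrow> real"
  assumes nonneg: "\<And>x. x \<in> S \<Longrightarrow> 0 \<le> f (g x)"
    and der: "\<And>x. x \<in> S \<Longrightarrow> (g has_derivative g' x) (at x within S)"
    and meas: "(\<lambda>x. indicator S x * (\<bar>det (matrix (g' x))\<bar> * f (g x))) \<in> borel_measurable borel"
    and measf: "(\<lambda>y. indicator (g ` S) y * f y) \<in> borel_measurable borel"
  shows "(\<integral>\<^sup>+y. ennreal (indicator (g ` S) y * f y) \<partial>lborel) \<le>
    (\<integral>\<^sup>+x. ennreal (indicator S x * (\<bar>det (matrix (g' x))\<bar> * f (g x))) \<partial>lborel)"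
proof -
  obtain \<rho> :: "'m ordered_index \<Rightarrow> 'm" where "bij \<rho>"
    using finite_same_card_bij[of "UNIV :: 'm ordered_index set" "UNIV :: 'm set"]
    by (auto simp: card_ordered_index)
  then have \<rho>\<sigma>: "inv \<rho> (\<rho> i) = i" "\<rho> (inv \<rho> j) = j" for i j
    by (simp_all add: bij_is_inj bij_is_surj surj_f_inv_f)
  define T where "T = (\<lambda>x :: real^'m. (\<chi> i. x$(\<rho> i)) :: real^'m ordered_index)"
  define T' where "T' = (\<lambda>y :: real^'m ordered_index. (\<chi> i. y$(inv \<rho> i)) :: real^'m)"
  have TT': "T' (T x) = x" "T (T' y) = y" for x y
    by (auto simp: T_def T'_def vec_eq_iff \<rho>\<sigma>)
  have lin: "linear T" "linear T'"
    by (auto simp: T_def T'_def vec_eq_iff intro!: linearI)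
  then have bl: "bounded_linear T" "bounded_linear T'"
    by (simp_all add: linear_conv_bounded_linear)
  have measT': "T' \<in> lborel \<rightarrow>\<^sub>M borel"
    using linear_continuous_on[OF bl(2), of UNIV] by (simp add: borel_measurable_continuous_onI)
  have leb: "(lborel :: (real^'m) measure) = distr lborel borel T'"
    unfolding T'_def by (rule lborel_reindex[where \<rho> = "inv \<rho>" and \<sigma> = \<rho>, symmetric]) (auto simp: \<rho>\<sigma>)
  have det: "det (matrix (\<lambda>x. T (L (T' x)))) = det (matrix L)" if "linear L" for L
  proof -
    have T'_axis: "T' (axis j 1) = axis (\<rho> j) 1" for j
      using \<rho>\<sigma> by (auto simp: T'_def vec_eq_iff axis_def)
    have "matrix (\<lambda>x. T (L (T' x))) = (\<chi> i j. matrix L $ \<rho> i $ \<rho> j)"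
      by (simp only: matrix_def T_def T'_axis vec_lambda_beta)
    then show ?thesis by (simp add: det_reindex[where \<rho> = \<rho> and \<sigma> = "inv \<rho>"] \<rho>\<sigma>)
  qed
  let ?S = "T ` S" and ?g = "\<lambda>y. T (g (T' y))" and ?g' = "\<lambda>y x. T (g' (T' y) (T' x))"
  have im: "?g ` ?S = T ` g ` S" by (simp add: image_image TT')
  have mem: "y \<in> T ` A \<longleftrightarrow> T' y \<in> A" for y A
    using TT' by (metis image_iff)
  have linS: "linear (g' x)" if "x \<in> S" for x
    using der[OF that] by (rule has_derivative_linear)
  have eqD: "indicator ?S y * (\<bar>det (matrix (?g' y))\<bar> * f (T' (?g y))) =
      indicator S (T' y) * (\<bar>det (matrix (g' (T' y)))\<bar> * f (g (T' y)))" for y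
    using linS det by (auto simp: indicator_def mem TT')
  have eqI: "indicator (?g ` ?S) y * f (T' y) = indicator (g ` S) (T' y) * f (T' y)" for y
    unfolding im by (simp add: indicator_def mem)
  have "(\<integral>\<^sup>+y. ennreal (indicator (?g ` ?S) y * f (T' y)) \<partial>lborel) \<le>
    (\<integral>\<^sup>+x. ennreal (indicator ?S x * (\<bar>det (matrix (?g' x))\<bar> * f (T' (?g x)))) \<partial>lborel)"
  proof (rule nn_integral_image_le_wellorder)
    fix y assume "y \<in> ?S"
    then have y: "T' y \<in> S" by (simp add: mem)
    show "0 \<le> f (T' (?g y))" using nonneg[OF y] by (simp add: TT')
    have 1: "(T' has_derivative T') (at y within ?S)"
      using bl(2) by (rule bounded_linear_imp_has_derivative)
    have "T' ` ?S = S" by (simp add: image_image TT')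
    then have 2: "(g has_derivative g' (T' y)) (at (T' y) within T' ` ?S)"
      using der[OF y] by simp
    have 3: "((\<lambda>y. g (T' y)) has_derivative (\<lambda>x. g' (T' y) (T' x))) (at y within ?S)"
      using diff_chain_within[OF 1 2] by (simp add: o_def)
    show "(?g has_derivative ?g' y) (at y within ?S)"
      using bounded_linear.has_derivative[OF bl(1) 3] .
  next
    show "(\<lambda>x. indicator ?S x * (\<bar>det (matrix (?g' x))\<bar> * f (T' (?g x)))) \<in> borel_measurable borel"
      unfolding eqD using measurable_compose[OF measT' meas] by simp
  qed
  then have "(\<integral>\<^sup>+y. ennreal (indicator (g ` S) (T' y) * f (T' y)) \<partial>lborel) \<le>
    (\<integral>\<^sup>+y. ennreal (indicator S (T' y) * (\<bar>det (matrix (g' (T' y)))\<bar> * f (g (T' y)))) \<partial>lborel)"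
    unfolding eqD eqI .
  then show ?thesis
    unfolding leb using measT' meas measf by (simp add: nn_integral_distr)
qed

section \<open>Determinants of projections between subspaces\<close>

text \<open>The unit ball is mapped into itself. The available inequality bounds the volume of an
  image from above, so it is applied to the inverse \<open>D\<close>, which carries \<open>S\<close>
  onto the ball: the volume of the ball is at most \<open>\<bar>det D\<bar>\<close> times that of
  \<open>S\<close>, hence \<open>\<bar>det D\<bar> \<ge> 1\<close>.\<close>

lemma abs_det_nonexpansive_le_1:
  fixes C :: "real^'m::finite^'m"
  assumes "\<And>x. norm (C *v x) \<le> norm x"
  shows "\<bar>det C\<bar> \<le> 1"
proof (cases "det C = 0")
  case False
  then have "invertible C" by (simp add: invertible_det_nz)
  then obtain D where D: "D ** C = mat 1" "C ** D = mat 1" by (auto simp: invertible_def)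
  define S where "S = (\<lambda>x. C *v x) ` ball (0 :: real^'m) 1"
  have DC: "D *v (C *v x) = x" "C *v (D *v x) = x" for x
    using D by (simp_all add: matrix_vector_mul_assoc)
  have S: "S \<subseteq> ball 0 1" using assms by (force simp: S_def intro: order.strict_trans1)
  have Svim: "S = (\<lambda>x. D *v x) -` ball 0 1"
    using DC unfolding S_def by (auto intro!: image_eqI[where x = "D *v _"] simp: DC)
  have "open S" unfolding Svim
    by (rule open_vimage) (auto intro: matrix_vector_mult_linear_continuous_on)
  have im: "(\<lambda>x. D *v x) ` S = ball 0 1" unfolding S_def by (simp add: image_image DC)
  have "(\<integral>\<^sup>+y. ennreal (indicator ((\<lambda>x. D *v x) ` S) y * 1) \<partial>lborel) \<le>
    (\<integral>\<^sup>+x. ennreal (indicator S x * (\<bar>det (matrix (\<lambda>x. D *v x))\<bar> * 1)) \<partial>lborel)"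
    by (rule nn_integral_image_le[where f = "\<lambda>_. 1"])
      (use \<open>open S\<close> in \<open>auto simp: im intro!: borel_measurable_indicator bounded_linear_imp_has_derivative matrix_vector_mul_bounded_linear\<close>)
  also have "\<dots> = (\<integral>\<^sup>+x. ennreal \<bar>det D\<bar> * indicator S x \<partial>lborel)"
    by (rule nn_integral_cong) (auto simp: indicator_def)
  also have "\<dots> = ennreal \<bar>det D\<bar> * emeasure lborel S"
    using \<open>open S\<close> by (subst nn_integral_cmult_indicator) auto
  also have "\<dots> \<le> ennreal \<bar>det D\<bar> * emeasure lborel (ball 0 1 :: (real^'m) set)"
    using S by (intro mult_left_mono emeasure_mono) auto
  finally have "emeasure lborel (ball 0 1 :: (real^'m) set) \<le> ennreal \<bar>det D\<bar> * emeasure lborel (ball 0 1 :: (real^'m) set)"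
    unfolding im by (simp add: ennreal_indicator)
  moreover have "emeasure lborel (ball 0 1 :: (real^'m) set) = ennreal (unit_ball_vol (CARD('m)))"
    by (simp add: emeasure_ball)
  ultimately have "ennreal (unit_ball_vol (CARD('m))) \<le> ennreal (\<bar>det D\<bar> * unit_ball_vol (CARD('m)))"
    by (simp add: ennreal_mult)
  then have "1 \<le> \<bar>det D\<bar>"
    by (subst (asm) ennreal_le_iff) (auto simp: mult_le_cancel_right1 unit_ball_vol_pos)
  moreover have "det D * det C = 1" using D(1) by (metis det_I det_mul)
  then have "\<bar>det D\<bar> * \<bar>det C\<bar> = 1" by (metis abs_mult abs_one)
  ultimately show ?thesis
    by (metis abs_ge_zero mult_left_mono mult_1 mult.commute)
qed simp

section \<open>Charts and their measures\<close>

text \<open>Bessel's inequality: \<open>?p\<close> is the orthogonal projection of \<open>z\<close>,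
  so \<open>?p \<bullet> ?p = ?p \<bullet> z\<close>, and the square of \<open>z - ?p\<close> is
  nonnegative.\<close>

lemma norm_orthonormal_coordinates_le:
  fixes a :: "'m::finite \<Rightarrow> 'v::real_inner"
  assumes "\<And>i j. a i \<bullet> a j = (if i = j then 1 else 0)"
  shows "norm (\<chi> i. a i \<bullet> z) \<le> norm z"
proof -
  let ?p = "\<Sum>i\<in>UNIV. (a i \<bullet> z) *\<^sub>R a i"
  have p: "?p \<bullet> w = (\<Sum>i\<in>UNIV. (a i \<bullet> z) * (a i \<bullet> w))" for w
    by (simp add: inner_sum_left)
  have "a i \<bullet> ?p = a i \<bullet> z" for i
  proof -
    have "a i \<bullet> ?p = (\<Sum>j\<in>UNIV. if j = i then a i \<bullet> z else 0)"
      unfolding inner_sum_right inner_scaleR_right assms by (rule sum.cong) auto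
    then show ?thesis by simp
  qed
  then have "?p \<bullet> ?p = ?p \<bullet> z" unfolding p by simp
  moreover have "0 \<le> (z - ?p) \<bullet> (z - ?p)" by simp
  ultimately have "?p \<bullet> z \<le> z \<bullet> z" by (simp add: inner_diff_left inner_diff_right inner_commute)
  then have "(norm (\<chi> i. a i \<bullet> z))\<^sup>2 \<le> (norm z)\<^sup>2"
    unfolding p power2_norm_eq_inner by (simp add: inner_vec_def)
  then show ?thesis by (rule power2_le_imp_le) simp
qed

lemma norm_orthonormal_combination:
  fixes b :: "'m::finite \<Rightarrow> 'v::real_inner" and x :: "real^'m"
  assumes "\<And>i j. b i \<bullet> b j = (if i = j then 1 else 0)"
  shows "norm (\<Sum>i\<in>UNIV. x$i *\<^sub>R b i) = norm x"
proof -
  have "b i \<bullet> (\<Sum>j\<in>UNIV. x$j *\<^sub>R b j) = x$i" for i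
  proof -
    have "b i \<bullet> (\<Sum>j\<in>UNIV. x$j *\<^sub>R b j) = (\<Sum>j\<in>UNIV. if j = i then x$i else 0)"
      unfolding inner_sum_right inner_scaleR_right assms by (rule sum.cong) auto
    then show ?thesis by simp
  qed
  then have "(\<Sum>i\<in>UNIV. x$i *\<^sub>R b i) \<bullet> (\<Sum>i\<in>UNIV. x$i *\<^sub>R b i) = x \<bullet> x"
    by (subst inner_sum_left) (simp add: inner_vec_def)
  then show ?thesis by (simp add: norm_eq_sqrt_inner)
qed

text \<open>The Cauchy-Schwarz inequality for the m-vectors of the two frames. Between orthonormal
  frames of the ranges, the cross Gram matrix \<open>?P\<close> represents the projection of one
  range to the other, which does not increase norms.\<close>

lemma abs_det_cross_gram_le:
  fixes L K :: "real^'m::finite \<Rightarrow> real^'n::finite"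
  assumes "linear L" "inj L" "linear K" "inj K"
  shows "\<bar>det (\<chi> i j. L (axis i 1) \<bullet> K (axis j 1))\<bar> \<le>
    sqrt (gram_det (\<lambda>i. L (axis i 1))) * sqrt (gram_det (\<lambda>i. K (axis i 1)))"
proof -
  obtain a and X :: "real^'m^'m" where a: "range a \<subseteq> range L"
    "\<And>i j. a i \<bullet> a j = (if i = j then 1 else 0)"
    "\<And>i. L (axis i 1) = (\<Sum>k\<in>UNIV. X$i$k *\<^sub>R a k)"
    using orthonormal_frame_expansion[OF assms(1,2)] by blast
  obtain b and Y :: "real^'m^'m" where b: "range b \<subseteq> range K"
    "\<And>i j. b i \<bullet> b j = (if i = j then 1 else 0)"
    "\<And>i. K (axis i 1) = (\<Sum>k\<in>UNIV. Y$i$k *\<^sub>R b k)"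
    using orthonormal_frame_expansion[OF assms(3,4)] by blast
  let ?P = "(\<chi> i j. a i \<bullet> b j) :: real^'m^'m"
  have "norm (?P *v x) \<le> norm x" for x
  proof -
    have "?P *v x = (\<chi> i. a i \<bullet> (\<Sum>j\<in>UNIV. x$j *\<^sub>R b j))"
      by (simp add: matrix_vector_mult_def inner_sum_right mult.commute)
    then show ?thesis
      using norm_orthonormal_coordinates_le[of a, OF a(2)] norm_orthonormal_combination[of b x, OF b(2)]
      by metis
  qed
  then have P: "\<bar>det ?P\<bar> \<le> 1" by (rule abs_det_nonexpansive_le_1)
  have "\<bar>det (\<chi> i j. L (axis i 1) \<bullet> K (axis j 1))\<bar> = \<bar>det X\<bar> * \<bar>det ?P\<bar> * \<bar>det Y\<bar>"
    unfolding a(3) b(3) det_cross_gram_linear_combination by (simp add: abs_mult)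
  also have "\<dots> \<le> \<bar>det X\<bar> * 1 * \<bar>det Y\<bar>"
    by (intro mult_right_mono mult_left_mono P) auto
  finally show ?thesis
    unfolding gram_det_axis_expansion[of a L X, OF a(2,3)] gram_det_axis_expansion[of b K Y, OF b(2,3)]
    by simp
qed

section \<open>Charts without a reference submanifold\<close>

text \<open>The Jacobian of the area formula, the square root of det(D\<phi>^T D\<phi>).\<close>

definition gram_jacobian :: "(real^'m::finite \<Rightarrow> real^'n::finite) \<Rightarrow> real^'m \<Rightarrow> real" where
  "gram_jacobian \<phi> x = sqrt (gram_det (coord_frame \<phi> x))"

text \<open>The surrounding submanifold is forgotten, so that charts of different submanifolds
  become members of one family.\<close>

definition chart :: "(real^'m::finite) set \<Rightarrow> (real^'m \<Rightarrow> real^'n::finite) \<Rightarrow> bool" where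
  "chart W \<phi> \<longleftrightarrow> local_parametrization (\<phi> ` W) W \<phi>"

lemma chartI: "local_parametrization M W \<phi> \<Longrightarrow> chart W \<phi>"
  by (simp add: chart_def local_parametrization_def)

lemma continuous_on_det:
  fixes A :: "'a::topological_space \<Rightarrow> real^'m::finite^'m"
  assumes "\<And>i j. continuous_on S (\<lambda>x. A x $ i $ j)"
  shows "continuous_on S (\<lambda>x. det (A x))"
  unfolding det_def by (intro continuous_intros assms)

lemma matrix_inv_left:
  fixes G :: "real^'m::finite^'m"
  assumes "det G \<noteq> 0"
  shows "matrix_inv G ** G = mat 1"
proof -
  have "invertible G" using assms by (simp add: invertible_det_nz)
  then have "\<exists>H. G ** H = mat 1 \<and> H ** G = mat 1" by (simp add: invertible_def)
  then have "G ** matrix_inv G = mat 1 \<and> matrix_inv G ** G = mat 1"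
    unfolding matrix_inv_def by (rule someI_ex)
  then show ?thesis by blast
qed

context
  fixes W :: "(real^'m::finite) set" and \<phi> :: "real^'m \<Rightarrow> real^'n::finite"
  assumes ch: "chart W \<phi>"
begin

lemma chart_open: "open W"
  using ch by (simp add: chart_def local_parametrization_def)

lemma chart_has_derivative:
  assumes "x \<in> W" shows "(\<phi> has_derivative frechet_derivative \<phi> (at x)) (at x within S)"
proof -
  have "Ck_on (Suc 0) W \<phi>" using ch by (auto simp: chart_def local_parametrization_def smooth_on_def)
  then have "\<phi> differentiable (at x)" using assms by simp
  then show ?thesis
    using frechet_derivative_works has_derivative_at_withinI by blast
qed

lemma chart_linear: "x \<in> W \<Longrightarrow> linear (frechet_derivative \<phi> (at x))"
  using chart_has_derivative by (rule has_derivative_linear)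

lemma chart_inj: "x \<in> W \<Longrightarrow> inj (frechet_derivative \<phi> (at x))"
  using ch by (simp add: chart_def local_parametrization_def)

lemma chart_continuous: "continuous_on W \<phi>"
  using ch by (auto simp: chart_def local_parametrization_def smooth_on_def dest: spec[of _ 0])

lemma chart_homeomorphism: obtains \<psi> where "homeomorphism W (\<phi> ` W) \<phi> \<psi>"
  using ch by (auto simp: chart_def local_parametrization_def)

lemma continuous_on_coord_frame: "continuous_on W (\<lambda>x. coord_frame \<phi> x i)"
proof -
  have "Ck_on (Suc 0) W \<phi>" using ch by (auto simp: chart_def local_parametrization_def smooth_on_def)
  then show ?thesis by (simp add: coord_frame_def)
qed

lemma continuous_on_gram_det: "continuous_on W (\<lambda>x. gram_det (coord_frame \<phi> x))"
  unfolding gram_det_def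
  by (rule continuous_on_det) (simp add: continuous_on_inner continuous_on_coord_frame)

lemma gram_det_coord_frame_pos: "x \<in> W \<Longrightarrow> gram_det (coord_frame \<phi> x) > 0"
  unfolding coord_frame_def by (rule gram_det_pos) (auto simp: chart_linear chart_inj)

lemma continuous_on_gram_jacobian: "continuous_on W (gram_jacobian \<phi>)"
  unfolding gram_jacobian_def[abs_def] by (intro continuous_intros continuous_on_gram_det)

lemma gram_jacobian_pos: "x \<in> W \<Longrightarrow> gram_jacobian \<phi> x > 0"
  by (simp add: gram_jacobian_def gram_det_coord_frame_pos)

lemma chart_preimage_borel:
  assumes "A \<in> sets borel" shows "W \<inter> \<phi> -` A \<in> sets borel"
proof -
  have "\<phi> \<in> borel_measurable (restrict_space borel W)"
    using chart_continuous by (rule borel_measurable_continuous_on_restrict)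
  from measurable_sets[OF this assms] show ?thesis
    using chart_open by (auto simp: sets_restrict_space_iff space_restrict_space Int_commute)
qed

text \<open>An open \<open>W\<close> is a countable union of compact sets, hence so is its
  continuous image.\<close>

lemma chart_image_borel: "\<phi> ` W \<in> sets borel"
proof -
  obtain C :: "nat \<Rightarrow> _" where C: "\<And>n. compact (C n)" "\<And>n. C n \<subseteq> W" "\<Union>(range C) = W"
    using open_Union_compact_subsets[OF chart_open] by metis
  have "compact (\<phi> ` C n)" for n
    using C chart_continuous by (intro compact_continuous_image) (auto intro: continuous_on_subset)
  then have "(\<Union>n. \<phi> ` C n) \<in> sets borel" by (auto intro: borel_compact)
  also have "(\<Union>n. \<phi> ` C n) = \<phi> ` W" using C(3) by (auto simp flip: image_UN)
  finally show ?thesis .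
qed

lemma borel_measurable_gram_jacobian: "(\<lambda>x. indicator W x * gram_jacobian \<phi> x) \<in> borel_measurable borel"
  using borel_measurable_continuous_on_indicator[OF _ continuous_on_gram_jacobian] chart_open by simp

lemma borel_measurable_chart: "(\<lambda>x. if x \<in> W then \<phi> x else 0) \<in> borel_measurable borel"
proof -
  have "(\<lambda>x. indicator W x *\<^sub>R \<phi> x) \<in> borel_measurable borel"
    using borel_measurable_continuous_on_indicator[OF _ chart_continuous] chart_open by simp
  moreover have "(\<lambda>x. indicator W x *\<^sub>R \<phi> x) = (\<lambda>x. if x \<in> W then \<phi> x else 0)"
    by (auto simp: indicator_def)
  ultimately show ?thesis by simp
qed

end

text \<open>The value 0 outside \<open>W\<close> only makes the map total; the density vanishes
  there, so the default contributes nothing.\<close>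

definition chart_measure :: "(real^'m::finite) set \<Rightarrow> (real^'m \<Rightarrow> real^'n::finite) \<Rightarrow> (real^'n) measure" where
  "chart_measure W \<phi> =
    distr (density lborel (\<lambda>x. ennreal (indicator W x * gram_jacobian \<phi> x))) borel (\<lambda>x. if x \<in> W then \<phi> x else 0)"

lemma sets_chart_measure [simp, measurable_cong]: "sets (chart_measure W \<phi>) = sets borel"
  by (simp add: chart_measure_def)

lemma emeasure_chart_measure:
  assumes ch: "chart W \<phi>" and A: "A \<in> sets borel"
  shows "emeasure (chart_measure W \<phi>) A = (\<integral>\<^sup>+x. ennreal (indicator (W \<inter> \<phi> -` A) x * gram_jacobian \<phi> x) \<partial>lborel)"
proof -
  let ?f = "\<lambda>x. if x \<in> W then \<phi> x else 0"
  have f: "?f \<in> borel_measurable borel" using ch by (rule borel_measurable_chart)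
  have fA: "?f -` A \<in> sets borel" using measurable_sets[OF f A] by simp
  have "emeasure (chart_measure W \<phi>) A = emeasure (density lborel (\<lambda>x. ennreal (indicator W x * gram_jacobian \<phi> x))) (?f -` A)"
    unfolding chart_measure_def using f A by (subst emeasure_distr) auto
  also have "\<dots> = (\<integral>\<^sup>+x. ennreal (indicator W x * gram_jacobian \<phi> x) * indicator (?f -` A) x \<partial>lborel)"
    using fA borel_measurable_gram_jacobian[OF ch] by (subst emeasure_density) auto
  also have "\<dots> = (\<integral>\<^sup>+x. ennreal (indicator (W \<inter> \<phi> -` A) x * gram_jacobian \<phi> x) \<partial>lborel)"
    by (rule nn_integral_cong) (auto simp: indicator_def)
  finally show ?thesis .
qed

text \<open>
  The derivative of the transition map within \<open>\<phi>\<^sup>-\<^sup>1 C\<close> need not be unique at points where this set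
  is thin. The derivative \<open>L \<circ> D\<phi>\<close> used here, with \<open>L\<close> the least squares left inverse of \<open>D\<theta>\<close>,
  may have too small a determinant there. This yields only an inequality, but the reverse one
  follows by exchanging the charts, so that no density theorem is needed.
\<close>

lemma chart_measure_le:
  fixes \<phi> \<theta> :: "real^'m::finite \<Rightarrow> real^'n::finite"
  assumes \<phi>: "chart W \<phi>" and \<theta>: "chart V \<theta>" and C: "C \<in> sets borel" "C \<subseteq> \<phi> ` W \<inter> \<theta> ` V"
  shows "emeasure (chart_measure V \<theta>) C \<le> emeasure (chart_measure W \<phi>) C"
proof -
  obtain \<psi> where \<psi>: "homeomorphism V (\<theta> ` V) \<theta> \<psi>" by (rule chart_homeomorphism[OF \<theta>])
  define S where "S = W \<inter> \<phi> -` C"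
  define g where "g x = \<psi> (\<phi> x)" for x
  have S: "S \<in> sets borel" unfolding S_def by (rule chart_preimage_borel[OF \<phi> C(1)])
  have SW: "S \<subseteq> W" by (auto simp: S_def)
  have \<phi>S: "\<phi> ` S = C" using C by (auto simp: S_def)
  have g: "g x \<in> V" "\<theta> (g x) = \<phi> x" if "x \<in> S" for x
    using that C \<psi> unfolding g_def S_def homeomorphism_def by auto
  have gS: "g ` S = V \<inter> \<theta> -` C"
  proof
    show "g ` S \<subseteq> V \<inter> \<theta> -` C" using g by (auto simp: S_def)
    show "V \<inter> \<theta> -` C \<subseteq> g ` S"
    proof
      fix y assume y: "y \<in> V \<inter> \<theta> -` C"
      then obtain x where x: "x \<in> S" "\<phi> x = \<theta> y" using \<phi>S by (metis IntD2 imageE vimageE)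
      then have "g x = y" using \<psi> y by (auto simp: g_def homeomorphism_def)
      with x show "y \<in> g ` S" by auto
    qed
  qed
  have cont_g: "continuous_on S g"
    unfolding g_def
  proof (rule continuous_on_compose2[of "\<theta> ` V" \<psi>])
    show "continuous_on S \<phi>" using chart_continuous[OF \<phi>] SW by (rule continuous_on_subset)
    show "continuous_on (\<theta> ` V) \<psi>" using \<psi> by (simp add: homeomorphism_def)
    show "\<phi> ` S \<subseteq> \<theta> ` V" using \<phi>S C by auto
  qed
  \<comment> \<open>In matrix terms \<open>G\<close> is D\<theta>^T D\<theta> and \<open>X\<close>
    is D\<theta>^T D\<phi>, so \<open>L\<close> is G^-1 D\<theta>^T and the candidate derivative of
    \<open>g\<close> is G^-1 X.\<close>
  define G where "G y = (\<chi> i j. coord_frame \<theta> y i \<bullet> coord_frame \<theta> y j)" for y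
  define L where "L y v = matrix_inv (G y) *v (\<chi> i. coord_frame \<theta> y i \<bullet> v)" for y v
  define X where "X x = (\<chi> i j. coord_frame \<theta> (g x) i \<bullet> coord_frame \<phi> x j)" for x
  have detG: "det (G y) = gram_det (coord_frame \<theta> y)" for y by (simp add: G_def gram_det_def)
  have detG_pos: "det (G y) > 0" if "y \<in> V" for y
    unfolding detG using that by (rule gram_det_coord_frame_pos[OF \<theta>])
  have linL: "linear (L y)" for y
    unfolding L_def
    by (intro linearI) (simp_all add: inner_add_right vec_eq_iff matrix_vector_mult_def algebra_simps sum.distrib sum_distrib_left)
  have LD: "L y \<circ> frechet_derivative \<theta> (at y) = id" if y: "y \<in> V" for y
  proof
    fix v :: "real^'m"
    have lin: "linear (frechet_derivative \<theta> (at y))" using chart_linear[OF \<theta> y] .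
    have "frechet_derivative \<theta> (at y) v = frechet_derivative \<theta> (at y) (\<Sum>j\<in>UNIV. v$j *\<^sub>R axis j 1)"
      by (metis basis_expansion scalar_mult_eq_scaleR)
    also have "\<dots> = (\<Sum>j\<in>UNIV. v$j *\<^sub>R coord_frame \<theta> y j)"
      using lin by (simp add: linear_sum linear_scale o_def coord_frame_def)
    finally have D: "frechet_derivative \<theta> (at y) v = (\<Sum>j\<in>UNIV. v$j *\<^sub>R coord_frame \<theta> y j)" .
    have "(\<chi> i. coord_frame \<theta> y i \<bullet> frechet_derivative \<theta> (at y) v) = G y *v v"
      unfolding D by (simp add: G_def matrix_vector_mult_def inner_sum_right mult.commute)
    then have "L y (frechet_derivative \<theta> (at y) v) = matrix_inv (G y) *v (G y *v v)"
      by (simp add: L_def)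
    also have "\<dots> = v"
      using matrix_inv_left[of "G y"] detG_pos[OF y] by (simp add: matrix_vector_mul_assoc)
    finally show "(L y \<circ> frechet_derivative \<theta> (at y)) v = id v" by simp
  qed
  let ?g' = "\<lambda>x v. L (g x) (frechet_derivative \<phi> (at x) v)"
  have der: "(g has_derivative ?g' x) (at x within S)" if x: "x \<in> S" for x
  proof -
    \<comment> \<open>A left inverse of the derivative is enough to differentiate the continuous
      inverse \<open>\<psi>\<close> within the image of \<open>\<theta>\<close>; no extension of
      \<open>\<psi>\<close> to a neighbourhood is required.\<close>
    have 1: "(\<psi> has_derivative L (g x)) (at (\<theta> (g x)) within \<theta> ` V)"
    proof (rule has_derivative_inverse_within)
      show "(\<theta> has_derivative frechet_derivative \<theta> (at (g x))) (at (g x) within V)"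
        using g[OF x] by (intro chart_has_derivative[OF \<theta>])
      show "continuous (at (\<theta> (g x)) within \<theta> ` V) \<psi>"
        using \<psi> g[OF x] by (auto simp: homeomorphism_def continuous_on_eq_continuous_within)
      show "L (g x) \<circ> frechet_derivative \<theta> (at (g x)) = id" using g[OF x] by (intro LD)
    qed (use g[OF x] linL \<psi> in \<open>auto simp: homeomorphism_def\<close>)
    have 2: "(\<psi> has_derivative L (g x)) (at (\<phi> x) within \<phi> ` S)"
      using 1 unfolding g(2)[OF x] \<phi>S by (rule has_derivative_subset) (use C in auto)
    have 3: "(\<phi> has_derivative frechet_derivative \<phi> (at x)) (at x within S)"
      using x SW by (intro chart_has_derivative[OF \<phi>]) auto
    show ?thesis using diff_chain_within[OF 3 2] by (simp add: o_def g_def[abs_def])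
  qed
  have det_g': "det (matrix (?g' x)) = det (X x) / gram_det (coord_frame \<theta> (g x))" if x: "x \<in> S" for x
  proof -
    have "matrix (?g' x) = matrix_inv (G (g x)) ** X x"
      by (simp add: matrix_def L_def X_def coord_frame_def matrix_matrix_mult_def
          matrix_vector_mult_def vec_eq_iff)
    moreover have "det (matrix_inv (G (g x))) * det (G (g x)) = 1"
      using matrix_inv_left[of "G (g x)"] detG_pos[of "g x"] g[OF x] by (metis det_I det_mul less_irrefl)
    ultimately show ?thesis
      using detG_pos[of "g x"] g[OF x] unfolding detG by (simp add: det_mul field_simps)
  qed
  \<comment> \<open>The determinant of G^-1 X has the full Gram determinant of
    \<open>\<theta>\<close> below; the integrand \<open>gram_jacobian \<theta>\<close> cancels one
    square root of it.\<close>
  define h where "h x = \<bar>det (X x)\<bar> / sqrt (gram_det (coord_frame \<theta> (g x)))" for x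
  have hg': "\<bar>det (matrix (?g' x))\<bar> * gram_jacobian \<theta> (g x) = h x" if x: "x \<in> S" for x
  proof -
    have "gram_det (coord_frame \<theta> (g x)) > 0"
      using g[OF x] by (intro gram_det_coord_frame_pos[OF \<theta>])
    then have "\<bar>d / gram_det (coord_frame \<theta> (g x))\<bar> * sqrt (gram_det (coord_frame \<theta> (g x))) =
        \<bar>d\<bar> / sqrt (gram_det (coord_frame \<theta> (g x)))" for d
      by (simp add: abs_divide divide_simps)
    then show ?thesis unfolding h_def gram_jacobian_def det_g'[OF x] .
  qed
  \<comment> \<open>This is where the projection bound enters; the inequality is strict at points
    where the two tangent spaces differ.\<close>
  have hle: "h x \<le> gram_jacobian \<phi> x" if x: "x \<in> S" for x
  proof -
    have "\<bar>det (X x)\<bar> \<le> gram_jacobian \<theta> (g x) * gram_jacobian \<phi> x"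
      unfolding X_def gram_jacobian_def coord_frame_def
      by (rule abs_det_cross_gram_le)
        (use x SW g[OF x] in \<open>auto simp: chart_linear[OF \<phi>] chart_inj[OF \<phi>] chart_linear[OF \<theta>] chart_inj[OF \<theta>]\<close>)
    then show ?thesis
      using gram_jacobian_pos[OF \<theta>, of "g x"] g[OF x]
      by (simp add: h_def field_simps flip: gram_jacobian_def)
  qed
  \<comment> \<open>The set \<open>S\<close> is merely Borel, but \<open>h\<close> is built from
    frames that are continuous along \<open>g\<close>, and continuity on a Borel set gives
    measurability.\<close>
  have cf\<theta>: "continuous_on S (\<lambda>x. coord_frame \<theta> (g x) i)" for i
    by (rule continuous_on_compose2[OF continuous_on_coord_frame[OF \<theta>] cont_g]) (use g in auto)
  have cf\<phi>: "continuous_on S (\<lambda>x. coord_frame \<phi> x i)" for i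
    using continuous_on_coord_frame[OF \<phi>] SW by (rule continuous_on_subset)
  have "continuous_on S (\<lambda>x. det (X x))"
    by (rule continuous_on_det) (simp add: X_def continuous_on_inner cf\<theta> cf\<phi>)
  moreover have "continuous_on S (\<lambda>x. gram_det (coord_frame \<theta> (g x)))"
    by (rule continuous_on_compose2[OF continuous_on_gram_det[OF \<theta>] cont_g]) (use g in auto)
  ultimately have cont_h: "continuous_on S h"
    unfolding h_def using gram_det_coord_frame_pos[OF \<theta>] g
    by (intro continuous_intros) (auto simp: less_imp_neq[symmetric])
  have meas_h: "(\<lambda>x. indicator S x * h x) \<in> borel_measurable borel"
    using borel_measurable_continuous_on_indicator[OF S cont_h] by simp
  have gSb: "g ` S \<in> sets borel" unfolding gS by (rule chart_preimage_borel[OF \<theta> C(1)])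
  have eq: "(\<lambda>x. indicator S x * (\<bar>det (matrix (?g' x))\<bar> * gram_jacobian \<theta> (g x))) = (\<lambda>x. indicator S x * h x)"
    using hg' by (auto simp: indicator_def)
  have "emeasure (chart_measure V \<theta>) C = (\<integral>\<^sup>+y. ennreal (indicator (g ` S) y * gram_jacobian \<theta> y) \<partial>lborel)"
    unfolding gS by (rule emeasure_chart_measure[OF \<theta> C(1)])
  also have "\<dots> \<le> (\<integral>\<^sup>+x. ennreal (indicator S x * (\<bar>det (matrix (?g' x))\<bar> * gram_jacobian \<theta> (g x))) \<partial>lborel)"
  proof (rule nn_integral_image_le)
    show "0 \<le> gram_jacobian \<theta> (g x)" if "x \<in> S" for x
      using gram_jacobian_pos[OF \<theta>, of "g x"] g[OF that] by simp
    show "(\<lambda>y. indicator (g ` S) y * gram_jacobian \<theta> y) \<in> borel_measurable borel"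
    proof -
      have "continuous_on (g ` S) (gram_jacobian \<theta>)"
        using continuous_on_gram_jacobian[OF \<theta>] by (rule continuous_on_subset) (use g in auto)
      from borel_measurable_continuous_on_indicator[OF gSb this] show ?thesis by simp
    qed
  qed (use der meas_h eq in auto)
  also have "\<dots> \<le> (\<integral>\<^sup>+x. ennreal (indicator S x * gram_jacobian \<phi> x) \<partial>lborel)"
    by (intro nn_integral_mono ennreal_leI) (auto simp: indicator_def hg' hle)
  also have "\<dots> = emeasure (chart_measure W \<phi>) C"
    unfolding S_def by (rule emeasure_chart_measure[OF \<phi> C(1), symmetric])
  finally show ?thesis .
qed

lemma chart_measure_eq:
  fixes \<phi> \<theta> :: "real^'m::finite \<Rightarrow> real^'n::finite"
  assumes "chart W \<phi>" "chart V \<theta>" "C \<in> sets borel" "C \<subseteq> \<phi> ` W \<inter> \<theta> ` V"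
  shows "emeasure (chart_measure W \<phi>) C = emeasure (chart_measure V \<theta>) C"
  using assms by (intro antisym chart_measure_le) auto

section \<open>Gluing compatible measures\<close>

lemma suminf_swap_ennreal:
  fixes f :: "nat \<Rightarrow> nat \<Rightarrow> ennreal"
  shows "(\<Sum>i. \<Sum>j. f i j) = (\<Sum>j. \<Sum>i. f i j)"
proof -
  have "(\<Sum>i. \<Sum>j. f i j) = (\<integral>\<^sup>+i. (\<Sum>j. f i j) \<partial>count_space UNIV)"
    by (rule nn_integral_count_space_nat[symmetric])
  also have "\<dots> = (\<Sum>j. \<integral>\<^sup>+i. f i j \<partial>count_space UNIV)"
    by (rule nn_integral_suminf) simp
  finally show ?thesis by (simp add: nn_integral_count_space_nat)
qed

text \<open>The index set may be uncountable, and the measures need agree only on measurable subsets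
  of the overlaps; nothing is said about \<open>\<nu> i\<close> outside \<open>U i\<close>.\<close>

locale compatible_measures =
  fixes N :: "'a measure" and I :: "'i set" and U :: "'i \<Rightarrow> 'a set" and \<nu> :: "'i \<Rightarrow> 'a measure"
  assumes nonempty: "I \<noteq> {}"
    and sets_\<nu>: "i \<in> I \<Longrightarrow> sets (\<nu> i) = sets N"
    and U_sets: "i \<in> I \<Longrightarrow> U i \<in> sets N"
    and compat: "\<lbrakk>i \<in> I; j \<in> I; A \<in> sets N; A \<subseteq> U i \<inter> U j\<rbrakk> \<Longrightarrow> emeasure (\<nu> i) A = emeasure (\<nu> j) A"
begin

definition covers :: "(nat \<Rightarrow> 'i) \<Rightarrow> 'a set \<Rightarrow> bool" where
  "covers c A \<longleftrightarrow> range c \<subseteq> I \<and> A \<subseteq> (\<Union>k. U (c k))"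

text \<open>Disjointing assigns each point to the first member of the cover that contains it, so
  that overlaps are counted once.\<close>

definition cover_value :: "(nat \<Rightarrow> 'i) \<Rightarrow> 'a set \<Rightarrow> ennreal" where
  "cover_value c A = (\<Sum>k. emeasure (\<nu> (c k)) (A \<inter> disjointed (\<lambda>k. U (c k)) k))"

text \<open>Sets that are not covered by countably many \<open>U i\<close> get infinite measure.\<close>

definition glued_value :: "'a set \<Rightarrow> ennreal" where
  "glued_value A = (if \<exists>c. covers c A then cover_value (SOME c. covers c A) A else \<infinity>)"

definition glued :: "'a measure" where
  "glued = measure_of (space N) (sets N) glued_value"

lemma covers_disjointed:
  assumes "covers c A"
  shows "disjointed (\<lambda>k. U (c k)) k \<in> sets N" "(\<Union>k. A \<inter> disjointed (\<lambda>k. U (c k)) k) = A"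
proof -
  have "range (\<lambda>k. U (c k)) \<subseteq> sets N" using assms U_sets by (auto simp: covers_def)
  then have "range (disjointed (\<lambda>k. U (c k))) \<subseteq> sets N" by (rule sets.range_disjointed_sets)
  then show "disjointed (\<lambda>k. U (c k)) k \<in> sets N" by auto
  have "(\<Union>k. A \<inter> disjointed (\<lambda>k. U (c k)) k) = A \<inter> (\<Union>k. U (c k))"
    by (metis Int_UN_distrib UN_disjointed_eq)
  then show "(\<Union>k. A \<inter> disjointed (\<lambda>k. U (c k)) k) = A" using assms by (auto simp: covers_def)
qed

lemma suminf_emeasure_disjointed:
  assumes "i \<in> I" "A \<in> sets N" "covers c A"
  shows "(\<Sum>k. emeasure (\<nu> i) (A \<inter> disjointed (\<lambda>k. U (c k)) k)) = emeasure (\<nu> i) A"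
proof -
  have "disjoint_family (\<lambda>k. A \<inter> disjointed (\<lambda>k. U (c k)) k)"
    using disjoint_family_disjointed[of "\<lambda>k. U (c k)"] unfolding disjoint_family_on_def by blast
  then have "(\<Sum>k. emeasure (\<nu> i) (A \<inter> disjointed (\<lambda>k. U (c k)) k)) =
      emeasure (\<nu> i) (\<Union>k. A \<inter> disjointed (\<lambda>k. U (c k)) k)"
    by (intro suminf_emeasure) (use assms sets_\<nu> covers_disjointed(1) in auto)
  then show ?thesis using covers_disjointed(2)[OF assms(3)] by simp
qed

text \<open>Common refinement: each cell lies in one member of either cover, so the two measures
  agree on it, and the double series may be summed in either order.\<close>

lemma cover_value_eq:
  assumes A: "A \<in> sets N" and c: "covers c A" and d: "covers d A"
  shows "cover_value c A = cover_value d A"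
proof -
  let ?C = "disjointed (\<lambda>k. U (c k))" and ?D = "disjointed (\<lambda>k. U (d k))"
  have I: "c k \<in> I" "d k \<in> I" for k using c d by (auto simp: covers_def)
  have dm: "covers d (A \<inter> X)" "covers c (A \<inter> X)" for X using c d by (auto simp: covers_def)
  have "cover_value c A = (\<Sum>k. \<Sum>l. emeasure (\<nu> (c k)) ((A \<inter> ?C k) \<inter> ?D l))"
    unfolding cover_value_def
    using suminf_emeasure_disjointed[OF I(1) _ dm(1), of "?C _"] A covers_disjointed(1)[OF c]
    by simp
  also have "\<dots> = (\<Sum>k. \<Sum>l. emeasure (\<nu> (d l)) ((A \<inter> ?C k) \<inter> ?D l))"
  proof (intro suminf_cong)
    fix k l
    show "emeasure (\<nu> (c k)) ((A \<inter> ?C k) \<inter> ?D l) = emeasure (\<nu> (d l)) ((A \<inter> ?C k) \<inter> ?D l)"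
      using A covers_disjointed(1)[OF c] covers_disjointed(1)[OF d]
        disjointed_subset[of "\<lambda>k. U (c k)" k] disjointed_subset[of "\<lambda>k. U (d k)" l]
      by (intro compat I) auto
  qed
  also have "\<dots> = (\<Sum>l. \<Sum>k. emeasure (\<nu> (d l)) ((A \<inter> ?D l) \<inter> ?C k))"
    by (subst suminf_swap_ennreal) (simp add: Int_ac)
  also have "\<dots> = cover_value d A"
    unfolding cover_value_def
    using suminf_emeasure_disjointed[OF I(2) _ dm(2), of "?D _"] A covers_disjointed(1)[OF d]
    by simp
  finally show ?thesis .
qed

lemma glued_value_eq:
  assumes "A \<in> sets N" "covers c A"
  shows "glued_value A = cover_value c A"
proof -
  have "covers (SOME c. covers c A) A" by (rule someI[of "\<lambda>c. covers c A", OF assms(2)])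
  moreover have "glued_value A = cover_value (SOME c. covers c A) A"
    using assms(2) unfolding glued_value_def by (subst if_P) blast+
  ultimately show ?thesis using cover_value_eq[OF assms(1)] assms(2) by metis
qed

lemma space_glued: "space glued = space N"
  by (simp add: glued_def space_measure_of sets.space_closed)

lemma sets_glued: "sets glued = sets N"
  by (simp add: glued_def sets.space_closed sets.sigma_sets_eq)

text \<open>Only countable additivity needs an argument. A countable cover of the union serves every
  term. If there is none, some term has none either, since countably many countable covers combine
  to a countable one, and then both sides are infinite.\<close>

lemma emeasure_glued:
  assumes "A \<in> sets N"
  shows "emeasure glued A = glued_value A"
proof (rule emeasure_measure_of[OF glued_def])
  obtain i where i: "i \<in> I" using nonempty by auto
  then have "covers (\<lambda>_. i) {}" by (auto simp: covers_def)
  then have "glued_value {} = 0"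
    using glued_value_eq[of "{}"] by (simp add: cover_value_def)
  then show "positive (sets glued) glued_value" by (simp add: positive_def)
  show "countably_additive (sets glued) glued_value"
  proof (rule countably_additiveI)
    fix A :: "nat \<Rightarrow> 'a set"
    assume A: "range A \<subseteq> sets glued" "disjoint_family A" "\<Union>(range A) \<in> sets glued"
    then have AN: "A k \<in> sets N" for k by (auto simp: sets_glued)
    show "(\<Sum>k. glued_value (A k)) = glued_value (\<Union>(range A))"
    proof (cases "\<exists>c. covers c (\<Union>(range A))")
      case True
      then obtain c where c: "covers c (\<Union>(range A))" by blast
      then have ck: "covers c (A k)" "c l \<in> I" for k l unfolding covers_def by blast+
      let ?C = "disjointed (\<lambda>k. U (c k))"
      have "(\<Sum>k. glued_value (A k)) = (\<Sum>k. \<Sum>l. emeasure (\<nu> (c l)) (A k \<inter> ?C l))"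
        by (simp add: glued_value_eq[OF AN ck(1)] cover_value_def)
      also have "\<dots> = (\<Sum>l. \<Sum>k. emeasure (\<nu> (c l)) (A k \<inter> ?C l))"
        by (rule suminf_swap_ennreal)
      also have "\<dots> = (\<Sum>l. emeasure (\<nu> (c l)) (\<Union>k. A k \<inter> ?C l))"
      proof (intro suminf_cong suminf_emeasure)
        fix l
        show "range (\<lambda>k. A k \<inter> ?C l) \<subseteq> sets (\<nu> (c l))"
          using AN covers_disjointed(1)[OF c] sets_\<nu>[OF ck(2)] by auto
        show "disjoint_family (\<lambda>k. A k \<inter> ?C l)"
          using A(2) by (auto simp: disjoint_family_on_def)
      qed
      also have "\<dots> = cover_value c (\<Union>(range A))"
        by (simp add: cover_value_def)
      also have "\<dots> = glued_value (\<Union>(range A))"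
        using AN c by (intro glued_value_eq[symmetric]) auto
      finally show ?thesis .
    next
      case False
      have "\<exists>k. \<nexists>c. covers c (A k)"
      proof (rule ccontr)
        assume "\<not> (\<exists>k. \<nexists>c. covers c (A k))"
        then obtain c where c: "\<And>k. covers (c k) (A k)" by metis
        \<comment> \<open>All covers \<open>c k\<close> are merged into one sequence through the
          pairing bijection on the natural numbers.\<close>
        define d where "d n = c (fst (prod_decode n)) (snd (prod_decode n))" for n
        have "covers d (\<Union>(range A))"
          unfolding covers_def
        proof (intro conjI subsetI)
          fix x assume "x \<in> \<Union>(range A)"
          then obtain k where "x \<in> A k" by blast
          then obtain l where "x \<in> U (c k l)" using c[of k] unfolding covers_def by blast
          then have "x \<in> U (d (prod_encode (k, l)))" by (simp add: d_def)
          then show "x \<in> (\<Union>n. U (d n))" by blast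
        next
          fix i assume "i \<in> range d"
          then show "i \<in> I" using c by (auto simp: covers_def d_def)
        qed
        then show False using False by blast
      qed
      then obtain k where "\<nexists>c. covers c (A k)" by blast
      then have k: "glued_value (A k) = \<infinity>" by (simp add: glued_value_def)
      have "glued_value (A k) \<le> (\<Sum>k. glued_value (A k))"
        using sum_le_suminf[of "\<lambda>k. glued_value (A k)" "{k}"] by simp
      then have "(\<Sum>k. glued_value (A k)) = \<infinity>" using k by (simp add: top_unique)
      moreover have "glued_value (\<Union>(range A)) = \<infinity>" using False by (simp add: glued_value_def)
      ultimately show ?thesis by simp
    qed
  qed
qed (use assms in \<open>auto simp: sets.space_closed sets_glued\<close>)

lemma emeasure_glued_member:
  assumes "i \<in> I" "A \<in> sets N" "A \<subseteq> U i"
  shows "emeasure glued A = emeasure (\<nu> i) A"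
proof -
  have c: "covers (\<lambda>_. i) A" using assms by (auto simp: covers_def)
  show ?thesis
    using suminf_emeasure_disjointed[OF assms(1,2) c] emeasure_glued[OF assms(2)]
      glued_value_eq[OF assms(2) c] by (simp add: cover_value_def)
qed

end

section \<open>The common measure of all charts\<close>

text \<open>Ensures that the family of charts to be glued is not empty.\<close>

lemma chart_empty: "chart {} \<phi>"
proof -
  have "Ck_on k {} f" for k and f :: "real^'a \<Rightarrow> real^'b"
    by (induction k arbitrary: f) auto
  then show ?thesis
    by (auto simp: chart_def local_parametrization_def smooth_on_def homeomorphism_def)
qed

interpretation chart_measures: compatible_measures
  "borel :: (real^'n::finite) measure"
  "{c :: (real^'m::finite) set \<times> (real^'m \<Rightarrow> real^'n). chart (fst c) (snd c)}"
  "\<lambda>c. snd c ` fst c" "\<lambda>c. chart_measure (fst c) (snd c)"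
proof
  show "{c :: (real^'m::finite) set \<times> (real^'m \<Rightarrow> real^'n). chart (fst c) (snd c)} \<noteq> {}"
    using chart_empty by force
qed (auto intro: chart_image_borel chart_measure_eq)

text \<open>The common extension of all chart measures; every volume measure is a restriction of it.\<close>

definition global_volume :: "'m::finite itself \<Rightarrow> (real^'n::finite) measure" where
  "global_volume _ = compatible_measures.glued (borel :: (real^'n) measure)
    {c :: (real^'m) set \<times> (real^'m \<Rightarrow> real^'n). chart (fst c) (snd c)}
    (\<lambda>c. snd c ` fst c) (\<lambda>c. chart_measure (fst c) (snd c))"

lemma sets_global_volume [simp, measurable_cong]: "sets (global_volume TYPE('m::finite)) = sets (borel :: (real^'n::finite) measure)"
  by (simp add: global_volume_def chart_measures.sets_glued)

lemma space_global_volume [simp]: "space (global_volume TYPE('m::finite)) = (UNIV :: (real^'n::finite) set)"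
  by (simp add: global_volume_def chart_measures.space_glued)

lemma emeasure_global_volume_chart:
  fixes \<phi> :: "real^'m::finite \<Rightarrow> real^'n::finite"
  assumes "chart W \<phi>" "A \<in> sets borel" "A \<subseteq> \<phi> ` W"
  shows "emeasure (global_volume TYPE('m)) A = emeasure (chart_measure W \<phi>) A"
  unfolding global_volume_def
  using chart_measures.emeasure_glued_member[of "(W, \<phi>)" A] assms by simp

section \<open>Topology of submanifolds\<close>

text \<open>A locally compact \<open>M\<close> is relatively closed in an open \<open>T\<close>, and
  a whole closed tube around \<open>K\<close> fits into \<open>T\<close>. Its trace on
  \<open>M\<close> is the intersection of a compact set with a closed one. The radius becomes the
  support width of the cutoff functions.\<close>

lemma locally_compact_supports:
  fixes M :: "'a::heine_borel set"
  assumes M: "locally compact M" and K: "compact K" "K \<subseteq> M" "K \<noteq> {}"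
  obtains e where "e > 0" "compact ({x. infdist x K \<le> e} \<inter> M)"
proof -
  obtain T where T: "open T" "closedin (top_of_set T) M"
    using locally_compact_closedin_open[OF M] .
  have "K \<subseteq> T" using K T(2) by (auto dest: closedin_imp_subset)
  then obtain e where e: "e > 0" "(\<Union>x\<in>K. cball x e) \<subseteq> T"
    using compact_subset_open_imp_cball_epsilon_subset[OF K(1) T(1)] by metis
  have sub: "{x. infdist x K \<le> e} \<subseteq> T"
  proof
    fix x assume x: "x \<in> {x. infdist x K \<le> e}"
    obtain y where "y \<in> K" "infdist x K = dist x y"
      using infdist_attains_inf[OF compact_imp_closed[OF K(1)] K(3)] by metis
    then have "x \<in> cball y e" using x by (simp add: dist_commute)
    moreover have "cball y e \<subseteq> T" using e(2) \<open>y \<in> K\<close> by blast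
    ultimately show "x \<in> T" by blast
  qed
  obtain C where C: "closed C" "M = T \<inter> C" using T(2) by (auto simp: closedin_closed)
  have "{x. infdist x K \<le> e} \<inter> M = {x. infdist x K \<le> e} \<inter> C" using sub C by auto
  then have "compact ({x. infdist x K \<le> e} \<inter> M)"
    using compact_Int_closed[OF compact_infdist_le[OF K(3,1) e(1)] C(1)] by simp
  with e(1) show ?thesis by (rule that)
qed

lemma locally_compact_sigma_compact:
  fixes M :: "'a::euclidean_space set"
  assumes M: "locally compact M"
  obtains K :: "nat \<Rightarrow> 'a set" where "\<And>n. compact (K n)" "(\<Union>n. K n) = M"
proof -
  obtain T where T: "open T" "closedin (top_of_set T) M"
    using locally_compact_closedin_open[OF M] .
  obtain C where C: "closed C" "M = T \<inter> C" using T(2) by (auto simp: closedin_closed)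
  obtain D :: "nat \<Rightarrow> 'a set" where D: "\<And>n. compact (D n)" "\<And>n. D n \<subseteq> T" "\<Union>(range D) = T"
    using open_Union_compact_subsets[OF T(1)] by metis
  have "(\<Union>n. D n \<inter> C) = M" using D C by auto
  then show ?thesis using D(1) C(1) by (intro that[of "\<lambda>n. D n \<inter> C"]) (auto intro: compact_Int_closed)
qed

lemma locally_compact_borel:
  fixes M :: "'a::euclidean_space set"
  assumes "locally compact M" shows "M \<in> sets borel"
proof -
  obtain K :: "nat \<Rightarrow> 'a set" where "\<And>n. compact (K n)" "(\<Union>n. K n) = M"
    using locally_compact_sigma_compact[OF assms] by metis
  then show ?thesis by (metis borel_compact sets.countable_UN range_subsetD image_subsetI)
qed

text \<open>A relatively closed set is the countable union of its traces on a compact exhaustion of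
  \<open>M\<close>.\<close>

lemma sets_restrict_borel_compact_generated:
  fixes M :: "'a::euclidean_space set"
  assumes M: "locally compact M"
  shows "sets (restrict_space borel M) = sigma_sets M {K. compact K \<and> K \<subseteq> M}"
proof
  obtain K :: "nat \<Rightarrow> 'a set" where K: "\<And>n. compact (K n)" "(\<Union>n. K n) = M"
    using locally_compact_sigma_compact[OF M] by metis
  have "sets (restrict_space borel M) = (\<inter>) M ` sigma_sets UNIV (Collect closed)"
    by (simp add: sets_restrict_space borel_eq_closed)
  also have "\<dots> = sigma_sets M ((\<inter>) M ` Collect closed)"
    using sigma_sets_Int[of M UNIV "Collect closed"] locally_compact_borel[OF M]
    by (simp add: borel_eq_closed Int_commute)
  also have "\<dots> \<subseteq> sigma_sets M {K. compact K \<and> K \<subseteq> M}"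
  proof (rule sigma_sets_mono, rule subsetI)
    fix A assume "A \<in> (\<inter>) M ` Collect closed"
    then obtain C where C: "closed C" "A = M \<inter> C" by auto
    then have "A = (\<Union>n. K n \<inter> C)" using K by auto
    moreover have "K n \<inter> C \<in> sigma_sets M {K. compact K \<and> K \<subseteq> M}" for n
      using K C by (intro sigma_sets.Basic) (auto intro: compact_Int_closed)
    ultimately show "A \<in> sigma_sets M {K. compact K \<and> K \<subseteq> M}"
      using sigma_sets.Union[of "\<lambda>n. K n \<inter> C"] by simp
  qed
  finally show "sets (restrict_space borel M) \<subseteq> sigma_sets M {K. compact K \<and> K \<subseteq> M}" .
  have "{K. compact K \<and> K \<subseteq> M} \<subseteq> sets (restrict_space borel M)"
    using locally_compact_borel[OF M] by (auto simp: sets_restrict_space_iff borel_compact)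
  then have "sigma_sets (space (restrict_space borel M)) {K. compact K \<and> K \<subseteq> M} \<subseteq> sets (restrict_space borel M)"
    by (rule sets.sigma_sets_subset)
  then show "sigma_sets M {K. compact K \<and> K \<subseteq> M} \<subseteq> sets (restrict_space borel M)"
    by (simp add: space_restrict_space)
qed

text \<open>The uniqueness half of the Riesz representation theorem. Indicators of compact sets are
  limits of continuous tents with compact support, and compact sets are an intersection-stable
  generator with a countable exhaustion of finite measure.\<close>

lemma measure_eqI_compactly_supported:
  fixes M :: "(real^'n::finite) set"
  assumes M: "locally compact M"
    and sets: "sets \<mu> = sets (restrict_space borel M)" "sets \<nu> = sets (restrict_space borel M)"
    and eq: "\<And>f. continuous_on M f \<Longrightarrow> compactly_supported M f \<Longrightarrow>
      integrable \<mu> f \<and> integrable \<nu> f \<and> (LINT p|\<mu>. f p) = (LINT p|\<nu>. f p)"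
  shows "\<mu> = \<nu>"
proof -
  have space: "space \<mu> = M" "space \<nu> = M"
    using sets_eq_imp_space_eq[OF sets(1)] sets_eq_imp_space_eq[OF sets(2)] by (auto simp: space_restrict_space)
  have compact_sets: "K \<in> sets (restrict_space borel M)" if "compact K" "K \<subseteq> M" for K
    using that locally_compact_borel[OF M] by (auto simp: sets_restrict_space_iff borel_compact)
  have K: "emeasure \<mu> K = emeasure \<nu> K \<and> emeasure \<mu> K \<noteq> \<infinity>" if K: "compact K" "K \<subseteq> M" for K
  proof (cases "K = {}")
    case False
    obtain e where e: "e > 0" "compact ({x. infdist x K \<le> e} \<inter> M)"
      using locally_compact_supports[OF M K False] .
    \<comment> \<open>The slope \<open>1 / e\<close> already makes the tent vanish beyond distance
      \<open>e\<close>, inside the compact tube; adding \<open>real i\<close> steepens it towards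
      the indicator of \<open>K\<close>. The widest tent \<open>f 0\<close> is the integrable
      majorant.\<close>
    define f where "f i p = max 0 (1 - (1 / e + real i) * infdist p K)" for i :: nat and p
    have cf: "continuous_on M (f i)" for i
      unfolding f_def by (intro continuous_intros)
    have f0: "f i p = 0" if "infdist p K > e" for i p
    proof -
      have "1 = (1 / e) * e" using e by simp
      also have "\<dots> \<le> (1 / e + real i) * infdist p K"
        using that e by (intro mult_mono) auto
      finally show ?thesis by (simp add: f_def)
    qed
    have cs: "compactly_supported M (f i)" for i
      unfolding compactly_supported_def
    proof (intro exI[of _ "{x. infdist x K \<le> e} \<inter> M"] conjI ballI)
      fix p assume "p \<in> M - ({x. infdist x K \<le> e} \<inter> M)"
      then show "f i p = 0" by (intro f0) auto
    qed (use e(2) in auto)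
    have fle: "norm (f i p) \<le> f 0 p" for i p
    proof -
      have "(1 / e) * infdist p K \<le> (1 / e + real i) * infdist p K"
        by (intro mult_right_mono) (auto simp: infdist_nonneg)
      then show ?thesis by (simp add: f_def)
    qed
    have lim: "(\<lambda>i. f i p) \<longlonglongrightarrow> indicator K p" for p
    proof (cases "p \<in> K")
      case True
      then show ?thesis by (simp add: f_def)
    next
      case False
      have "infdist p K > 0"
        using False K \<open>K \<noteq> {}\<close> in_closed_iff_infdist_zero[OF compact_imp_closed[OF K(1)]]
          infdist_nonneg[of p K] by fastforce
      then obtain n where n: "real n * infdist p K > 1"
        using reals_Archimedean3 by blast
      have "f i p = 0" if "i \<ge> n" for i
      proof -
        have "real n * infdist p K \<le> (1 / e + real i) * infdist p K"
          using that e by (intro mult_right_mono) (auto simp: infdist_nonneg add_increasing)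
        then show ?thesis using n by (simp add: f_def)
      qed
      then have "\<forall>\<^sub>F i in sequentially. f i p = 0" by (auto simp: eventually_sequentially)
      then show ?thesis using False by (simp add: tendsto_eventually)
    qed
    have conv: "(\<lambda>i. LINT p|\<kappa>. f i p) \<longlonglongrightarrow> (LINT p|\<kappa>. indicator K p)"
      and conv_int: "integrable \<kappa> (indicator K :: _ \<Rightarrow> real)"
      if "\<And>i. integrable \<kappa> (f i)" "K \<in> sets \<kappa>" for \<kappa>
    proof -
      have "(indicator K :: _ \<Rightarrow> real) \<in> borel_measurable \<kappa>" using that by simp
      moreover have "f i \<in> borel_measurable \<kappa>" for i using that(1) by (rule borel_measurable_integrable)
      moreover have "AE p in \<kappa>. (\<lambda>i. f i p) \<longlonglongrightarrow> indicator K p" using lim by (intro AE_I2)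
      moreover have "AE p in \<kappa>. norm (f i p) \<le> f 0 p" for i using fle by (intro AE_I2)
      ultimately show "(\<lambda>i. LINT p|\<kappa>. f i p) \<longlonglongrightarrow> (LINT p|\<kappa>. indicator K p)"
        and "integrable \<kappa> (indicator K :: _ \<Rightarrow> real)"
        by (blast intro: integral_dominated_convergence integrable_dominated_convergence that(1))+
    qed
    have int: "integrable \<mu> (f i)" "integrable \<nu> (f i)" "(LINT p|\<mu>. f i p) = (LINT p|\<nu>. f i p)" for i
      using eq[OF cf cs] by auto
    have Ks: "K \<in> sets \<mu>" "K \<in> sets \<nu>" using compact_sets[OF K] sets by auto
    have "(LINT p|\<mu>. indicator K p :: real) = (LINT p|\<nu>. indicator K p)"
      by (rule LIMSEQ_unique[OF conv[OF int(1) Ks(1)]]) (unfold int(3), rule conv[OF int(2) Ks(2)])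
    moreover have "K \<inter> space \<mu> = K" "K \<inter> space \<nu> = K" using K space by auto
    ultimately have "measure \<mu> K = measure \<nu> K" by (simp add: space)
    moreover have "emeasure \<mu> K < \<infinity>" "emeasure \<nu> K < \<infinity>"
      using conv_int[OF int(1) Ks(1)] conv_int[OF int(2) Ks(2)] Ks by (auto simp: integrable_indicator_iff)
    ultimately show ?thesis
      using emeasure_eq_ennreal_measure[of \<mu> K] emeasure_eq_ennreal_measure[of \<nu> K] by simp
  qed simp
  obtain A :: "nat \<Rightarrow> _" where A: "\<And>n. compact (A n)" "(\<Union>n. A n) = M"
    using locally_compact_sigma_compact[OF M] by metis
  show ?thesis
  proof (rule measure_eqI_generator_eq[of "{K. compact K \<and> K \<subseteq> M}" M \<mu> \<nu> A])
    show "Int_stable {K. compact K \<and> K \<subseteq> M}" by (auto simp: Int_stable_def)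
    show "sets \<mu> = sigma_sets M {K. compact K \<and> K \<subseteq> M}" "sets \<nu> = sigma_sets M {K. compact K \<and> K \<subseteq> M}"
      using sets sets_restrict_borel_compact_generated[OF M] by auto
    have "A n \<subseteq> M" for n using A(2) by blast
    then show "range A \<subseteq> {K. compact K \<and> K \<subseteq> M}" "emeasure \<mu> (A n) \<noteq> \<infinity>" for n
      using A(1) K by blast+
    show "emeasure \<mu> X = emeasure \<nu> X" if "X \<in> {K. compact K \<and> K \<subseteq> M}" for X
      using that K by blast
  qed (use A(2) in auto)
qed

section \<open>Smooth maps and parametrizations under restriction and linear substitution\<close>

lemma Ck_on_subset: "Ck_on k S f \<Longrightarrow> T \<subseteq> S \<Longrightarrow> Ck_on k T f"
  by (induction k arbitrary: f) (auto intro: continuous_on_subset)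

text \<open>On an open set, agreement of two functions carries over to their derivatives, which is
  what the recursion asks for.\<close>

lemma Ck_on_cong:
  assumes "open S" "\<And>x. x \<in> S \<Longrightarrow> f x = g x" "Ck_on k S f"
  shows "Ck_on k S g"
  using assms(2,3)
proof (induction k arbitrary: f g)
  case 0
  then show ?case by (metis Ck_on.simps(1) continuous_on_cong)
next
  case (Suc k)
  have der: "(g has_derivative frechet_derivative f (at x)) (at x)" if "x \<in> S" for x
  proof -
    have "(f has_derivative frechet_derivative f (at x)) (at x)"
      using Suc(3) that by (simp flip: frechet_derivative_works)
    then show ?thesis
      by (rule has_derivative_transform_within_open[OF _ assms(1) that]) (rule Suc(2))
  qed
  have "frechet_derivative f (at x) = frechet_derivative g (at x)" if "x \<in> S" for x
    using frechet_derivative_at[OF der[OF that]] .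
  moreover have "Ck_on k S (\<lambda>x. frechet_derivative f (at x) v)" for v using Suc(3) by simp
  ultimately have "Ck_on k S (\<lambda>x. frechet_derivative g (at x) v)" for v
    by (intro Suc(1)[of "\<lambda>x. frechet_derivative f (at x) v" "\<lambda>x. frechet_derivative g (at x) v"]) auto
  then show ?case using der by (auto intro: differentiableI)
qed

lemma has_derivative_compose_linear:
  assumes R: "bounded_linear R" and f: "f differentiable (at (R x))"
  shows "((\<lambda>x. f (R x)) has_derivative (\<lambda>v. frechet_derivative f (at (R x)) (R v))) (at x)"
  using diff_chain_at[OF bounded_linear_imp_has_derivative[OF R] frechet_derivative_works[THEN iffD1, OF f]]
  by (simp add: o_def)

text \<open>The derivative of the composite in direction \<open>v\<close> is the derivative of
  \<open>f\<close> in the fixed direction \<open>R v\<close>, composed with \<open>R\<close>, so the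
  induction closes.\<close>

lemma Ck_on_compose_linear:
  fixes R :: "'a::euclidean_space \<Rightarrow> 'b::euclidean_space"
  assumes R: "bounded_linear R" and S: "open S" and f: "Ck_on k S f"
  shows "Ck_on k (R -` S) (\<lambda>x. f (R x))"
  using f
proof (induction k arbitrary: f)
  case 0
  then show ?case
    using linear_continuous_on[OF R] by (auto intro: continuous_on_compose2)
next
  case (Suc k)
  have op: "open (R -` S)" using S linear_continuous_on[OF R] by (intro open_vimage) auto
  have der: "((\<lambda>x. f (R x)) has_derivative (\<lambda>v. frechet_derivative f (at (R x)) (R v))) (at x)" if "x \<in> R -` S" for x
    using Suc(2) that by (intro has_derivative_compose_linear[OF R]) auto
  have "Ck_on k (R -` S) (\<lambda>x. frechet_derivative (\<lambda>x. f (R x)) (at x) v)" for v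
  proof (rule Ck_on_cong[OF op])
    show "Ck_on k (R -` S) (\<lambda>x. frechet_derivative f (at (R x)) (R v))"
      using Suc(2) by (intro Suc(1)) auto
  qed (use frechet_derivative_at[OF der] in \<open>auto dest: fun_cong\<close>)
  then show ?case using der by (auto intro: differentiableI)
qed

lemma local_parametrization_restrict:
  assumes "local_parametrization M W \<phi>" "open V" "V \<subseteq> W"
  shows "local_parametrization M V \<phi>"
proof -
  obtain \<psi> where \<psi>: "homeomorphism W (\<phi> ` W) \<phi> \<psi>" using assms by (auto simp: local_parametrization_def)
  have "openin (top_of_set W) V" using assms by (simp add: open_subset)
  then have "openin (top_of_set (\<phi> ` W)) (\<phi> ` V)"
    by (rule homeomorphism_imp_open_map[OF \<psi>])
  then have "openin (top_of_set M) (\<phi> ` V)"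
    using assms(1) openin_trans by (auto simp: local_parametrization_def)
  moreover have "homeomorphism V (\<phi> ` V) \<phi> \<psi>"
    using \<psi> by (rule homeomorphism_of_subsets) (use assms in auto)
  ultimately show ?thesis
    using assms by (auto simp: local_parametrization_def smooth_on_def intro: Ck_on_subset)
qed

lemma local_parametrization_openin:
  "local_parametrization M W \<phi> \<Longrightarrow> openin (top_of_set M) (\<phi> ` W)"
  by (simp add: local_parametrization_def)

lemma local_parametrization_subset: "local_parametrization M W \<phi> \<Longrightarrow> \<phi> ` W \<subseteq> M"
  using local_parametrization_openin openin_imp_subset by blast

text \<open>\<open>V\<close> and \<open>Z\<close> are the images of an open ball in the parameter
  domain and of the closed ball with the same centre and radius.\<close>

lemma local_parametrization_compact_neighbourhood:
  fixes W :: "(real^'m::finite) set"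
  assumes lp: "local_parametrization M W \<phi>" and p: "p \<in> \<phi> ` W"
  obtains V Z where "openin (top_of_set M) V" "p \<in> V" "V \<subseteq> Z" "compact Z" "Z \<subseteq> \<phi> ` W"
proof -
  obtain x where x: "x \<in> W" "p = \<phi> x" using p by auto
  have "open W" using lp by (simp add: local_parametrization_def)
  then obtain e where e: "e > 0" "cball x e \<subseteq> W" using x open_contains_cball by blast
  then have b: "ball x e \<subseteq> W" using ball_subset_cball by blast
  have "continuous_on W \<phi>" by (rule chart_continuous[OF chartI[OF lp]])
  then have "compact (\<phi> ` cball x e)"
    using e(2) by (intro compact_continuous_image compact_cball) (rule continuous_on_subset)
  moreover have "openin (top_of_set M) (\<phi> ` ball x e)"
    using local_parametrization_restrict[OF lp _ b] by (simp add: local_parametrization_def)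
  moreover have "p \<in> \<phi> ` ball x e" using x e by auto
  moreover have "\<phi> ` ball x e \<subseteq> \<phi> ` cball x e" using ball_subset_cball by blast
  moreover have "\<phi> ` cball x e \<subseteq> \<phi> ` W" using e by blast
  ultimately show ?thesis by (metis that)
qed

lemma submanifold_locally_compact:
  assumes "submanifold TYPE('m::finite) (M :: (real^'n::finite) set)"
  shows "locally compact M"
  unfolding locally_compact
proof
  fix p assume "p \<in> M"
  then obtain W :: "(real^'m) set" and \<phi> where lp: "local_parametrization M W \<phi>" "p \<in> \<phi> ` W"
    using assms unfolding submanifold_def by blast
  obtain V Z where "openin (top_of_set M) V" "p \<in> V" "V \<subseteq> Z" "compact Z" "Z \<subseteq> \<phi> ` W"
    using local_parametrization_compact_neighbourhood[OF lp] .
  moreover from this have "Z \<subseteq> M" using local_parametrization_subset[OF lp(1)] by simp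
  ultimately show "\<exists>u v. p \<in> u \<and> u \<subseteq> v \<and> v \<subseteq> M \<and> openin (top_of_set M) u \<and> compact v"
    by (intro exI[of _ V] exI[of _ Z] conjI)
qed

section \<open>The volume measure of a submanifold\<close>

lemma local_parametrization_range_subset_tangent_space:
  fixes W :: "(real^'m::finite) set"
  assumes lp: "local_parametrization M W \<phi>" and x: "x \<in> W"
  shows "range (frechet_derivative \<phi> (at x)) \<subseteq> tangent_space TYPE('m) M (\<phi> x)"
  unfolding tangent_space_def
  by (intro subsetI CollectI exI[of _ W] exI[of _ \<phi>] exI[of _ x] conjI lp x refl)

text \<open>The link between forms and chart measures; the sign is settled later by restricting to
  positive charts.\<close>

lemma abs_volume_form_coord_frame:
  fixes \<omega> :: "('m::finite, 'n::finite) form"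
  assumes \<omega>: "riemannian_volume_form M \<omega>" and lp: "local_parametrization M W \<phi>" and x: "x \<in> W"
  shows "\<bar>\<omega> (\<phi> x) (coord_frame \<phi> x)\<bar> = gram_jacobian \<phi> x"
  unfolding gram_jacobian_def coord_frame_def
proof (rule abs_alternating_eq_sqrt_gram_det)
  have p: "\<phi> x \<in> M" using local_parametrization_subset[OF lp] x by (auto simp: image_subset_iff)
  note ch = chartI[OF lp]
  show "linear (frechet_derivative \<phi> (at x))" "inj (frechet_derivative \<phi> (at x))"
    using chart_linear[OF ch x] chart_inj[OF ch x] by auto
  show "alternating_on (tangent_space TYPE('m) M (\<phi> x)) (\<omega> (\<phi> x))"
    using \<omega> p by (simp add: riemannian_volume_form_def smooth_form_def)
  show "range (frechet_derivative \<phi> (at x)) \<subseteq> tangent_space TYPE('m) M (\<phi> x)"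
    by (rule local_parametrization_range_subset_tangent_space[OF lp x])
  fix e :: "'m \<Rightarrow> real^'n"
  assume "\<forall>i. e i \<in> tangent_space TYPE('m) M (\<phi> x)" "\<forall>i j. e i \<bullet> e j = (if i = j then 1 else 0)"
  then show "\<bar>\<omega> (\<phi> x) e\<bar> = 1"
    using \<omega>[unfolded riemannian_volume_form_def, THEN conjunct2, THEN bspec[OF _ p], THEN spec[of _ e]]
    by simp
qed

lemma positive_volume_form_coord_frame:
  fixes \<omega> :: "('m::finite, 'n::finite) form"
  assumes "riemannian_volume_form M \<omega>" "positive_parametrization M \<omega> W \<phi>" "x \<in> W"
  shows "\<omega> (\<phi> x) (coord_frame \<phi> x) = gram_jacobian \<phi> x"
proof -
  have "local_parametrization M W \<phi>" "\<omega> (\<phi> x) (coord_frame \<phi> x) > 0"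
    using assms(2,3) unfolding positive_parametrization_def by blast+
  then show ?thesis using abs_volume_form_coord_frame[OF assms(1) _ assms(3), of \<phi>] by simp
qed

text \<open>Made for the reflection that reverses the orientation of a chart. Being its own inverse,
  \<open>R\<close> makes the inverse homeomorphism and the new domain explicit.\<close>

lemma local_parametrization_compose_involution:
  fixes W :: "(real^'m::finite) set" and R :: "real^'m \<Rightarrow> real^'m"
  assumes lp: "local_parametrization M W \<phi>" and R: "bounded_linear R" "\<And>x. R (R x) = x"
  shows "local_parametrization M (R -` W) (\<lambda>x. \<phi> (R x))"
    and "(\<lambda>x. \<phi> (R x)) ` (R -` W) = \<phi> ` W"
    and "\<And>x. x \<in> R -` W \<Longrightarrow> coord_frame (\<lambda>x. \<phi> (R x)) x = (\<lambda>i. frechet_derivative \<phi> (at (R x)) (R (axis i 1)))"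
proof -
  note ch = chartI[OF lp]
  have op: "open W" by (rule chart_open[OF ch])
  have cR: "continuous_on S R" for S using R(1) by (rule linear_continuous_on)
  have opR: "open (R -` W)" using op cR[of UNIV] by (intro open_vimage)
  have RW: "R ` (R -` W) = W" using R(2) by (metis surjI image_vimage_eq inf_top_right)
  then show im: "(\<lambda>x. \<phi> (R x)) ` (R -` W) = \<phi> ` W" by (metis image_image)
  have der: "frechet_derivative (\<lambda>x. \<phi> (R x)) (at x) = (\<lambda>v. frechet_derivative \<phi> (at (R x)) (R v))"
    if "x \<in> R -` W" for x
  proof -
    have d: "\<phi> differentiable (at (R x))"
      using chart_has_derivative[OF ch, of "R x" UNIV] that by (auto intro: differentiableI)
    show ?thesis by (rule frechet_derivative_at[OF has_derivative_compose_linear[OF R(1) d], symmetric])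
  qed
  then show "coord_frame (\<lambda>x. \<phi> (R x)) x = (\<lambda>i. frechet_derivative \<phi> (at (R x)) (R (axis i 1)))"
    if "x \<in> R -` W" for x using that by (simp add: coord_frame_def)
  have injR: "inj R" using R(2) by (metis injI)
  obtain \<psi> where \<psi>: "homeomorphism W (\<phi> ` W) \<phi> \<psi>" by (rule chart_homeomorphism[OF ch])
  have "homeomorphism (R -` W) W R R"
    unfolding homeomorphism_def using R(2) RW cR by (auto simp: image_def) (metis)+
  from homeomorphism_compose[OF this \<psi>]
  have hom: "homeomorphism (R -` W) (\<phi> ` W) (\<lambda>x. \<phi> (R x)) (R \<circ> \<psi>)" by (simp add: o_def)
  have sm: "smooth_on (R -` W) (\<lambda>x. \<phi> (R x))"
    using lp by (auto simp: local_parametrization_def smooth_on_def intro: Ck_on_compose_linear[OF R(1) op])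
  have inj: "\<forall>x\<in>R -` W. inj (frechet_derivative (\<lambda>x. \<phi> (R x)) (at x))"
  proof
    fix x assume x: "x \<in> R -` W"
    then have "inj (frechet_derivative \<phi> (at (R x)))" by (intro chart_inj[OF ch]) simp
    from inj_compose[OF this injR] show "inj (frechet_derivative (\<lambda>x. \<phi> (R x)) (at x))"
      unfolding der[OF x] by (simp add: o_def)
  qed
  show "local_parametrization M (R -` W) (\<lambda>x. \<phi> (R x))"
    unfolding local_parametrization_def im
    by (intro conjI opR sm inj local_parametrization_openin[OF lp] exI[of _ "R \<circ> \<psi>"] hom)
qed

section \<open>Positive charts and partitions of unity\<close>

text \<open>The coefficient of \<open>\<omega>\<close> in a chart is continuous and nonzero, so the
  chart can be shrunk until the sign is constant. A negative sign is repaired by reflecting one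
  coordinate.\<close>

lemma exists_positive_parametrization:
  fixes \<omega> :: "('m::finite, 'n::finite) form"
  assumes M: "submanifold TYPE('m) M" and \<omega>: "riemannian_volume_form M \<omega>" and p: "p \<in> M"
  shows "\<exists>c. positive_parametrization M \<omega> (fst c) (snd c) \<and> p \<in> snd c ` fst c"
proof -
  obtain W :: "(real^'m) set" and \<phi> where lp: "local_parametrization M W \<phi>" "p \<in> \<phi> ` W"
    using M p unfolding submanifold_def by blast
  note ch = chartI[OF lp(1)]
  obtain x where x: "x \<in> W" "p = \<phi> x" using lp(2) by (rule imageE)
  define s where "s x = \<omega> (\<phi> x) (coord_frame \<phi> x)" for x
  have "smooth_on W s"
    using \<omega> lp(1) unfolding riemannian_volume_form_def smooth_form_def s_def[abs_def] by simp
  then have cs: "continuous_on W s" unfolding smooth_on_def by (metis Ck_on.simps(1))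
  have "\<bar>s x\<bar> > 0"
    using abs_volume_form_coord_frame[OF \<omega> lp(1) x(1)] gram_jacobian_pos[OF ch x(1)] by (simp add: s_def)
  then consider "s x > 0" | "s x < 0" by linarith
  then show ?thesis
  proof cases
    case 1
    define V where "V = s -` {0<..} \<inter> W"
    have "open V" unfolding V_def
      by (rule continuous_on_open_vimage[THEN iffD1, rule_format]) (use chart_open[OF ch] cs in auto)
    then have "local_parametrization M V \<phi>"
      by (rule local_parametrization_restrict[OF lp(1)]) (simp add: V_def)
    then have "positive_parametrization M \<omega> V \<phi>"
      by (simp add: positive_parametrization_def V_def s_def)
    moreover have "p \<in> \<phi> ` V" unfolding x(2) by (rule imageI) (use x 1 in \<open>simp add: V_def\<close>)
    ultimately show ?thesis by (intro exI[of _ "(V, \<phi>)"]) simp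
  next
    case 2
    define V where "V = s -` {..<0} \<inter> W"
    have V: "V \<subseteq> W" by (auto simp: V_def)
    have "open V" unfolding V_def
      by (rule continuous_on_open_vimage[THEN iffD1, rule_format]) (use chart_open[OF ch] cs in auto)
    then have lpV: "local_parametrization M V \<phi>"
      by (rule local_parametrization_restrict[OF lp(1)]) (simp add: V_def)
    \<comment> \<open>Types are nonempty, so there is a coordinate to reflect.\<close>
    obtain k :: 'm where True by simp
    define R where "R x = (\<chi> i. if i = k then - x$i else x$i)" for x :: "real^'m"
    have R: "bounded_linear R" "R (R x) = x" for x
    proof -
      have "linear R" by (rule linearI) (auto simp: R_def vec_eq_iff)
      then show "bounded_linear R" by (rule linear_conv_bounded_linear[THEN iffD1])
    qed (simp add: R_def vec_eq_iff)
    have Rax: "R (axis i 1) = (if i = k then (-1) *\<^sub>R axis k 1 else axis i 1)" for i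
      by (auto simp: R_def vec_eq_iff axis_def)
    note comp = local_parametrization_compose_involution[OF lpV R]
    have "\<omega> (\<phi> (R y)) (coord_frame (\<lambda>x. \<phi> (R x)) y) > 0" if y: "y \<in> R -` V" for y
    proof -
      let ?v = "coord_frame \<phi> (R y)" and ?T = "tangent_space TYPE('m) M (\<phi> (R y))"
      have Ry: "R y \<in> W" "s (R y) < 0" using y by (auto simp: V_def)
      have lin: "linear (frechet_derivative \<phi> (at (R y)))" by (rule chart_linear[OF ch Ry(1)])
      \<comment> \<open>The zero summand brings the negated vector into the shape of the linearity
        clause of \<open>alternating_on\<close>, with coefficients -1 and 0.\<close>
      have "coord_frame (\<lambda>x. \<phi> (R x)) y i = (?v(k := (-1) *\<^sub>R ?v k + 0 *\<^sub>R ?v k)) i" for i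
        unfolding comp(3)[OF y] using linear_scale[OF lin, of "-1" "axis k 1"]
        by (simp add: Rax coord_frame_def del: scaleR_minus1_left)
      then have frame: "coord_frame (\<lambda>x. \<phi> (R x)) y = ?v(k := (-1) *\<^sub>R ?v k + 0 *\<^sub>R ?v k)" by blast
      have "\<phi> (R y) \<in> M" using local_parametrization_subset[OF lp(1)] Ry(1) by (auto simp: image_subset_iff)
      then have alt: "alternating_on ?T (\<omega> (\<phi> (R y)))"
        using \<omega> by (simp add: riemannian_volume_form_def smooth_form_def)
      have vT: "range ?v \<subseteq> ?T"
        using local_parametrization_range_subset_tangent_space[OF lp(1) Ry(1)] by (auto simp: coord_frame_def)
      then have vk: "?v k \<in> ?T" by (simp add: image_subset_iff)
      have "\<omega> (\<phi> (R y)) (?v(k := (-1) *\<^sub>R ?v k + 0 *\<^sub>R ?v k)) =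
          (-1) * \<omega> (\<phi> (R y)) (?v(k := ?v k)) + 0 * \<omega> (\<phi> (R y)) (?v(k := ?v k))"
        using alt[unfolded alternating_on_def, THEN conjunct1, THEN spec[of _ ?v], THEN spec[of _ k],
          THEN bspec[OF _ vk], THEN bspec[OF _ vk], THEN spec[of _ "-1"], THEN spec[of _ 0]] vT
        by (rule mp)
      then have "\<omega> (\<phi> (R y)) (coord_frame (\<lambda>x. \<phi> (R x)) y) = - s (R y)"
        unfolding frame s_def by simp
      then show ?thesis using Ry(2) by simp
    qed
    then have "positive_parametrization M \<omega> (R -` V) (\<lambda>x. \<phi> (R x))"
      using comp(1) by (simp add: positive_parametrization_def)
    moreover have "p \<in> (\<lambda>x. \<phi> (R x)) ` (R -` V)"
      unfolding comp(2) x(2) by (rule imageI) (use x 2 in \<open>simp add: V_def\<close>)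
    ultimately show ?thesis by (intro exI[of _ "(R -` V, \<lambda>x. \<phi> (R x))"]) simp
  qed
qed

text \<open>Tents over a finite subcover of \<open>K\<close>, divided by their sum. The sum has to
  equal 1 only on \<open>K\<close>, which leaves freedom in the denominator elsewhere.\<close>

lemma positive_partition_of_unity:
  fixes \<omega> :: "('m::finite, 'n::finite) form"
  assumes M: "submanifold TYPE('m) M" and \<omega>: "riemannian_volume_form M \<omega>"
    and K: "compact K" "K \<subseteq> M"
  shows "\<exists>(N :: nat) W \<phi> (\<rho> :: nat \<Rightarrow> real^'n \<Rightarrow> real).
    (\<forall>i<N. positive_parametrization M \<omega> (W i) (\<phi> i) \<and>
      continuous_on M (\<rho> i) \<and> (\<forall>p\<in>M. 0 \<le> \<rho> i p \<and> \<rho> i p \<le> 1) \<and>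
      (\<exists>K. compact K \<and> K \<subseteq> \<phi> i ` W i \<and> (\<forall>p\<in>M - K. \<rho> i p = 0))) \<and>
    (\<forall>p\<in>K. (\<Sum>i<N. \<rho> i p) = 1)"
proof -
  \<comment> \<open>The compact \<open>Z\<close> lies between the trace of the ball and the chart
    image, so a tent over the ball is supported in a compact subset of the chart.\<close>
  have "\<exists>c Z e. positive_parametrization M \<omega> (fst c) (snd c) \<and> compact Z \<and> Z \<subseteq> snd c ` fst c \<and>
      e > 0 \<and> M \<inter> ball p e \<subseteq> Z" if p: "p \<in> K" for p
  proof -
    have "p \<in> M" using p K(2) by (rule rev_subsetD)
    then obtain c where c: "positive_parametrization M \<omega> (fst c) (snd c)" "p \<in> snd c ` fst c"
      using exists_positive_parametrization[OF M \<omega>] by blast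
    have lp: "local_parametrization M (fst c) (snd c)" using c(1) by (simp add: positive_parametrization_def)
    obtain V Z where V: "openin (top_of_set M) V" "p \<in> V" "V \<subseteq> Z" "compact Z" "Z \<subseteq> snd c ` fst c"
      using local_parametrization_compact_neighbourhood[OF lp c(2)] .
    obtain T where T: "open T" "V = M \<inter> T" using V(1) by (auto simp: openin_open)
    then obtain e where e: "e > 0" "ball p e \<subseteq> T" using V(2) openE by (metis IntD2)
    then have "M \<inter> ball p e \<subseteq> Z" using T(2) V(3) by blast
    then show ?thesis using c(1) V(4,5) e(1) by (intro exI[of _ c] exI[of _ Z] exI[of _ e] conjI)
  qed
  then have "\<forall>p\<in>K. \<exists>c Z e. positive_parametrization M \<omega> (fst c) (snd c) \<and> compact Z \<and> Z \<subseteq> snd c ` fst c \<and>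
      e > 0 \<and> M \<inter> ball p e \<subseteq> Z" by (rule ballI)
  then obtain c Z e where cZe: "\<forall>p\<in>K. positive_parametrization M \<omega> (fst (c p)) (snd (c p)) \<and> compact (Z p) \<and>
      Z p \<subseteq> snd (c p) ` fst (c p) \<and> e p > 0 \<and> M \<inter> ball p (e p) \<subseteq> Z p"
    unfolding bchoice_iff by (elim exE)
  then have c: "positive_parametrization M \<omega> (fst (c p)) (snd (c p))" "compact (Z p)"
      "Z p \<subseteq> snd (c p) ` fst (c p)" "e p > 0" "M \<inter> ball p (e p) \<subseteq> Z p" if "p \<in> K" for p
    using that by simp_all
  have "K \<subseteq> (\<Union>p\<in>K. ball p (e p))" using c(4) by auto
  then obtain C where C: "C \<subseteq> K" "finite C" "K \<subseteq> (\<Union>p\<in>C. ball p (e p))"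
    using compactE_image[OF K(1), of K "\<lambda>p. ball p (e p)"] by auto
  obtain h where h: "bij_betw h {0..<card C} C" using ex_bij_betw_nat_finite[OF C(2)] by auto
  define N where "N = card C"
  have hC: "h i \<in> C" "h i \<in> K" if "i < N" for i
    using h that C(1) by (auto simp: N_def bij_betw_def)
  define g where "g p q = max 0 (e p - dist p q)" for p q :: "real^'n"
  define s where "s q = (\<Sum>i<N. g (h i) q)" for q
  have cg: "continuous_on A (g p)" for A p unfolding g_def by (intro continuous_intros)
  have g0: "g p q \<ge> 0" for p q by (simp add: g_def)
  have cs: "continuous_on A s" for A unfolding s_def by (intro continuous_intros cg)
  have s_pos: "s q > 0" if q: "q \<in> K" for q
  proof -
    obtain p where p: "p \<in> C" "q \<in> ball p (e p)" using C(3) q by blast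
    then obtain i where i: "i < N" "h i = p" using h unfolding N_def bij_betw_def by (metis atLeastLessThan_iff imageE)
    have "0 < g (h i) q" using p i by (simp add: g_def)
    also have "\<dots> \<le> s q" unfolding s_def by (rule member_le_sum) (use i g0 in auto)
    finally show ?thesis .
  qed
  \<comment> \<open>The minimum of \<open>s\<close> on the compact \<open>K\<close>; for empty
    \<open>K\<close> any positive number will do.\<close>
  obtain b where b: "b > 0" "\<And>q. q \<in> K \<Longrightarrow> b \<le> s q"
  proof (cases "K = {}")
    case False
    then obtain x where "x \<in> K" "\<forall>y\<in>K. s x \<le> s y"
      using continuous_attains_inf[OF K(1) False cs] by blast
    then show ?thesis using s_pos[of x] that[of "s x"] by blast
  qed (use that[of 1] in auto)
  \<comment> \<open>The maximum with \<open>b\<close> keeps the denominator positive where all tents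
    vanish and changes nothing on \<open>K\<close>.\<close>
  define \<rho> where "\<rho> i q = g (h i) q / max (s q) b" for i q
  have charts: "positive_parametrization M \<omega> (fst (c (h i))) (snd (c (h i))) \<and>
      continuous_on M (\<rho> i) \<and> (\<forall>q\<in>M. 0 \<le> \<rho> i q \<and> \<rho> i q \<le> 1) \<and>
      (\<exists>Y. compact Y \<and> Y \<subseteq> snd (c (h i)) ` fst (c (h i)) \<and> (\<forall>q\<in>M - Y. \<rho> i q = 0))" if i: "i < N" for i
  proof -
    have "continuous_on M (\<rho> i)"
      unfolding \<rho>_def using b(1) by (intro continuous_intros cg cs) (auto simp: max_def)
    moreover have "0 \<le> \<rho> i q \<and> \<rho> i q \<le> 1" for q
    proof -
      have "g (h i) q \<le> s q" unfolding s_def by (rule member_le_sum) (use i g0 in auto)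
      then show ?thesis using g0[of "h i" q] b(1) by (auto simp: \<rho>_def divide_simps)
    qed
    moreover have "\<exists>Y. compact Y \<and> Y \<subseteq> snd (c (h i)) ` fst (c (h i)) \<and> (\<forall>q\<in>M - Y. \<rho> i q = 0)"
    proof (intro exI conjI ballI)
      fix q assume "q \<in> M - Z (h i)"
      then have "q \<notin> ball (h i) (e (h i))" using c(5)[OF hC(2)[OF i]] by auto
      then show "\<rho> i q = 0" by (simp add: \<rho>_def g_def)
    qed (rule c(2,3)[OF hC(2)[OF i]])+
    ultimately show ?thesis using c(1)[OF hC(2)[OF i]] by simp
  qed
  have sum1: "(\<Sum>i<N. \<rho> i q) = 1" if q: "q \<in> K" for q
  proof -
    have "(\<Sum>i<N. \<rho> i q) = s q / max (s q) b"
      by (simp add: \<rho>_def s_def sum_divide_distrib)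
    then show ?thesis using b(2)[OF q] s_pos[OF q] by (simp add: max_def)
  qed
  show ?thesis
    by (intro exI[of _ N] exI[of _ "\<lambda>i. fst (c (h i))"] exI[of _ "\<lambda>i. snd (c (h i))"] exI[of _ \<rho>])
      (use charts sum1 in blast)
qed

section \<open>Integrals of forms as integrals against the common measure\<close>

text \<open>A chart measure is concentrated on the image of its chart, so agreement on subsets of
  the image becomes an equality of measures, through which integrals can be transported.\<close>

lemma density_global_volume_chart:
  fixes \<phi> :: "real^'m::finite \<Rightarrow> real^'n::finite"
  assumes ch: "chart W \<phi>"
  shows "density (global_volume TYPE('m)) (\<lambda>p. ennreal (indicator (\<phi> ` W) p)) = chart_measure W \<phi>"
proof (rule measure_eqI)
  fix A assume "A \<in> sets (density (global_volume TYPE('m)) (\<lambda>p. ennreal (indicator (\<phi> ` W) p)))"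
  then have A: "A \<in> sets (borel :: (real^'n) measure)" by simp
  note im = chart_image_borel[OF ch]
  have "emeasure (density (global_volume TYPE('m)) (\<lambda>p. ennreal (indicator (\<phi> ` W) p))) A =
      (\<integral>\<^sup>+p. ennreal (indicator (\<phi> ` W) p) * indicator A p \<partial>global_volume TYPE('m))"
    using A im by (subst emeasure_density) auto
  also have "\<dots> = (\<integral>\<^sup>+p. indicator (A \<inter> \<phi> ` W) p \<partial>global_volume TYPE('m))"
    by (rule nn_integral_cong) (auto simp: indicator_def)
  also have "\<dots> = emeasure (global_volume TYPE('m)) (A \<inter> \<phi> ` W)"
    using A im by simp
  also have "\<dots> = emeasure (chart_measure W \<phi>) (A \<inter> \<phi> ` W)"
    using A im by (intro emeasure_global_volume_chart[OF ch]) auto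
  also have "W \<inter> \<phi> -` (A \<inter> \<phi> ` W) = W \<inter> \<phi> -` A" by auto
  then have "emeasure (chart_measure W \<phi>) (A \<inter> \<phi> ` W) = emeasure (chart_measure W \<phi>) A"
    using A im by (simp only: emeasure_chart_measure[OF ch] sets.Int)
  finally show "emeasure (density (global_volume TYPE('m)) (\<lambda>p. ennreal (indicator (\<phi> ` W) p))) A =
      emeasure (chart_measure W \<phi>) A" .
qed simp

lemma integral_global_volume_chart:
  fixes W :: "(real^'m::finite) set" and M :: "(real^'n::finite) set" and g :: "real^'n \<Rightarrow> real"
  assumes lp: "local_parametrization M W \<phi>" and M: "M \<in> sets borel" and g: "continuous_on M g"
    and K: "compact K" "K \<subseteq> \<phi> ` W" "\<And>p. p \<in> M - K \<Longrightarrow> g p = 0"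
  shows "integrable (restrict_space (global_volume TYPE('m)) M) g"
    and "(LINT p|restrict_space (global_volume TYPE('m)) M. g p) = (LINT x:W|lborel. g (\<phi> x) * gram_jacobian \<phi> x)"
proof -
  note ch = chartI[OF lp]
  have WM: "\<phi> ` W \<subseteq> M" by (rule local_parametrization_subset[OF lp])
  \<comment> \<open>Extension by 0 off \<open>M\<close>; this makes the continuous \<open>g\<close>
    a Borel function on the whole space.\<close>
  define G where "G p = indicator M p *\<^sub>R g p" for p
  have G: "G \<in> borel_measurable borel" unfolding G_def[abs_def]
    using borel_measurable_continuous_on_indicator[OF M g] .
  have Mspace: "M \<inter> space (global_volume TYPE('m)) \<in> sets (global_volume TYPE('m))" using M by simp
  have G_ind: "indicator (\<phi> ` W) p *\<^sub>R G p = G p" for p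
    using K(2,3) WM by (auto simp: G_def indicator_def)
  have im: "(\<lambda>p. indicator (\<phi> ` W) p :: real) \<in> borel_measurable (global_volume TYPE('m))"
    using chart_image_borel[OF ch] by (simp add: borel_measurable_indicator)
  have Gm: "G \<in> borel_measurable (global_volume TYPE('m))" using G by simp
  define w where "w x = indicator W x * gram_jacobian \<phi> x" for x
  have w: "w \<in> borel_measurable lborel" "\<And>x. 0 \<le> w x"
    using borel_measurable_gram_jacobian[OF ch] gram_jacobian_pos[OF ch]
    by (auto simp: w_def[abs_def] indicator_def less_imp_le)
  define \<Phi> where "\<Phi> x = (if x \<in> W then \<phi> x else 0)" for x
  have \<Phi>: "\<Phi> \<in> density lborel (\<lambda>x. ennreal (w x)) \<rightarrow>\<^sub>M borel"
    using borel_measurable_chart[OF ch] by (simp add: \<Phi>_def[abs_def])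
  have G\<Phi>: "(\<lambda>x. G (\<Phi> x)) \<in> borel_measurable lborel"
    using measurable_compose[OF \<Phi> G] by simp
  have cm: "chart_measure W \<phi> = distr (density lborel (\<lambda>x. ennreal (w x))) borel \<Phi>"
    by (simp add: chart_measure_def w_def[abs_def] \<Phi>_def[abs_def])
  define F where "F x = g (\<phi> x) * gram_jacobian \<phi> x" for x
  have wG: "w x *\<^sub>R G (\<Phi> x) = indicator W x *\<^sub>R F x" for x
    using WM by (auto simp: w_def G_def \<Phi>_def F_def indicator_def)
  obtain \<psi> where \<psi>: "homeomorphism W (\<phi> ` W) \<phi> \<psi>" by (rule chart_homeomorphism[OF ch])
  have S: "compact (\<psi> ` K)"
    using \<psi> K(1,2) by (intro compact_continuous_image) (auto simp: homeomorphism_def intro: continuous_on_subset)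
  have SW: "\<psi> ` K \<subseteq> W" using \<psi> K(2) by (auto simp: homeomorphism_def)
  have ind: "indicator (\<psi> ` K) x *\<^sub>R F x = indicator W x *\<^sub>R F x" for x
  proof (cases "x \<in> W \<and> x \<notin> \<psi> ` K")
    case True
    then have "\<phi> x \<in> M - K" using \<psi> WM by (auto simp: homeomorphism_def) (metis imageI)
    then show ?thesis using K(3) True by (simp add: F_def)
  qed (use SW in \<open>auto simp: indicator_def\<close>)
  have "continuous_on W F" unfolding F_def
    using WM by (intro continuous_intros continuous_on_gram_jacobian[OF ch] continuous_on_compose2[OF g chart_continuous[OF ch]])
  then have "continuous_on (\<psi> ` K) F" using SW by (rule continuous_on_subset)
  then have "integrable lborel (\<lambda>x. indicator (\<psi> ` K) x *\<^sub>R F x)"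
    by (rule borel_integrable_compact[OF S])
  then have "integrable lborel (\<lambda>x. w x *\<^sub>R G (\<Phi> x))" by (simp only: ind wG)
  then have "integrable (density lborel (\<lambda>x. ennreal (w x))) (\<lambda>x. G (\<Phi> x))"
    using integrable_density[OF G\<Phi> w(1)] w(2) by simp
  then have "integrable (chart_measure W \<phi>) G"
    unfolding cm using integrable_distr_eq[OF \<Phi> G] by simp
  then have "integrable (global_volume TYPE('m)) (\<lambda>p. indicator (\<phi> ` W) p *\<^sub>R G p)"
    unfolding density_global_volume_chart[OF ch, symmetric]
    using integrable_density[OF Gm im] by simp
  then have "integrable (global_volume TYPE('m)) G" by (simp only: G_ind)
  then show "integrable (restrict_space (global_volume TYPE('m)) M) g"
    using integrable_restrict_space[OF Mspace, of g] by (simp add: G_def[abs_def])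
  have "(LINT p|restrict_space (global_volume TYPE('m)) M. g p) = (LINT p|global_volume TYPE('m). G p)"
    using integral_restrict_space[OF Mspace, of g] by (simp add: G_def[abs_def])
  also have "\<dots> = (LINT p|global_volume TYPE('m). indicator (\<phi> ` W) p *\<^sub>R G p)" by (simp only: G_ind)
  also have "\<dots> = (LINT p|chart_measure W \<phi>. G p)"
    unfolding density_global_volume_chart[OF ch, symmetric]
    using integral_density[OF Gm im] by simp
  also have "\<dots> = (LINT x|density lborel (\<lambda>x. ennreal (w x)). G (\<Phi> x))"
    unfolding cm by (rule integral_distr[OF \<Phi> G])
  also have "\<dots> = (LINT x|lborel. w x *\<^sub>R G (\<Phi> x))"
    using integral_density[OF G\<Phi> w(1)] w(2) by simp
  finally show "(LINT p|restrict_space (global_volume TYPE('m)) M. g p) = (LINT x:W|lborel. g (\<phi> x) * gram_jacobian \<phi> x)"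
    by (simp only: wG set_lebesgue_integral_def F_def)
qed

text \<open>A form integral constrains its partition only where the form is nonzero; for f times
  \<omega> this shows that the constraint holds wherever f is nonzero.\<close>

lemma volume_form_nonzero:
  fixes \<omega> :: "('m::finite, 'n::finite) form"
  assumes "submanifold TYPE('m) M" "riemannian_volume_form M \<omega>" "p \<in> M"
  shows "\<omega> p \<noteq> (\<lambda>_. 0)"
proof -
  obtain c where c: "positive_parametrization M \<omega> (fst c) (snd c)" "p \<in> snd c ` fst c"
    using exists_positive_parametrization[OF assms] by blast
  from c(2) obtain x where "p = snd c x" "x \<in> fst c" by (rule imageE)
  then have "\<omega> p (coord_frame (snd c) x) > 0" using c(1) by (simp add: positive_parametrization_def)
  then show ?thesis by auto
qed

text \<open>Whatever charts and partition are chosen, each local term is the integral of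
  \<open>\<rho> i * f\<close> against the same measure, and these functions add up to
  \<open>f\<close> on \<open>M\<close>. So form integrals are independent of all choices.\<close>

lemma has_form_integral_imp_integral:
  fixes \<omega> :: "('m::finite, 'n::finite) form"
  assumes M: "submanifold TYPE('m) M" and \<omega>: "riemannian_volume_form M \<omega>"
    and f: "continuous_on M f" and I: "has_form_integral M \<omega> (\<lambda>p v. f p * \<omega> p v) I"
  shows "integrable (restrict_space (global_volume TYPE('m)) M) f"
    and "I = (LINT p|restrict_space (global_volume TYPE('m)) M. f p)"
proof -
  let ?\<mu> = "restrict_space (global_volume TYPE('m)) M :: (real^'n) measure"
  obtain N :: nat and W \<phi> \<rho> where *:
    "\<forall>i<N. positive_parametrization M \<omega> (W i) (\<phi> i) \<and>
           continuous_on M (\<rho> i) \<and> (\<forall>p\<in>M. 0 \<le> \<rho> i p \<and> \<rho> i p \<le> 1) \<and>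
           (\<exists>K. compact K \<and> K \<subseteq> \<phi> i ` W i \<and> (\<forall>p\<in>M - K. \<rho> i p = 0))"
    and sum1: "\<forall>p\<in>M. (\<lambda>v. f p * \<omega> p v) \<noteq> (\<lambda>_. 0) \<longrightarrow> (\<Sum>i<N. \<rho> i p) = 1"
    and I_eq: "I = (\<Sum>i<N. LINT x:W i|lborel. \<rho> i (\<phi> i x) * (f (\<phi> i x) * \<omega> (\<phi> i x) (coord_frame (\<phi> i) x)))"
    using I unfolding has_form_integral_def by (elim exE conjE)
  have Mb: "M \<in> sets borel" using locally_compact_borel[OF submanifold_locally_compact[OF M]] .
  note chart_i = *[THEN spec, THEN mp]
  have pos: "positive_parametrization M \<omega> (W i) (\<phi> i)" if "i < N" for i
    by (rule chart_i[OF that, THEN conjunct1])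
  have \<rho>: "continuous_on M (\<rho> i)" if "i < N" for i
    by (rule chart_i[OF that, THEN conjunct2, THEN conjunct1])
  have supp: "\<exists>K. compact K \<and> K \<subseteq> \<phi> i ` W i \<and> (\<forall>p\<in>M - K. \<rho> i p = 0)" if "i < N" for i
    by (rule chart_i[OF that, THEN conjunct2, THEN conjunct2, THEN conjunct2])
  have local: "integrable ?\<mu> (\<lambda>p. \<rho> i p * f p) \<and> (LINT p|?\<mu>. \<rho> i p * f p) =
      (LINT x:W i|lborel. \<rho> i (\<phi> i x) * (f (\<phi> i x) * \<omega> (\<phi> i x) (coord_frame (\<phi> i) x)))" if i: "i < N" for i
  proof -
    obtain K where supp_K: "compact K \<and> K \<subseteq> \<phi> i ` W i \<and> (\<forall>p\<in>M - K. \<rho> i p = 0)"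
      using supp[OF i] by (rule exE)
    note K = supp_K[THEN conjunct1] supp_K[THEN conjunct2, THEN conjunct1]
      supp_K[THEN conjunct2, THEN conjunct2, THEN bspec]
    have lp: "local_parametrization M (W i) (\<phi> i)" using pos[OF i] by (simp add: positive_parametrization_def)
    have "continuous_on M (\<lambda>p. \<rho> i p * f p)" by (intro continuous_intros \<rho>[OF i] f)
    note int = integral_global_volume_chart[OF lp Mb this K(1,2)]
    have "(LINT x:W i|lborel. (\<rho> i (\<phi> i x) * f (\<phi> i x)) * gram_jacobian (\<phi> i) x) =
      (LINT x:W i|lborel. \<rho> i (\<phi> i x) * (f (\<phi> i x) * \<omega> (\<phi> i x) (coord_frame (\<phi> i) x)))"
      using chart_open[OF chartI[OF lp]] positive_volume_form_coord_frame[OF \<omega> pos[OF i]]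
      by (intro set_lebesgue_integral_cong) auto
    then show ?thesis using int K(3) by simp
  qed
  have f_sum: "(\<Sum>i<N. \<rho> i p * f p) = f p" if p: "p \<in> M" for p
  proof (cases "f p = 0")
    case False
    have "(\<lambda>v. f p * \<omega> p v) \<noteq> (\<lambda>_. 0)"
    proof
      assume "(\<lambda>v. f p * \<omega> p v) = (\<lambda>_. 0)"
      then have "f p * \<omega> p v = 0" for v by (rule fun_cong)
      then have "\<omega> p = (\<lambda>_. 0)" using False by auto
      then show False using volume_form_nonzero[OF M \<omega> p] by blast
    qed
    then have "(\<Sum>i<N. \<rho> i p) = 1" using sum1 p by blast
    then show ?thesis by (simp flip: sum_distrib_right)
  qed simp
  have space: "space ?\<mu> = M" by (simp add: space_restrict_space)
  have "integrable ?\<mu> (\<lambda>p. \<Sum>i<N. \<rho> i p * f p)" using local by (intro Bochner_Integration.integrable_sum) auto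
  moreover have "integrable ?\<mu> (\<lambda>p. \<Sum>i<N. \<rho> i p * f p) \<longleftrightarrow> integrable ?\<mu> f"
    by (rule Bochner_Integration.integrable_cong) (use f_sum space in auto)
  ultimately show "integrable ?\<mu> f" by blast
  have "I = (\<Sum>i<N. LINT p|?\<mu>. \<rho> i p * f p)" unfolding I_eq using local by (intro sum.cong) auto
  also have "\<dots> = (LINT p|?\<mu>. (\<Sum>i<N. \<rho> i p * f p))"
    using local by (intro Bochner_Integration.integral_sum[symmetric]) auto
  also have "\<dots> = (LINT p|?\<mu>. f p)"
    by (rule Bochner_Integration.integral_cong) (use f_sum space in auto)
  finally show "I = (LINT p|?\<mu>. f p)" .
qed

text \<open>The partition over the support supplies some admissible value, and all admissible values
  coincide, which resolves the definite description.\<close>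

lemma form_integral_volume_form:
  fixes \<omega> :: "('m::finite, 'n::finite) form"
  assumes M: "submanifold TYPE('m) M" and \<omega>: "riemannian_volume_form M \<omega>"
    and f: "continuous_on M f" "compactly_supported M f"
  shows "integrable (restrict_space (global_volume TYPE('m)) M) f \<and>
    (LINT p|restrict_space (global_volume TYPE('m)) M. f p) = form_integral M \<omega> (\<lambda>p v. f p * \<omega> p v)"
proof -
  obtain K where K: "compact K" "K \<subseteq> M" "\<And>p. p \<in> M - K \<Longrightarrow> f p = 0"
    using f(2) unfolding compactly_supported_def by blast
  obtain N :: nat and W \<phi> and \<rho> :: "nat \<Rightarrow> real^'n \<Rightarrow> real" where part:
    "\<forall>i<N. positive_parametrization M \<omega> (W i) (\<phi> i) \<and>
      continuous_on M (\<rho> i) \<and> (\<forall>p\<in>M. 0 \<le> \<rho> i p \<and> \<rho> i p \<le> 1) \<and>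
      (\<exists>K. compact K \<and> K \<subseteq> \<phi> i ` W i \<and> (\<forall>p\<in>M - K. \<rho> i p = 0))"
    and part1: "\<forall>p\<in>K. (\<Sum>i<N. \<rho> i p) = 1"
    using positive_partition_of_unity[OF M \<omega> K(1,2)] by (elim exE conjE)
  let ?\<alpha> = "\<lambda>p v. f p * \<omega> p v"
  let ?I = "\<Sum>i<N. LINT x:W i|lborel. \<rho> i (\<phi> i x) * ?\<alpha> (\<phi> i x) (coord_frame (\<phi> i) x)"
  have sum1: "\<forall>p\<in>M. ?\<alpha> p \<noteq> (\<lambda>_. 0) \<longrightarrow> (\<Sum>i<N. \<rho> i p) = 1"
  proof (intro ballI impI)
    fix p assume p: "p \<in> M" "?\<alpha> p \<noteq> (\<lambda>_. 0)"
    have "p \<in> K"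
    proof (rule ccontr)
      assume "p \<notin> K"
      then have "f p = 0" using K(3) p(1) by blast
      then show False using p(2) by simp
    qed
    then show "(\<Sum>i<N. \<rho> i p) = 1" by (rule part1[THEN bspec])
  qed
  have I: "has_form_integral M \<omega> ?\<alpha> ?I"
    unfolding has_form_integral_def
    by (intro exI[of _ N] exI[of _ W] exI[of _ \<phi>] exI[of _ \<rho>])
      (rule conjI[OF part conjI[OF sum1 refl]])
  note val = has_form_integral_imp_integral[OF M \<omega> f(1)]
  have "form_integral M \<omega> ?\<alpha> = ?I"
    unfolding form_integral_def
  proof (rule the_equality)
    show "has_form_integral M \<omega> ?\<alpha> ?I" by (rule I)
  next
    fix J assume "has_form_integral M \<omega> ?\<alpha> J"
    from trans[OF val(2)[OF this] sym[OF val(2)[OF I]]] show "J = ?I" .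
  qed
  then show ?thesis using val[OF I] by simp
qed

text \<open>The restriction satisfies the requirement for every volume form. The given
  \<open>\<omega>\<close> is what pins down a competitor: it fixes the integrals of all compactly
  supported continuous functions.\<close>

lemma volume_measure_eq:
  fixes \<omega> :: "('m::finite, 'n::finite) form"
  assumes M: "submanifold TYPE('m) M" and \<omega>: "riemannian_volume_form M \<omega>"
  shows "volume_measure TYPE('m) M = restrict_space (global_volume TYPE('m)) M"
  unfolding volume_measure_def
proof (rule the_equality)
  let ?\<mu> = "restrict_space (global_volume TYPE('m)) M :: (real^'n) measure"
  have sets: "sets ?\<mu> = sets (restrict_space borel M)"
    by (rule sets_restrict_space_cong) simp
  show "sets ?\<mu> = sets (restrict_space borel M) \<and> (\<forall>(\<omega> :: ('m, 'n) form) f. riemannian_volume_form M \<omega> \<and>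
      continuous_on M f \<and> compactly_supported M f \<longrightarrow>
      integrable ?\<mu> f \<and> (LINT p|?\<mu>. f p) = form_integral M \<omega> (\<lambda>p v. f p * \<omega> p v))"
    using sets form_integral_volume_form[OF M] by blast
  fix \<nu> :: "(real^'n) measure"
  assume \<nu>: "sets \<nu> = sets (restrict_space borel M) \<and> (\<forall>(\<omega> :: ('m, 'n) form) f. riemannian_volume_form M \<omega> \<and>
      continuous_on M f \<and> compactly_supported M f \<longrightarrow>
      integrable \<nu> f \<and> (LINT p|\<nu>. f p) = form_integral M \<omega> (\<lambda>p v. f p * \<omega> p v))"
  show "\<nu> = ?\<mu>"
  proof (rule measure_eqI_compactly_supported[OF submanifold_locally_compact[OF M] _ sets])
    fix f assume f: "continuous_on M f" "compactly_supported M f"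
    have "integrable \<nu> f \<and> (LINT p|\<nu>. f p) = form_integral M \<omega> (\<lambda>p v. f p * \<omega> p v)"
      using \<nu>[THEN conjunct2, THEN spec[of _ \<omega>], THEN spec[of _ f]] \<omega> f by blast
    then show "integrable \<nu> f \<and> integrable ?\<mu> f \<and> (LINT p|\<nu>. f p) = (LINT p|?\<mu>. f p)"
      using form_integral_volume_form[OF M \<omega> f] by simp
  qed (use \<nu> in blast)
qed

section \<open>The inductive volume measure\<close>

lemma set_integral_sums_disjoint:
  fixes f :: "'a \<Rightarrow> real"
  assumes M: "disjoint_family M" "\<And>k::nat. M k \<in> sets \<mu>" and f: "set_integrable \<mu> (\<Union>k. M k) f"
  shows "(\<lambda>k. LINT x:M k|\<mu>. f x) sums (LINT x:(\<Union>k. M k)|\<mu>. f x)"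
proof -
  have sub: "set_integrable \<mu> (M k) f" for k
    using f M(2) by (rule set_integrable_subset) auto
  have fin: "(\<Sum>k<n. LINT x:M k|\<mu>. f x) = (LINT x:(\<Union>k<n. M k)|\<mu>. f x)" for n
    by (rule set_integral_finite_Union[symmetric])
      (use M sub in \<open>auto intro: disjoint_family_on_mono\<close>)
  have U: "(\<Union>n. \<Union>k<n. M k) = (\<Union>k. M k)" by blast
  have "incseq (\<lambda>n. \<Union>k<n. M k)" by (intro incseq_SucI UN_mono) auto
  then have "(\<lambda>n. LINT x:(\<Union>k<n. M k)|\<mu>. f x) \<longlonglongrightarrow> (LINT x:(\<Union>n. \<Union>k<n. M k)|\<mu>. f x)"
    by (intro set_integral_cont_up) (use M f U in auto)
  then show ?thesis unfolding sums_def fin U .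
qed

section \<open>Evaluating the inductive volume measure\<close>

context
  fixes \<Omega> :: "(real^'n::finite) set"
  assumes \<Omega>: "open \<Omega>"
begin

lemma Bo_iff: "A \<in> Bo \<Omega> \<longleftrightarrow> A \<in> sets borel \<and> A \<subseteq> \<Omega>"
  using \<Omega> by (auto simp: sets_restrict_space_iff)

lemma volume_measure_submanifolds_in:
  assumes "M \<in> submanifolds_in TYPE('m::finite) \<Omega>"
  shows "M \<in> Bo \<Omega>" "volume_measure TYPE('m) M = restrict_space (global_volume TYPE('m)) M"
proof -
  obtain \<omega> :: "('m, 'n) form" where M: "submanifold TYPE('m) M" "M \<subseteq> \<Omega>" "riemannian_volume_form M \<omega>"
    using assms unfolding submanifolds_in_def by blast
  show "M \<in> Bo \<Omega>"
    using M(2) locally_compact_borel[OF submanifold_locally_compact[OF M(1)]] by (simp add: Bo_iff)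
  show "volume_measure TYPE('m) M = restrict_space (global_volume TYPE('m)) M"
    by (rule volume_measure_eq[OF M(1,3)])
qed

lemma emeasure_volume_measure:
  assumes M: "M \<in> submanifolds_in TYPE('m::finite) \<Omega>" and A: "A \<in> sets borel" "A \<subseteq> M"
  shows "emeasure (volume_measure TYPE('m) M) A = emeasure (global_volume TYPE('m)) A"
  unfolding volume_measure_submanifolds_in(2)[OF M]
  using volume_measure_submanifolds_in(1)[OF M] A by (intro emeasure_restrict_space) (auto simp: Bo_iff)

lemma sets_volume_measure_in: "sets (volume_measure_in TYPE('m::finite) \<Omega> M) = Bo \<Omega>"
  by (simp add: volume_measure_in_def)

lemma emeasure_volume_measure_in:
  assumes M: "M \<in> submanifolds_in TYPE('m::finite) \<Omega>" and A: "A \<in> Bo \<Omega>"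
  shows "emeasure (volume_measure_in TYPE('m) \<Omega> M) A = emeasure (global_volume TYPE('m)) (A \<inter> M)"
proof -
  have sets: "sets (volume_measure TYPE('m) M) = sets (restrict_space borel M)"
    unfolding volume_measure_submanifolds_in(2)[OF M] by (rule sets_restrict_space_cong) simp
  have space: "space (volume_measure TYPE('m) M) = M"
    unfolding volume_measure_submanifolds_in(2)[OF M] by (simp add: space_restrict_space)
  have MB: "M \<in> sets borel" "M \<subseteq> \<Omega>" using volume_measure_submanifolds_in(1)[OF M] by (auto simp: Bo_iff)
  have meas: "(\<lambda>x. x) \<in> volume_measure TYPE('m) M \<rightarrow>\<^sub>M restrict_space borel \<Omega>"
  proof (rule measurable_restrict_space2)
    show "(\<lambda>x. x) \<in> space (volume_measure TYPE('m) M) \<rightarrow> \<Omega>" using space MB by auto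
    show "(\<lambda>x. x) \<in> volume_measure TYPE('m) M \<rightarrow>\<^sub>M borel"
      unfolding measurable_cong_sets[OF sets refl] by (rule measurable_restrict_space1) simp
  qed
  have "emeasure (volume_measure_in TYPE('m) \<Omega> M) A = emeasure (volume_measure TYPE('m) M) (A \<inter> M)"
    unfolding volume_measure_in_def using emeasure_distr[OF meas A] by (simp add: space)
  also have "\<dots> = emeasure (global_volume TYPE('m)) (A \<inter> M)"
    using A MB by (intro emeasure_volume_measure[OF M]) (auto simp: Bo_iff)
  finally show ?thesis .
qed

text \<open>By restriction from the common measure, every admissible \<open>S\<close> yields a value
  in which \<open>S\<close> no longer occurs.\<close>

lemma piece_measure_eq:
  assumes C: "C \<in> pieces TYPE('m::finite) \<Omega>" and A: "A \<in> Bo \<Omega>"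
  shows "piece_measure TYPE('m) \<Omega> C A = emeasure (global_volume TYPE('m)) (A \<inter> C)"
proof -
  obtain S where S: "S \<in> submanifolds_in TYPE('m) \<Omega>" "C \<subseteq> S" and CB: "C \<in> Bo \<Omega>"
    using C unfolding pieces_def by blast
  have AC: "A \<inter> C \<in> sets borel" using A CB by (auto simp: Bo_iff)
  have *: "emeasure (volume_measure TYPE('m) S') (A \<inter> C) = emeasure (global_volume TYPE('m)) (A \<inter> C)"
    if "S' \<in> submanifolds_in TYPE('m) \<Omega>" "C \<subseteq> S'" for S'
    by (rule emeasure_volume_measure[OF that(1) AC]) (use that(2) in blast)
  show ?thesis
    unfolding piece_measure_def
    by (rule the_equality) (use * S in \<open>simp, metis\<close>)
qed

lemma decompositions_sets:
  assumes "\<D> \<in> decompositions TYPE('m::finite) \<Omega> N"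
  shows "finite \<D>" "\<And>C. C \<in> \<D> \<Longrightarrow> C \<in> pieces TYPE('m) \<Omega>" "\<And>C. C \<in> \<D> \<Longrightarrow> C \<in> sets borel"
    "disjoint \<D>" "\<Union>\<D> = N"
  using assms by (auto simp: decompositions_def pieces_def Bo_iff)

lemma union_measure_eq:
  assumes N: "N \<in> piece_unions TYPE('m::finite) \<Omega>" and A: "A \<in> Bo \<Omega>"
  shows "union_measure TYPE('m) \<Omega> N A = emeasure (global_volume TYPE('m)) (A \<inter> N)"
proof -
  have *: "(\<Sum>C\<in>\<D>. piece_measure TYPE('m) \<Omega> C A) = emeasure (global_volume TYPE('m)) (A \<inter> N)"
    if D: "\<D> \<in> decompositions TYPE('m) \<Omega> N" for \<D>
  proof -
    note d = decompositions_sets[OF D]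
    have "(\<Sum>C\<in>\<D>. piece_measure TYPE('m) \<Omega> C A) = (\<Sum>C\<in>\<D>. emeasure (global_volume TYPE('m)) (A \<inter> C))"
      by (intro sum.cong refl piece_measure_eq d(2) A)
    also have "\<dots> = emeasure (global_volume TYPE('m)) (\<Union>C\<in>\<D>. A \<inter> C)"
    proof (rule sum_emeasure)
      show "(\<lambda>C. A \<inter> C) ` \<D> \<subseteq> sets (global_volume TYPE('m))" using d(3) A by (auto simp: Bo_iff)
      show "disjoint_family_on (\<lambda>C. A \<inter> C) \<D>"
        using d(4) by (auto simp: disjoint_family_on_def pairwise_def disjnt_def)
    qed (rule d(1))
    also have "(\<Union>C\<in>\<D>. A \<inter> C) = A \<inter> N" using d(5) by blast
    finally show ?thesis .
  qed
  obtain \<D> where "\<D> \<in> decompositions TYPE('m) \<Omega> N" using N unfolding piece_unions_def by blast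
  then show ?thesis
    unfolding union_measure_def using * by (intro the_equality) auto
qed

text \<open>Disjointness comes for free by peeling off one submanifold at a time. In the covering
  form, directedness of the index class is immediate.\<close>

lemma piece_unions_iff:
  "N \<in> piece_unions TYPE('m::finite) \<Omega> \<longleftrightarrow>
    N \<in> sets borel \<and> (\<exists>F. finite F \<and> F \<subseteq> submanifolds_in TYPE('m) \<Omega> \<and> N \<subseteq> \<Union>F)"
proof
  assume "N \<in> piece_unions TYPE('m) \<Omega>"
  then obtain \<D> where D: "\<D> \<in> decompositions TYPE('m) \<Omega> N" unfolding piece_unions_def by blast
  note d = decompositions_sets[OF D]
  have "\<forall>C\<in>\<D>. \<exists>S. S \<in> submanifolds_in TYPE('m) \<Omega> \<and> C \<subseteq> S" using d(2) unfolding pieces_def by blast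
  then obtain S where S: "\<forall>C\<in>\<D>. S C \<in> submanifolds_in TYPE('m) \<Omega> \<and> C \<subseteq> S C" by (rule bchoice[THEN exE])
  have "N \<in> sets borel" using d(1,3,5) by (metis sets.finite_Union subsetI)
  moreover have "finite (S ` \<D>)" "S ` \<D> \<subseteq> submanifolds_in TYPE('m) \<Omega>" "N \<subseteq> \<Union>(S ` \<D>)"
    using S d(1,5) by blast+
  ultimately show "N \<in> sets borel \<and> (\<exists>F. finite F \<and> F \<subseteq> submanifolds_in TYPE('m) \<Omega> \<and> N \<subseteq> \<Union>F)"
    by blast
next
  assume "N \<in> sets borel \<and> (\<exists>F. finite F \<and> F \<subseteq> submanifolds_in TYPE('m) \<Omega> \<and> N \<subseteq> \<Union>F)"
  then obtain F where N: "N \<in> sets borel" and F: "finite F" "F \<subseteq> submanifolds_in TYPE('m) \<Omega>" "N \<subseteq> \<Union>F"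
    by blast
  have "\<exists>\<D>. \<D> \<in> decompositions TYPE('m) \<Omega> N"
    using F N
  proof (induction F arbitrary: N rule: finite_induct)
    case empty
    then have "{} \<in> decompositions TYPE('m) \<Omega> N" by (auto simp: decompositions_def)
    then show ?case by blast
  next
    case (insert M F)
    have M: "M \<in> submanifolds_in TYPE('m) \<Omega>" using insert.prems by blast
    have MB: "M \<in> sets borel" "M \<subseteq> \<Omega>" using volume_measure_submanifolds_in(1)[OF M] by (auto simp: Bo_iff)
    \<comment> \<open>The remainder \<open>N - M\<close> is covered by \<open>F\<close> alone, and
      \<open>N \<inter> M\<close> becomes one further piece.\<close>
    obtain \<D> where D: "\<D> \<in> decompositions TYPE('m) \<Omega> (N - M)"
      using insert.IH[of "N - M"] insert.prems MB by blast
    note d = decompositions_sets[OF D]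
    have "N \<inter> M \<in> pieces TYPE('m) \<Omega>"
      unfolding pieces_def using insert.prems MB M by (auto simp: Bo_iff)
    moreover have "disjoint (insert (N \<inter> M) \<D>)"
      unfolding pairwise_insert using d(4,5) by (auto simp: disjnt_def)
    moreover have "\<Union>(insert (N \<inter> M) \<D>) = N" using d(5) by auto
    ultimately have "insert (N \<inter> M) \<D> \<in> decompositions TYPE('m) \<Omega> N"
      unfolding decompositions_def using d(1,2) by auto
    then show ?case by blast
  qed
  then show "N \<in> piece_unions TYPE('m) \<Omega>" unfolding piece_unions_def by blast
qed

lemma piece_unions_empty: "{} \<in> piece_unions TYPE('m::finite) \<Omega>"
  unfolding piece_unions_iff by (auto intro: exI[of _ "{}"])

lemma piece_unions_Un:
  assumes "N \<in> piece_unions TYPE('m::finite) \<Omega>" "N' \<in> piece_unions TYPE('m) \<Omega>"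
  shows "N \<union> N' \<in> piece_unions TYPE('m) \<Omega>"
proof -
  obtain F F' where "finite F" "F \<subseteq> submanifolds_in TYPE('m) \<Omega>" "N \<subseteq> \<Union>F" "N \<in> sets borel"
    "finite F'" "F' \<subseteq> submanifolds_in TYPE('m) \<Omega>" "N' \<subseteq> \<Union>F'" "N' \<in> sets borel"
    using assms unfolding piece_unions_iff by blast
  then have "finite (F \<union> F') \<and> F \<union> F' \<subseteq> submanifolds_in TYPE('m) \<Omega> \<and> N \<union> N' \<subseteq> \<Union>(F \<union> F')" "N \<union> N' \<in> sets borel"
    by auto
  then show ?thesis unfolding piece_unions_iff by blast
qed

text \<open>The net is increasing, so its limit is its supremum.\<close>

lemma Lim_union_measure:
  assumes A: "A \<in> Bo \<Omega>"
  shows "Lim (inclusion_net (piece_unions TYPE('m::finite) \<Omega>)) (\<lambda>N. union_measure TYPE('m) \<Omega> N A) =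
    (SUP N\<in>piece_unions TYPE('m) \<Omega>. emeasure (global_volume TYPE('m)) (A \<inter> N))"
proof -
  let ?P = "piece_unions TYPE('m) \<Omega>"
  let ?H = "\<lambda>N. emeasure (global_volume TYPE('m)) (A \<inter> N)"
  have ev: "eventually Q (inclusion_net ?P) \<longleftrightarrow> (\<exists>N\<in>?P. \<forall>N'\<in>?P. N \<subseteq> N' \<longrightarrow> Q N')" for Q
  proof -
    have "eventually Q (inclusion_net ?P) \<longleftrightarrow> (\<exists>N\<in>?P. eventually Q (principal {N' \<in> ?P. N \<subseteq> N'}))"
      unfolding inclusion_net_def
    proof (rule eventually_INF_base)
      show "?P \<noteq> {}" using piece_unions_empty by blast
      fix N N' assume "N \<in> ?P" "N' \<in> ?P"
      then show "\<exists>X\<in>?P. principal {N' \<in> ?P. X \<subseteq> N'} \<le>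
          inf (principal {N' \<in> ?P. N \<subseteq> N'}) (principal {N'' \<in> ?P. N' \<subseteq> N''})"
        by (intro bexI[of _ "N \<union> N'"] piece_unions_Un) auto
    qed
    then show ?thesis by (simp add: eventually_principal Ball_def imp_conjL)
  qed
  have mono: "?H N \<le> ?H N'" if "N' \<in> ?P" "N \<subseteq> N'" for N N'
    using that A unfolding piece_unions_iff by (intro emeasure_mono) (auto simp: Bo_iff)
  have "((\<lambda>N. union_measure TYPE('m) \<Omega> N A) \<longlongrightarrow> (SUP N\<in>?P. ?H N)) (inclusion_net ?P)"
  proof (rule order_tendstoI)
    fix a assume "a < (SUP N\<in>?P. ?H N)"
    then obtain N where N: "N \<in> ?P" "a < ?H N" unfolding less_SUP_iff by blast
    show "\<forall>\<^sub>F N in inclusion_net ?P. a < union_measure TYPE('m) \<Omega> N A"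
      unfolding ev
    proof (intro bexI[OF _ N(1)] ballI impI)
      fix N' assume N': "N' \<in> ?P" "N \<subseteq> N'"
      then show "a < union_measure TYPE('m) \<Omega> N' A"
        using N(2) mono[OF N'] union_measure_eq[OF N'(1) A] by (simp add: order.strict_trans2)
    qed
  next
    fix a assume a: "(SUP N\<in>?P. ?H N) < a"
    show "\<forall>\<^sub>F N in inclusion_net ?P. union_measure TYPE('m) \<Omega> N A < a"
      unfolding ev
    proof (intro bexI[OF _ piece_unions_empty] ballI impI)
      fix N assume N: "N \<in> ?P"
      then have "?H N \<le> (SUP N\<in>?P. ?H N)" by (rule SUP_upper)
      then show "union_measure TYPE('m) \<Omega> N A < a"
        using a union_measure_eq[OF N A] by simp
    qed
  qed
  \<comment> \<open>Limits along a filter are unique only if it is proper; the tails are nonempty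
    because each contains its own index.\<close>
  moreover have "inclusion_net ?P \<noteq> bot"
  proof
    assume "inclusion_net ?P = bot"
    then have "eventually (\<lambda>_. False) (inclusion_net ?P)" by simp
    then show False unfolding ev by blast
  qed
  ultimately show ?thesis by (intro tendsto_Lim)
qed

lemma sets_inductive_volume_measure:
  "sets (inductive_volume_measure TYPE('m::finite) \<Omega>) = Bo \<Omega>"
proof -
  have sub: "Bo \<Omega> \<subseteq> Pow \<Omega>" by (auto simp: Bo_iff)
  have "sigma_sets \<Omega> (Bo \<Omega>) = Bo \<Omega>"
    using sets.sigma_sets_eq[of "restrict_space borel \<Omega>"] by (simp add: space_restrict_space)
  then show ?thesis
    unfolding inductive_volume_measure_def using sub by (simp add: sets_measure_of)
qed

text \<open>\<open>measure_of\<close> yields the intended values only for a countably additive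
  function. This holds because a supremum over a directed family may be exchanged with a series of
  nonnegative terms.\<close>

lemma emeasure_inductive_volume_measure:
  assumes A: "A \<in> Bo \<Omega>"
  shows "emeasure (inductive_volume_measure TYPE('m::finite) \<Omega>) A =
    (SUP N\<in>piece_unions TYPE('m) \<Omega>. emeasure (global_volume TYPE('m)) (A \<inter> N))"
proof -
  let ?P = "piece_unions TYPE('m) \<Omega>" and ?G = "emeasure (global_volume TYPE('m))"
  let ?L = "\<lambda>A. Lim (inclusion_net ?P) (\<lambda>N. union_measure TYPE('m) \<Omega> N A)"
  have PB: "N \<in> sets borel" if "N \<in> ?P" for N using that unfolding piece_unions_iff by blast
  have "emeasure (inductive_volume_measure TYPE('m) \<Omega>) A = ?L A"
  proof (rule emeasure_measure_of[OF inductive_volume_measure_def])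
    show "Bo \<Omega> \<subseteq> Pow \<Omega>" by (auto simp: Bo_iff)
    show "A \<in> sets (inductive_volume_measure TYPE('m) \<Omega>)"
      unfolding sets_inductive_volume_measure by (rule A)
    have "?P \<noteq> {}" using piece_unions_empty by blast
    then have "?L {} = 0" by (simp add: Lim_union_measure Bo_iff)
    then show "positive (sets (inductive_volume_measure TYPE('m) \<Omega>)) ?L" by (simp add: positive_def)
    show "countably_additive (sets (inductive_volume_measure TYPE('m) \<Omega>)) ?L"
      unfolding sets_inductive_volume_measure
    proof (rule countably_additiveI)
      fix B :: "nat \<Rightarrow> _"
      assume B: "range B \<subseteq> Bo \<Omega>" "disjoint_family B" "\<Union>(range B) \<in> Bo \<Omega>"
      have Bi: "B i \<in> Bo \<Omega>" for i using B(1) by blast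
      have "(\<Sum>i. ?L (B i)) = (\<Sum>i. SUP N\<in>?P. ?G (B i \<inter> N))"
        by (intro suminf_cong Lim_union_measure Bi)
      also have "\<dots> = (SUP N\<in>?P. \<Sum>i. ?G (B i \<inter> N))"
      proof (rule ennreal_suminf_SUP_eq_directed)
        \<comment> \<open>The union of \<open>N\<close> and \<open>N'\<close> dominates both
          simultaneously in all terms of the series.\<close>
        fix X N N' assume N: "N \<in> ?P" "N' \<in> ?P"
        show "\<exists>N''\<in>?P. \<forall>n\<in>X. ?G (B n \<inter> N) \<le> ?G (B n \<inter> N'') \<and> ?G (B n \<inter> N') \<le> ?G (B n \<inter> N'')"
        proof (intro bexI[OF _ piece_unions_Un[OF N]] ballI conjI emeasure_mono)
          show "B n \<inter> (N \<union> N') \<in> sets (global_volume TYPE('m))" for n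
            using Bi[of n] PB[OF N(1)] PB[OF N(2)] by (auto simp: Bo_iff)
          then show "B n \<inter> (N \<union> N') \<in> sets (global_volume TYPE('m))" for n .
        qed auto
      qed
      also have "\<dots> = (SUP N\<in>?P. ?G (\<Union>(range B) \<inter> N))"
      proof (intro SUP_cong refl)
        fix N assume N: "N \<in> ?P"
        have "(\<Sum>i. ?G (B i \<inter> N)) = ?G (\<Union>i. B i \<inter> N)"
        proof (rule suminf_emeasure)
          show "range (\<lambda>i. B i \<inter> N) \<subseteq> sets (global_volume TYPE('m))"
            using Bi PB[OF N] by (auto simp: Bo_iff)
          show "disjoint_family (\<lambda>i. B i \<inter> N)"
            using B(2) unfolding disjoint_family_on_def by blast
        qed
        then show "(\<Sum>i. ?G (B i \<inter> N)) = ?G (\<Union>(range B) \<inter> N)" by (simp only: UN_simps)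
      qed
      also have "\<dots> = ?L (\<Union>(range B))" by (rule Lim_union_measure[OF B(3), symmetric])
      finally show "(\<Sum>i. ?L (B i)) = ?L (\<Union>(range B))" .
    qed
  qed
  then show ?thesis using Lim_union_measure[OF A] by simp
qed

text \<open>The partial unions of the \<open>M k\<close> are admissible indices that exhaust
  \<open>A\<close>, so continuity from below gives one inequality and monotonicity the other. On
  sets without such a cover the glued measure may be infinite by convention while the supremum is
  not.\<close>

lemma emeasure_inductive_volume_measure_covered:
  assumes A: "A \<in> Bo \<Omega>" and M: "\<And>k::nat. M k \<in> submanifolds_in TYPE('m::finite) \<Omega>" and cov: "A \<subseteq> (\<Union>k. M k)"
  shows "emeasure (inductive_volume_measure TYPE('m) \<Omega>) A = emeasure (global_volume TYPE('m)) A"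
proof -
  let ?P = "piece_unions TYPE('m) \<Omega>" and ?G = "emeasure (global_volume TYPE('m))"
  have MB: "M k \<in> sets borel" for k using volume_measure_submanifolds_in(1)[OF M] by (simp add: Bo_iff)
  have AB: "A \<in> sets borel" using A by (simp add: Bo_iff)
  have P: "(\<Union>k<n. M k) \<in> ?P" for n
    unfolding piece_unions_iff using M MB by (auto intro!: exI[of _ "M ` {..<n}"])
  have U: "(\<Union>n. A \<inter> (\<Union>k<n. M k)) = A" using cov by blast
  have "?G A = (SUP n. ?G (A \<inter> (\<Union>k<n. M k)))"
    using SUP_emeasure_incseq[of "\<lambda>n. A \<inter> (\<Union>k<n. M k)" "global_volume TYPE('m)"] AB MB U
    by (fastforce simp: incseq_def)
  also have "\<dots> \<le> (SUP N\<in>?P. ?G (A \<inter> N))"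
    using P by (intro SUP_least SUP_upper)
  finally have "?G A \<le> (SUP N\<in>?P. ?G (A \<inter> N))" .
  moreover have "(SUP N\<in>?P. ?G (A \<inter> N)) \<le> ?G A"
    using AB by (intro SUP_least emeasure_mono) auto
  ultimately show ?thesis using emeasure_inductive_volume_measure[OF A] by simp
qed

section \<open>Integration over sequences of submanifolds\<close>

text \<open>Turns every integral over a submanifold into a set integral against one fixed measure,
  so that convergence theorems for that measure apply.\<close>

lemma volume_measure_in_eq_density:
  assumes M: "M \<in> submanifolds_in TYPE('m::finite) \<Omega>"
  shows "volume_measure_in TYPE('m) \<Omega> M =
    density (inductive_volume_measure TYPE('m) \<Omega>) (\<lambda>x. ennreal (indicator M x))"
proof (rule measure_eqI)
  show "sets (volume_measure_in TYPE('m) \<Omega> M) =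
      sets (density (inductive_volume_measure TYPE('m) \<Omega>) (\<lambda>x. ennreal (indicator M x)))"
    by (simp add: sets_volume_measure_in sets_inductive_volume_measure)
  fix A assume "A \<in> sets (volume_measure_in TYPE('m) \<Omega> M)"
  then have A: "A \<in> Bo \<Omega>" by (simp add: sets_volume_measure_in)
  have MB: "M \<in> Bo \<Omega>" by (rule volume_measure_submanifolds_in(1)[OF M])
  have AM: "A \<inter> M \<in> Bo \<Omega>" using A MB by auto
  have iM: "(indicator M :: _ \<Rightarrow> real) \<in> borel_measurable (inductive_volume_measure TYPE('m) \<Omega>)"
    by (intro borel_measurable_indicator) (simp add: sets_inductive_volume_measure MB)
  have "emeasure (density (inductive_volume_measure TYPE('m) \<Omega>) (\<lambda>x. ennreal (indicator M x))) A =
      (\<integral>\<^sup>+x. ennreal (indicator M x) * indicator A x \<partial>inductive_volume_measure TYPE('m) \<Omega>)"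
    by (rule emeasure_density) (use A iM in \<open>auto simp: sets_inductive_volume_measure\<close>)
  also have "\<dots> = (\<integral>\<^sup>+x. indicator (A \<inter> M) x \<partial>inductive_volume_measure TYPE('m) \<Omega>)"
    by (rule nn_integral_cong) (auto simp: indicator_def)
  also have "\<dots> = emeasure (inductive_volume_measure TYPE('m) \<Omega>) (A \<inter> M)"
    using AM by (intro nn_integral_indicator) (simp add: sets_inductive_volume_measure)
  also have "\<dots> = emeasure (global_volume TYPE('m)) (A \<inter> M)"
    by (rule emeasure_inductive_volume_measure_covered[OF AM, of "\<lambda>_. M"]) (use M in auto)
  finally show "emeasure (volume_measure_in TYPE('m) \<Omega> M) A =
      emeasure (density (inductive_volume_measure TYPE('m) \<Omega>) (\<lambda>x. ennreal (indicator M x))) A"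
    using emeasure_volume_measure_in[OF M A] by simp
qed

lemma
  fixes f :: "real^'n \<Rightarrow> real"
  assumes M: "M \<in> submanifolds_in TYPE('m::finite) \<Omega>" and f: "f \<in> borel_measurable (restrict_space borel \<Omega>)"
  shows integrable_volume_measure_in: "integrable (volume_measure_in TYPE('m) \<Omega> M) f \<longleftrightarrow>
      set_integrable (inductive_volume_measure TYPE('m) \<Omega>) M f"
    and integral_volume_measure_in: "(LINT x|volume_measure_in TYPE('m) \<Omega> M. f x) =
      (LINT x:M|inductive_volume_measure TYPE('m) \<Omega>. f x)"
    and nn_integral_volume_measure_in: "(\<integral>\<^sup>+x. ennreal \<bar>f x\<bar> \<partial>volume_measure_in TYPE('m) \<Omega> M) =
      (\<integral>\<^sup>+x. ennreal \<bar>f x\<bar> * indicator M x \<partial>inductive_volume_measure TYPE('m) \<Omega>)"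
proof -
  let ?H = "inductive_volume_measure TYPE('m) \<Omega>"
  have fH: "f \<in> borel_measurable ?H"
    using f by (simp add: measurable_cong_sets[OF sets_inductive_volume_measure refl])
  have MH: "M \<in> sets ?H"
    using volume_measure_submanifolds_in(1)[OF M] by (simp add: sets_inductive_volume_measure)
  then have iH: "(indicator M :: _ \<Rightarrow> real) \<in> borel_measurable ?H"
    by (rule borel_measurable_indicator)
  show "integrable (volume_measure_in TYPE('m) \<Omega> M) f \<longleftrightarrow> set_integrable ?H M f"
    unfolding volume_measure_in_eq_density[OF M] set_integrable_def
    by (rule integrable_density[OF fH iH]) simp
  show "(LINT x|volume_measure_in TYPE('m) \<Omega> M. f x) = (LINT x:M|?H. f x)"
    unfolding volume_measure_in_eq_density[OF M] set_lebesgue_integral_def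
    by (rule integral_density[OF fH iH]) simp
  show "(\<integral>\<^sup>+x. ennreal \<bar>f x\<bar> \<partial>volume_measure_in TYPE('m) \<Omega> M) =
      (\<integral>\<^sup>+x. ennreal \<bar>f x\<bar> * indicator M x \<partial>?H)"
    unfolding volume_measure_in_eq_density[OF M]
    by (subst nn_integral_density) (use fH MH in \<open>auto simp: ennreal_indicator mult.commute\<close>)
qed

text \<open>Null overlaps within \<open>A\<close> mean that \<open>A \<inter> M k\<close> and
  \<open>A \<inter> disjointed M k\<close> differ by a null set, and the disjointed sets partition
  \<open>A\<close>.\<close>

lemma emeasure_inductive_volume_measure_series:
  assumes A: "A \<in> Bo \<Omega>" and M: "\<And>k::nat. M k \<in> submanifolds_in TYPE('m::finite) \<Omega>" and cov: "A \<subseteq> (\<Union>k. M k)"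
    and null: "\<And>j k. j \<noteq> k \<Longrightarrow> emeasure (volume_measure_in TYPE('m) \<Omega> (M k)) (A \<inter> M j \<inter> M k) = 0"
  shows "emeasure (inductive_volume_measure TYPE('m) \<Omega>) A =
    (\<Sum>k. emeasure (volume_measure_in TYPE('m) \<Omega> (M k)) (A \<inter> M k))"
proof -
  let ?G = "global_volume TYPE('m)"
  have MB: "M k \<in> sets borel" "M k \<subseteq> \<Omega>" for k
    using volume_measure_submanifolds_in(1)[OF M[of k]] by (simp_all add: Bo_iff)
  have AB: "A \<in> sets borel" using A by (simp add: Bo_iff)
  have null': "A \<inter> M j \<inter> M k \<in> null_sets ?G" if "j \<noteq> k" for j k
  proof (rule null_setsI)
    have "A \<inter> M j \<inter> M k \<in> Bo \<Omega>" using AB MB A by (auto simp: Bo_iff)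
    then show "emeasure ?G (A \<inter> M j \<inter> M k) = 0"
      using null[OF that] emeasure_volume_measure_in[OF M, of "A \<inter> M j \<inter> M k" k] by (simp add: Int_assoc)
  qed (use AB MB in auto)
  have "range (disjointed M) \<subseteq> sets borel" by (rule sets.range_disjointed_sets) (use MB in auto)
  then have DB: "disjointed M k \<in> sets borel" for k by blast
  have "emeasure ?G (A \<inter> disjointed M k) = emeasure ?G (A \<inter> M k)" for k
  proof -
    have n: "(\<Union>j\<in>{0..<k}. A \<inter> M j \<inter> M k) \<in> null_sets ?G"
      by (rule null_sets_UN') (auto intro!: null')
    have "A \<inter> disjointed M k = A \<inter> M k - (\<Union>j\<in>{0..<k}. A \<inter> M j \<inter> M k)"
      by (auto simp: disjointed_def)
    then show ?thesis using emeasure_Diff_null_set[OF n, of "A \<inter> M k"] AB MB by simp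
  qed
  then have "(\<Sum>k. emeasure ?G (A \<inter> M k)) = (\<Sum>k. emeasure ?G (A \<inter> disjointed M k))" by simp
  also have "\<dots> = emeasure ?G (\<Union>k. A \<inter> disjointed M k)"
  proof (rule suminf_emeasure)
    show "range (\<lambda>k. A \<inter> disjointed M k) \<subseteq> sets ?G" using AB DB by auto
    show "disjoint_family (\<lambda>k. A \<inter> disjointed M k)"
      using disjoint_family_disjointed[of M] unfolding disjoint_family_on_def by blast
  qed
  also have "(\<Union>k. A \<inter> disjointed M k) = A \<inter> (\<Union>k. disjointed M k)" by blast
  also have "\<dots> = A" using cov by (auto simp: UN_disjointed_eq)
  also have "emeasure ?G A = emeasure (inductive_volume_measure TYPE('m) \<Omega>) A"
    by (rule emeasure_inductive_volume_measure_covered[OF A M cov, symmetric])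
  finally have "emeasure (inductive_volume_measure TYPE('m) \<Omega>) A = (\<Sum>k. emeasure ?G (A \<inter> M k))" ..
  moreover have "emeasure (volume_measure_in TYPE('m) \<Omega> (M k)) (A \<inter> M k) = emeasure ?G (A \<inter> M k)" for k
    using emeasure_volume_measure_in[OF M, of "A \<inter> M k" k] AB MB A by (simp add: Bo_iff le_infI1)
  ultimately show ?thesis by simp
qed

text \<open>The integral of \<open>\<bar>f x\<bar>\<close> over the union is the sum of both given
  series, hence finite. The conclusion stays on the union because the measures of the
  \<open>M k\<close> do not see \<open>f\<close> elsewhere.\<close>

lemma set_integrable_inductive_volume_measure:
  fixes f :: "real^'n \<Rightarrow> real"
  assumes M: "\<And>k::nat. M k \<in> submanifolds_in TYPE('m::finite) \<Omega>" and disj: "disjoint_family M"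
    and int: "\<And>k. integrable (volume_measure_in TYPE('m) \<Omega> (M k)) f"
    and pos: "summable (\<lambda>k. LINT x|volume_measure_in TYPE('m) \<Omega> (M k). max (f x) 0)"
    and neg: "summable (\<lambda>k. LINT x|volume_measure_in TYPE('m) \<Omega> (M k). max (- f x) 0)"
  shows "set_integrable (inductive_volume_measure TYPE('m) \<Omega>) (\<Union>k. M k) f"
proof -
  let ?H = "inductive_volume_measure TYPE('m) \<Omega>" and ?V = "\<lambda>k. volume_measure_in TYPE('m) \<Omega> (M k)"
  have f: "f \<in> borel_measurable (restrict_space borel \<Omega>)"
    using borel_measurable_integrable[OF int[of 0]]
    by (simp add: measurable_cong_sets[OF sets_volume_measure_in refl])
  then have fH: "f \<in> borel_measurable ?H"
    by (simp add: measurable_cong_sets[OF sets_inductive_volume_measure refl])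
  have MH: "M k \<in> sets ?H" for k
    using volume_measure_submanifolds_in(1)[OF M[of k]] by (simp add: sets_inductive_volume_measure)
  define a where "a k = (LINT x|?V k. max (f x) 0) + (LINT x|?V k. max (- f x) 0)" for k
  have a: "(\<integral>\<^sup>+x. ennreal \<bar>f x\<bar> \<partial>?V k) = ennreal (a k)" "0 \<le> a k" for k
  proof -
    have "(LINT x|?V k. \<bar>f x\<bar>) = (LINT x|?V k. max (f x) 0 + max (- f x) 0)"
      by (rule Bochner_Integration.integral_cong) auto
    also have "\<dots> = a k"
      unfolding a_def using int[of k] by (intro Bochner_Integration.integral_add) auto
    finally have "(LINT x|?V k. \<bar>f x\<bar>) = a k" .
    then show "(\<integral>\<^sup>+x. ennreal \<bar>f x\<bar> \<partial>?V k) = ennreal (a k)"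
      using nn_integral_eq_integral[of "?V k" "\<lambda>x. \<bar>f x\<bar>"] int[of k] by simp
    show "0 \<le> a k" unfolding a_def by (intro add_nonneg_nonneg integral_nonneg_AE) auto
  qed
  have "summable a" unfolding a_def using pos neg by (rule summable_add)
  have "(\<integral>\<^sup>+x. ennreal \<bar>f x\<bar> * indicator (\<Union>k. M k) x \<partial>?H) = (\<Sum>k. \<integral>\<^sup>+x. ennreal \<bar>f x\<bar> * indicator (M k) x \<partial>?H)"
    by (rule nn_integral_disjoint_family) (use MH fH disj in auto)
  also have "\<dots> = (\<Sum>k. ennreal (a k))"
    using nn_integral_volume_measure_in[OF M f] a(1) by simp
  also have "\<dots> = ennreal (\<Sum>k. a k)"
    using a(2) \<open>summable a\<close> by (rule suminf_ennreal2)
  finally have fin: "(\<integral>\<^sup>+x. ennreal \<bar>f x\<bar> * indicator (\<Union>k. M k) x \<partial>?H) < \<infinity>" by simp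
  have "(\<integral>\<^sup>+x. ennreal (norm (indicator (\<Union>k. M k) x *\<^sub>R f x)) \<partial>?H) =
      (\<integral>\<^sup>+x. ennreal \<bar>f x\<bar> * indicator (\<Union>k. M k) x \<partial>?H)"
    by (rule nn_integral_cong) (auto simp: indicator_def)
  moreover have "(\<lambda>x. indicator (\<Union>k. M k) x *\<^sub>R f x) \<in> borel_measurable ?H"
    using fH MH by (intro borel_measurable_scaleR borel_measurable_indicator) auto
  ultimately show ?thesis
    unfolding set_integrable_def using fin by (intro integrableI_bounded) auto
qed

end

text \<open>In (i) the overlaps inside \<open>A\<close> have measure zero; otherwise a part of
  positive volume shared by two members, for example by repeating one, would be counted twice. In
  (ii) integrability over each submanifold is part of the claim, so that no integral is a default
  value. In (iii) integrability is meant on the union, the only place that the hypotheses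
  control.\<close>

theorem theorem3p1:
  fixes \<Omega> :: "(real^'n::finite) set"
  assumes "CARD('m::finite) \<le> CARD('n)" and "open \<Omega>"
  shows
    "(\<forall>A M.
        A \<in> Bo \<Omega> \<and> (\<forall>k::nat. M k \<in> submanifolds_in TYPE('m) \<Omega>) \<and> A \<subseteq> (\<Union>k. M k) \<and>
        (\<forall>j k. j \<noteq> k \<longrightarrow> emeasure (volume_measure_in TYPE('m) \<Omega> (M k)) (A \<inter> M j \<inter> M k) = 0) \<longrightarrow>
        emeasure (inductive_volume_measure TYPE('m) \<Omega>) A =
          (\<Sum>k. emeasure (volume_measure_in TYPE('m) \<Omega> (M k)) (A \<inter> M k)))
     \<and>
     (\<forall>(f :: real^'n \<Rightarrow> real) M.
        integrable (inductive_volume_measure TYPE('m) \<Omega>) f \<and>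
        (\<forall>k::nat. M k \<in> submanifolds_in TYPE('m) \<Omega>) \<and> disjoint_family M \<longrightarrow>
        (\<forall>k. integrable (volume_measure_in TYPE('m) \<Omega> (M k)) f) \<and>
        (\<lambda>k. LINT x|volume_measure_in TYPE('m) \<Omega> (M k). f x) sums
          (LINT x:(\<Union>k. M k)|inductive_volume_measure TYPE('m) \<Omega>. f x))
     \<and>
     (\<forall>(f :: real^'n \<Rightarrow> real) M.
        (\<forall>k::nat. M k \<in> submanifolds_in TYPE('m) \<Omega>) \<and> disjoint_family M \<and>
        (\<forall>k. integrable (volume_measure_in TYPE('m) \<Omega> (M k)) f) \<and>
        summable (\<lambda>k. LINT x|volume_measure_in TYPE('m) \<Omega> (M k). max (f x) 0) \<and>
        summable (\<lambda>k. LINT x|volume_measure_in TYPE('m) \<Omega> (M k). max (- f x) 0) \<longrightarrow>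
        set_integrable (inductive_volume_measure TYPE('m) \<Omega>) (\<Union>k. M k) f \<and>
        (\<lambda>k. LINT x|volume_measure_in TYPE('m) \<Omega> (M k). f x) sums
          (LINT x:(\<Union>k. M k)|inductive_volume_measure TYPE('m) \<Omega>. f x))"
proof -
  note \<Omega> = assms(2)
  let ?H = "inductive_volume_measure TYPE('m) \<Omega>" and ?V = "volume_measure_in TYPE('m) \<Omega>"
  have MH: "M \<in> sets ?H" if "M \<in> submanifolds_in TYPE('m) \<Omega>" for M
    using volume_measure_submanifolds_in(1)[OF \<Omega> that] by (simp add: sets_inductive_volume_measure[OF \<Omega>])
  have sums: "(\<lambda>k. LINT x|?V (M k). f x) sums (LINT x:(\<Union>k. M k)|?H. f x)"
    if M: "\<forall>k::nat. M k \<in> submanifolds_in TYPE('m) \<Omega>" and disj: "disjoint_family M"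
      and f: "f \<in> borel_measurable (restrict_space borel \<Omega>)" "set_integrable ?H (\<Union>k. M k) f"
    for f :: "real^'n \<Rightarrow> real" and M
    using set_integral_sums_disjoint[OF disj MH[OF M[rule_format]] f(2)]
    by (simp add: integral_volume_measure_in[OF \<Omega> M[rule_format] f(1)])
  show ?thesis
  proof (intro conjI allI impI; elim conjE)
    fix A M
    assume "A \<in> Bo \<Omega>" "\<forall>k::nat. M k \<in> submanifolds_in TYPE('m) \<Omega>" "A \<subseteq> (\<Union>k. M k)"
      "\<forall>j k. j \<noteq> k \<longrightarrow> emeasure (?V (M k)) (A \<inter> M j \<inter> M k) = 0"
    then show "emeasure ?H A = (\<Sum>k. emeasure (?V (M k)) (A \<inter> M k))"
      by (intro emeasure_inductive_volume_measure_series[OF \<Omega>]) blast+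
  next
    fix f :: "real^'n \<Rightarrow> real" and M
    assume f: "integrable ?H f" and M: "\<forall>k::nat. M k \<in> submanifolds_in TYPE('m) \<Omega>"
      and disj: "disjoint_family M"
    have fm: "f \<in> borel_measurable (restrict_space borel \<Omega>)"
      using borel_measurable_integrable[OF f]
      by (simp add: measurable_cong_sets[OF sets_inductive_volume_measure[OF \<Omega>] refl])
    have int: "set_integrable ?H X f" if "X \<in> sets ?H" for X
      unfolding set_integrable_def using that f by (rule integrable_mult_indicator)
    show "integrable (?V (M k)) f" for k
      unfolding integrable_volume_measure_in[OF \<Omega> M[rule_format] fm]
      by (rule int[OF MH[OF M[rule_format]]])
    show "(\<lambda>k. LINT x|?V (M k). f x) sums (LINT x:(\<Union>k. M k)|?H. f x)"
      by (rule sums[OF M disj fm int]) (use MH M in auto)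
  next
    fix f :: "real^'n \<Rightarrow> real" and M
    assume M: "\<forall>k::nat. M k \<in> submanifolds_in TYPE('m) \<Omega>" and disj: "disjoint_family M"
      and int: "\<forall>k. integrable (?V (M k)) f"
      and pn: "summable (\<lambda>k. LINT x|?V (M k). max (f x) 0)" "summable (\<lambda>k. LINT x|?V (M k). max (- f x) 0)"
    show U: "set_integrable ?H (\<Union>k. M k) f"
      by (rule set_integrable_inductive_volume_measure[OF \<Omega> M[rule_format] disj int[rule_format] pn])
    have fm: "f \<in> borel_measurable (restrict_space borel \<Omega>)"
      using borel_measurable_integrable[OF int[rule_format, of 0]]
      by (simp add: measurable_cong_sets[OF sets_volume_measure_in[OF \<Omega>] refl])
    show "(\<lambda>k. LINT x|?V (M k). f x) sums (LINT x:(\<Union>k. M k)|?H. f x)"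
      by (rule sums[OF M disj fm U])
  qed
qed

end
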